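(* Every $q$-matroid $\mathcal{M}=(E,\rho)$ is a direct sum of irreducible $q$-matroids, and the summands are unique up to equivalence: if $\mathcal{M}\approx\mathcal{M}_1\oplus\cdots\oplus\mathcal{M}_t$ and $\mathcal{M}\approx\mathcal{N}_1\oplus\cdots\oplus\mathcal{N}_s$ with all $\mathcal{M}_i,\mathcal{N}_j$ irreducible, then $s=t$ and, after reordering, $\mathcal{M}_i\approx\mathcal{N}_i$ for all $i$.
   Context: Let $\mathbb{F}=\mathbb{F}_q$. A $q$-matroid is $\mathcal{M}=(E,\rho)$, $E$ a finite-dimensional $\mathbb{F}$-vector space, $\rho$ defined on subspaces with $0\le\rho(V)\le\dim V$, monotone and submodular ($\rho(V+W)+\rho(V\cap W)\le\rho(V)+\rho(W)$). Two $q$-matroids $(E_1,\rho_1),(E_2,\rho_2)$ are equivalent ($\approx$) if there is an $\mathbb{F}$-isomorphism $\alpha:E_1\to E_2$ with $\rho_2(\alpha(V))=\rho_1(V)$ for all subspaces $V$. Direct sum: for $q$-matroids $\mathcal{M}_i=(E_i,\rho_i)$ and $E=E_1\oplus E_2$ with projections $\pi_i:E\to E_i$, $\mathcal{M}_1\oplus\mathcal{M}_2=(E,\rho)$ where $\rho(V)=\dim V+\min_{X\le V}(\rho_1(\pi_1(X))+\rho_2(\pi_2(X))-\dim X)$; this operation is associative, so iterated direct sums $\mathcal{M}_1\oplus\cdots\oplus\mathcal{M}_t$ are well defined. We write $\mathcal{M}=\mathcal{M}_1\oplus\mathcal{M}_2$ when $E$ is the internal direct sum of $E_1,E_2$ and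 the rank functions agree. A $q$-matroid is reducible if $\mathcal{M}=\mathcal{M}_1\oplus\mathcal{M}_2$ with both ground spaces nonzero, and irreducible otherwise.
   Formalization: Uniqueness is proved for irreducible summands with nonzero ground space, because the zero q-matroid counts as irreducible and M ≈ M ⊕ 0 would break s = t; ground spaces are taken, up to isomorphism, as finite-dimensional subspaces of the space of sequences over F. *)

theory Defs
  imports Main "HOL.Vector_Spaces" "HOL-Library.Function_Algebras"
begin

text \<open>Ambient universe: the F-vector space nat => F (F a finite field, F = F_q).
  Ground spaces of q-matroids are finite-dimensional subspaces of it; every
  finite-dimensional F-space is isomorphic to such a subspace.\<close>

definition fscale :: "'f::field \<Rightarrow> (nat \<Rightarrow> 'f) \<Rightarrow> (nat \<Rightarrow> 'f)" where
  "fscale c v = (\<lambda>i. c * v i)"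

global_interpretation fv: Vector_Spaces.vector_space "fscale :: 'f::field \<Rightarrow> (nat \<Rightarrow> 'f) \<Rightarrow> (nat \<Rightarrow> 'f)"
  by unfold_locales (auto simp: fscale_def fun_eq_iff algebra_simps)

type_synonym 'f qm = "(nat \<Rightarrow> 'f) set \<times> ((nat \<Rightarrow> 'f) set \<Rightarrow> nat)"

definition subspaces :: "(nat \<Rightarrow> 'f::field) set \<Rightarrow> (nat \<Rightarrow> 'f) set set" where
  "subspaces E = {V. fv.subspace V \<and> V \<subseteq> E}"

definition qmatroid :: "'f::field qm \<Rightarrow> bool" where
  "qmatroid M \<longleftrightarrow> (case M of (E, \<rho>) \<Rightarrow>
     (\<exists>B. finite B \<and> fv.span B = E) \<and>
     (\<forall>V\<in>subspaces E. \<rho> V \<le> fv.dim V) \<and>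
     (\<forall>V\<in>subspaces E. \<forall>W\<in>subspaces E. V \<subseteq> W \<longrightarrow> \<rho> V \<le> \<rho> W) \<and>
     (\<forall>V\<in>subspaces E. \<forall>W\<in>subspaces E.
        \<rho> (fv.span (V \<union> W)) + \<rho> (V \<inter> W) \<le> \<rho> V + \<rho> W))"

definition qm_equiv :: "'f::field qm \<Rightarrow> 'f qm \<Rightarrow> bool" where
  "qm_equiv M N \<longleftrightarrow> (case M of (E1, \<rho>1) \<Rightarrow> case N of (E2, \<rho>2) \<Rightarrow>
     (\<exists>\<alpha>. bij_betw \<alpha> E1 E2 \<and>
        (\<forall>x\<in>E1. \<forall>y\<in>E1. \<alpha> (x + y) = \<alpha> x + \<alpha> y) \<and>
        (\<forall>c. \<forall>x\<in>E1. \<alpha> (fscale c x) = fscale c (\<alpha> x)) \<and>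
        (\<forall>V\<in>subspaces E1. \<rho>2 (\<alpha> ` V) = \<rho>1 V)))"

definition ds_rank ::
  "((nat \<Rightarrow> 'f::field) \<Rightarrow> (nat \<Rightarrow> 'f)) \<Rightarrow> ((nat \<Rightarrow> 'f) \<Rightarrow> (nat \<Rightarrow> 'f)) \<Rightarrow>
   ((nat \<Rightarrow> 'f) set \<Rightarrow> nat) \<Rightarrow> ((nat \<Rightarrow> 'f) set \<Rightarrow> nat) \<Rightarrow> (nat \<Rightarrow> 'f) set \<Rightarrow> nat" where
  "ds_rank p1 p2 \<rho>1 \<rho>2 V = nat (int (fv.dim V) +
     Min {int (\<rho>1 (p1 ` X)) + int (\<rho>2 (p2 ` X)) - int (fv.dim X) | X. X \<in> subspaces V})"

text \<open>External direct sum, realised inside the universe by interleaving coordinates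
  (E1 (+) E2 is identified with {interleave u v}); projections take even/odd coordinates.\<close>
definition interleave :: "(nat \<Rightarrow> 'f) \<Rightarrow> (nat \<Rightarrow> 'f) \<Rightarrow> (nat \<Rightarrow> 'f)" where
  "interleave u v = (\<lambda>i. if even i then u (i div 2) else v (i div 2))"

definition evp :: "(nat \<Rightarrow> 'f) \<Rightarrow> (nat \<Rightarrow> 'f)" where "evp w = (\<lambda>i. w (2 * i))"
definition odp :: "(nat \<Rightarrow> 'f) \<Rightarrow> (nat \<Rightarrow> 'f)" where "odp w = (\<lambda>i. w (2 * i + 1))"

definition dsum :: "'f::field qm \<Rightarrow> 'f qm \<Rightarrow> 'f qm" where
  "dsum M N = (case M of (E1, \<rho>1) \<Rightarrow> case N of (E2, \<rho>2) \<Rightarrow>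
     ({interleave u v | u v. u \<in> E1 \<and> v \<in> E2}, ds_rank evp odp \<rho>1 \<rho>2))"

text \<open>Iterated direct sum M1 (+) (M2 (+) ( ... (+) Mt)) (associativity makes bracketing irrelevant).\<close>
fun dsum_list :: "'f::field qm list \<Rightarrow> 'f qm" where
  "dsum_list [] = ({0}, \<lambda>_. 0)"
| "dsum_list [M] = M"
| "dsum_list (M # Ms) = dsum M (dsum_list Ms)"

definition iproj :: "(nat \<Rightarrow> 'f::field) set \<Rightarrow> (nat \<Rightarrow> 'f) set \<Rightarrow> (nat \<Rightarrow> 'f) \<Rightarrow> (nat \<Rightarrow> 'f)" where
  "iproj E1 E2 w = (THE u. u \<in> E1 \<and> w - u \<in> E2)"

definition reducible :: "'f::field qm \<Rightarrow> bool" where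
  "reducible M \<longleftrightarrow> (case M of (E, \<rho>) \<Rightarrow>
     (\<exists>E1 \<rho>1 E2 \<rho>2. qmatroid (E1, \<rho>1) \<and> qmatroid (E2, \<rho>2) \<and>
        E1 \<noteq> {0} \<and> E2 \<noteq> {0} \<and> E1 \<subseteq> E \<and> E2 \<subseteq> E \<and>
        E1 \<inter> E2 = {0} \<and> fv.span (E1 \<union> E2) = E \<and>
        (\<forall>V\<in>subspaces E. \<rho> V = ds_rank (iproj E1 E2) (iproj E2 E1) \<rho>1 \<rho>2 V)))"

definition irreducible_qm :: "'f::field qm \<Rightarrow> bool" where
  "irreducible_qm M \<longleftrightarrow> qmatroid M \<and> \<not> reducible M"

end

theory Submission
  imports Defs "HOL-Library.Cardinality" "HOL-Library.FuncSet"
begin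

text \<open>Call a space cyclic if all its hyperplanes have the same rank as the space itself. Every space
  contains a cyclic space of the same nullity \<open>dim - \<rho>\<close>, so a q-matroid is determined by the ranks of
  its cyclic spaces; there a direct sum decomposition with projections \<open>p\<^sub>i\<close> simply says
  \<open>\<rho> X = \<Sum>\<^sub>i \<rho> (p\<^sub>i X)\<close>, and projections map cyclic spaces to cyclic spaces.
  For two decompositions \<open>p\<^sub>i\<close>, \<open>r\<^sub>j\<close> into irreducibles, a summand \<open>E\<^sub>i\<close> is a single loop, a single
  coloop, or cyclic and loop-free. In the last case submodularity forces \<open>p\<^sub>k r\<^sub>j E\<^sub>i\<close> to consist of loops
  for \<open>k \<noteq> i\<close>, so the maps \<open>p\<^sub>i r\<^sub>j\<close> restrict to a decomposition of \<open>E\<^sub>i\<close>; by irreducibility exactly one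
  of them is the identity, which matches \<open>E\<^sub>i\<close> with \<open>r\<^sub>j E\<close>. The number of loops is read off from the
  space of all loops, and the number of coloops then from the size of \<open>E\<close>.\<close>

(* Pointwise evaluation would rewrite even unapplied sums of vectors into abstractions. *)
declare plus_fun_apply [simp del] zero_fun_apply [simp del] minus_apply [simp del]

section \<open>Finite subspaces and their dimension\<close>

text \<open>The summands are not unique as subspaces: in the sum of a loop line and a coloop line,
  every complement of the loop line can serve as the coloop. So the subspaces of two decompositions
  cannot simply be identified. Instead one family of projections is compressed to a summand of the
  other, and loops appear as error terms that vanish only on loop-free summands. Loop and coloop
  lines have no canonical partners, but lines of equal rank are equivalent, so for them only the
  number matters.

  The minimum in the rank of a direct sum cannot be dropped on arbitrary subspaces: the diagonal
  line in the sum of two coloops has rank 1, although both of its projections have rank 1. On a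
  cyclic space every proper subspace has smaller nullity, which forces the minimum to be attained at
  the whole space. This is why rank identities are imposed on cyclic spaces only, and why it matters
  that projections keep spaces cyclic: identities can then be applied one after another.\<close>

lemma finite_span:
  fixes B :: "(nat \<Rightarrow> 'f::{field,finite}) set"
  assumes "finite B" shows "finite (fv.span B)"
  using assms
proof (induction B rule: finite_induct)
  case (insert a B)
  have "fv.span (insert a B) \<subseteq> (\<lambda>(k, y). fscale k a + y) ` (UNIV \<times> fv.span B)"
  proof
    fix x assume "x \<in> fv.span (insert a B)"
    then obtain k where k: "x - fscale k a \<in> fv.span B"
      by (auto simp: fv.span_insert)
    have "x = (\<lambda>(k, y). fscale k a + y) (k, x - fscale k a)" by simp
    then show "x \<in> (\<lambda>(k, y). fscale k a + y) ` (UNIV \<times> fv.span B)" using k by blast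
  qed
  then show ?case using insert by (meson finite_SigmaI finite_imageI finite_subset finite)
qed simp

text \<open>The representative \<open>x\<close> may lie in \<open>Y\<close>, and then
  \<open>Y = X\<close>; a proper hyperplane also needs \<open>x \<notin> Y\<close>. No dimension
  occurs in this form, so the condition pulls back along a linear map by choosing a preimage of
  \<open>x\<close>.\<close>

definition is_hyperplane ::
  "(nat \<Rightarrow> 'f::field) set \<Rightarrow> (nat \<Rightarrow> 'f) set \<Rightarrow> (nat \<Rightarrow> 'f) \<Rightarrow> bool" where
  "is_hyperplane Y X x \<longleftrightarrow> fv.subspace Y \<and> Y \<subseteq> X \<and> x \<in> X \<and> (\<forall>z\<in>X. \<exists>c. z - fscale c x \<in> Y)"

lemma card_hyperplane:
  fixes X :: "(nat \<Rightarrow> 'f::{field,finite}) set"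
  assumes X: "fv.subspace X" "finite X" and Y: "is_hyperplane Y X x" and x: "x \<notin> Y"
  shows "card X = CARD('f) * card Y"
proof -
  have sY: "fv.subspace Y" and YX: "Y \<subseteq> X" and xX: "x \<in> X"
    and cov: "\<And>z. z \<in> X \<Longrightarrow> \<exists>c. z - fscale c x \<in> Y"
    using Y by (auto simp: is_hyperplane_def)
  let ?h = "\<lambda>(k, y). fscale k x + y"
  have "inj_on ?h (UNIV \<times> Y)"
  proof (rule inj_onI, clarify)
    fix k y k' y' assume y: "y \<in> Y" "y' \<in> Y" and e: "fscale k x + y = fscale k' x + y'"
    have d: "fscale (k - k') x = y' - y"
      using e by (simp add: fv.scale_left_diff_distrib algebra_simps)
    have "k = k'"
    proof (rule ccontr)
      assume "k \<noteq> k'"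
      then have "x = fscale (inverse (k - k')) (fscale (k - k') x)"
        by (simp only: fv.scale_scale) simp
      then have "x = fscale (inverse (k - k')) (y' - y)" by (simp only: d)
      then show False using x y sY by (metis fv.subspace_diff fv.subspace_scale)
    qed
    with e show "k = k' \<and> y = y'" by simp
  qed
  moreover have "?h ` (UNIV \<times> Y) = X"
  proof
    show "?h ` (UNIV \<times> Y) \<subseteq> X"
      using X xX YX by (auto intro!: fv.subspace_add fv.subspace_scale)
    show "X \<subseteq> ?h ` (UNIV \<times> Y)"
    proof
      fix z assume "z \<in> X"
      then obtain c where c: "z - fscale c x \<in> Y" using cov by blast
      have "z = ?h (c, z - fscale c x)" by simp
      then show "z \<in> ?h ` (UNIV \<times> Y)" using c by blast
    qed
  qed
  ultimately have "card X = card ((UNIV :: 'f set) \<times> Y)"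
    by (metis card_image)
  then show ?thesis by (simp add: card_cartesian_product)
qed

lemma is_hyperplane_span_insert: "is_hyperplane (fv.span B) (fv.span (insert x B)) x"
  unfolding is_hyperplane_def
  by (auto intro: fv.span_base) (auto simp: fv.span_insert intro: exI[of _ 0])

lemma card_span_independent:
  fixes B :: "(nat \<Rightarrow> 'f::{field,finite}) set"
  assumes "finite B" "fv.independent B"
  shows "card (fv.span B) = CARD('f) ^ card B"
  using assms
proof (induction B rule: finite_induct)
  case (insert a B)
  then have "a \<notin> fv.span B" "fv.independent B"
    by (auto simp: fv.independent_insert split: if_splits)
  then show ?case
    using insert card_hyperplane[OF _ _ is_hyperplane_span_insert[of B a]]
    by (simp add: finite_span)
qed simp

lemma card_span_singleton: "x \<noteq> 0 \<Longrightarrow> card (fv.span {x :: nat \<Rightarrow> 'f::{field,finite}}) = CARD('f)"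
  using card_span_independent[of "{x}"] by simp

text \<open>Since \<open>CARD('f)\<close> is at least 2, the size of a subspace determines its
  dimension; the dimension formulas below come from counting elements.\<close>

lemma card_subspace:
  fixes V :: "(nat \<Rightarrow> 'f::{field,finite}) set"
  assumes "fv.subspace V" "finite V"
  shows "card V = CARD('f) ^ fv.dim V"
proof -
  obtain B where B: "B \<subseteq> V" "fv.independent B" "V \<subseteq> fv.span B" "card B = fv.dim V"
    using fv.basis_exists by blast
  then have "fv.span B = V" using assms(1) by (simp add: fv.span_minimal subset_antisym)
  then show ?thesis using card_span_independent[of B] B assms finite_subset by metis
qed

lemma two_le_card_field: "2 \<le> CARD('f::{field,finite})"
proof -
  have "card {0, 1::'f} \<le> CARD('f)" by (rule card_mono) auto
  then show ?thesis by simp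
qed

lemma dim_eqI_card:
  fixes V W :: "(nat \<Rightarrow> 'f::{field,finite}) set"
  assumes "fv.subspace V" "finite V" "fv.subspace W" "finite W" "card V = card W"
  shows "fv.dim V = fv.dim W"
proof -
  have "CARD('f) ^ fv.dim V = CARD('f) ^ fv.dim W"
    using assms card_subspace[of V] card_subspace[of W] by simp
  then show ?thesis using two_le_card_field[where 'f='f]
    by (metis Suc_1 Suc_le_lessD power_inject_exp)
qed

lemma dim_subset:
  fixes V W :: "(nat \<Rightarrow> 'f::{field,finite}) set"
  assumes "fv.subspace V" "fv.subspace W" "finite W" "V \<subseteq> W"
  shows "fv.dim V \<le> fv.dim W"
proof -
  have "CARD('f) ^ fv.dim V \<le> CARD('f) ^ fv.dim W"
    using assms card_subspace[of V] card_subspace[of W] card_mono[of W V] finite_subset by metis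
  then show ?thesis using two_le_card_field[where 'f='f]
    by (metis Suc_1 Suc_le_lessD power_le_imp_le_exp)
qed

lemma dim_hyperplane:
  fixes X :: "(nat \<Rightarrow> 'f::{field,finite}) set"
  assumes X: "fv.subspace X" "finite X" and Y: "is_hyperplane Y X x" and x: "x \<notin> Y"
  shows "fv.dim X = Suc (fv.dim Y)"
proof -
  have "fv.subspace Y" "finite Y" using X Y finite_subset by (auto simp: is_hyperplane_def)
  then have "CARD('f) ^ fv.dim X = CARD('f) ^ Suc (fv.dim Y)"
    using card_hyperplane[OF assms] card_subspace X by (metis power_Suc)
  then show ?thesis using two_le_card_field[where 'f='f]
    by (metis Suc_1 Suc_le_lessD power_inject_exp)
qed

lemma subspace_span_Un:
  assumes "fv.subspace A" "fv.subspace B"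
  shows "fv.span (A \<union> B) = {a + b | a b. a \<in> A \<and> b \<in> B}"
  using assms by (auto simp: fv.span_Un fv.span_eq_iff[THEN iffD2])

lemma finite_span_Un:
  assumes "fv.subspace A" "fv.subspace B" "finite A" "finite B"
  shows "finite (fv.span (A \<union> B))"
proof -
  have "fv.span (A \<union> B) = (\<lambda>(a, b). a + b) ` (A \<times> B)"
    using assms by (auto simp: subspace_span_Un)
  then show ?thesis using assms by simp
qed

text \<open>Counts the fibres of the addition map from \<open>A \<times> B\<close> onto the sum of
  \<open>A\<close> and \<open>B\<close>: each fibre is a copy of
  \<open>A \<inter> B\<close>.\<close>

lemma dim_modular:
  fixes A B :: "(nat \<Rightarrow> 'f::{field,finite}) set"
  assumes A: "fv.subspace A" "finite A" and B: "fv.subspace B" "finite B"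
  shows "fv.dim (fv.span (A \<union> B)) + fv.dim (A \<inter> B) = fv.dim A + fv.dim B"
proof -
  let ?S = "fv.span (A \<union> B)"
  have S: "?S = {a + b | a b. a \<in> A \<and> b \<in> B}" using A B by (simp add: subspace_span_Un)
  have fS: "finite ?S" using A B by (simp add: finite_span_Un)
  \<comment> \<open>\<open>s\<close> chooses one decomposition of each element of the sum; every
    other one differs from it by an element of \<open>A \<inter> B\<close>, the second coordinate of
    the bijection.\<close>
  define s where "s z = (SOME a. a \<in> A \<and> z - a \<in> B)" for z
  have s: "s z \<in> A \<and> z - s z \<in> B" if "z \<in> ?S" for z
  proof -
    have "\<exists>a. a \<in> A \<and> z - a \<in> B" using that by (auto simp: S)
    then show ?thesis unfolding s_def by (rule someI_ex)
  qed
  have "bij_betw (\<lambda>(z, w). (s z + w, z - s z - w)) (?S \<times> (A \<inter> B)) (A \<times> B)"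
  proof (rule bij_betw_byWitness[where f' = "\<lambda>(a, b). (a + b, a - s (a + b))"])
    show "(\<lambda>(z, w). (s z + w, z - s z - w)) ` (?S \<times> (A \<inter> B)) \<subseteq> A \<times> B"
      using s A B by (auto intro: fv.subspace_add fv.subspace_diff)
    show "(\<lambda>(a, b). (a + b, a - s (a + b))) ` (A \<times> B) \<subseteq> ?S \<times> (A \<inter> B)"
    proof clarify
      fix a b assume ab: "a \<in> A" "b \<in> B"
      then have z: "a + b \<in> ?S" by (auto simp: S)
      have "a - s (a + b) = (a + b - s (a + b)) - b" by simp
      then have "a - s (a + b) \<in> B" using s[OF z] ab B fv.subspace_diff by metis
      moreover have "a - s (a + b) \<in> A" using s[OF z] ab A fv.subspace_diff by metis
      ultimately show "a + b \<in> ?S \<and> a - s (a + b) \<in> A \<inter> B" using z by simp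
    qed
  qed auto
  from bij_betw_same_card[OF this]
  have "card ?S * card (A \<inter> B) = card A * card B"
    by (simp only: card_cartesian_product)
  moreover have "finite (A \<inter> B)" "fv.subspace (A \<inter> B)"
    using A B by (auto simp: fv.subspace_inter)
  ultimately have "CARD('f) ^ (fv.dim ?S + fv.dim (A \<inter> B)) = CARD('f) ^ (fv.dim A + fv.dim B)"
    using A B fS by (simp add: card_subspace power_add)
  then show ?thesis using two_le_card_field[where 'f='f]
    by (metis Suc_1 Suc_le_lessD power_inject_exp)
qed

section \<open>Linear maps on subspaces\<close>

definition linear_map_on ::
  "(nat \<Rightarrow> 'f::field) set \<Rightarrow> ((nat \<Rightarrow> 'f) \<Rightarrow> (nat \<Rightarrow> 'f)) \<Rightarrow> bool" where
  "linear_map_on V f \<longleftrightarrow> (\<forall>x\<in>V. \<forall>y\<in>V. f (x + y) = f x + f y) \<and>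
     (\<forall>c. \<forall>x\<in>V. f (fscale c x) = fscale c (f x))"

lemma linear_map_on_add: "linear_map_on V f \<Longrightarrow> x \<in> V \<Longrightarrow> y \<in> V \<Longrightarrow> f (x + y) = f x + f y"
  and linear_map_on_scale: "linear_map_on V f \<Longrightarrow> x \<in> V \<Longrightarrow> f (fscale c x) = fscale c (f x)"
  by (auto simp: linear_map_on_def)

lemma linear_map_on_0: "linear_map_on V f \<Longrightarrow> fv.subspace V \<Longrightarrow> f 0 = 0"
  using linear_map_on_scale[of V f 0 0] fv.subspace_0 by auto

lemma linear_map_on_diff:
  assumes "linear_map_on V f" "fv.subspace V" "x \<in> V" "y \<in> V"
  shows "f (x - y) = f x - f y"
  using linear_map_on_add[of V f "x - y" y] assms by (simp add: fv.subspace_diff)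

lemma linear_map_on_subset: "linear_map_on V f \<Longrightarrow> W \<subseteq> V \<Longrightarrow> linear_map_on W f"
  unfolding linear_map_on_def by blast

lemma linear_map_on_comp:
  "linear_map_on V f \<Longrightarrow> f ` V \<subseteq> W \<Longrightarrow> linear_map_on W g \<Longrightarrow> linear_map_on V (\<lambda>x. g (f x))"
  by (auto simp: linear_map_on_def image_subset_iff)

lemma linear_map_on_id: "linear_map_on V (\<lambda>x. x)"
  by (simp add: linear_map_on_def)

lemma linear_map_on_minus:
  "linear_map_on V f \<Longrightarrow> linear_map_on V g \<Longrightarrow> linear_map_on V (\<lambda>x. f x - g x)"
  by (auto simp: linear_map_on_def fv.scale_right_diff_distrib)

lemma linear_map_on_sum:
  "(\<And>i. i \<in> I \<Longrightarrow> linear_map_on V (f i)) \<Longrightarrow> linear_map_on V (\<lambda>x. \<Sum>i\<in>I. f i x)"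
  by (auto simp: linear_map_on_def fv.scale_sum_right simp flip: sum.distrib intro!: sum.cong)

lemma linear_map_on_apply_sum:
  assumes "linear_map_on V f" "fv.subspace V" "\<And>i. i \<in> I \<Longrightarrow> x i \<in> V"
  shows "f (\<Sum>i\<in>I. x i) = (\<Sum>i\<in>I. f (x i))"
  using assms(3)
proof (induction I rule: infinite_finite_induct)
  case (insert a I)
  then show ?case
    using assms linear_map_on_add[of V f "x a" "\<Sum>i\<in>I. x i"] by (simp add: fv.subspace_sum)
qed (use assms linear_map_on_0 in auto)

lemma subspace_image:
  assumes "linear_map_on V f" "fv.subspace W" "W \<subseteq> V"
  shows "fv.subspace (f ` W)"
proof (rule fv.subspaceI)
  have "f 0 = 0" using assms linear_map_on_0 linear_map_on_subset by blast
  then show "0 \<in> f ` W" using assms fv.subspace_0 by force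
next
  fix x y assume "x \<in> f ` W" "y \<in> f ` W"
  then obtain a b where "x = f a" "y = f b" "a \<in> W" "b \<in> W" by blast
  then show "x + y \<in> f ` W" using assms linear_map_on_add[of V f a b] fv.subspace_add
    by (metis image_eqI subsetD)
next
  fix c x assume "x \<in> f ` W"
  then obtain a where "x = f a" "a \<in> W" by blast
  then show "fscale c x \<in> f ` W" using assms linear_map_on_scale[of V f a c] fv.subspace_scale
    by (metis image_eqI subsetD)
qed

lemma subspace_preimage:
  assumes "linear_map_on V f" "fv.subspace V" "fv.subspace W"
  shows "fv.subspace {x \<in> V. f x \<in> W}"
  using assms linear_map_on_0[of V f]
  by (auto intro!: fv.subspaceI fv.subspace_add fv.subspace_scale
      simp: linear_map_on_add linear_map_on_scale fv.subspace_0)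

lemma dim_image_inj:
  fixes V :: "(nat \<Rightarrow> 'f::{field,finite}) set"
  assumes "linear_map_on V f" "fv.subspace V" "finite V" "inj_on f V"
  shows "fv.dim (f ` V) = fv.dim V"
  using assms by (intro dim_eqI_card) (auto simp: card_image intro: subspace_image)

lemma image_span_Un:
  assumes "linear_map_on V f" "fv.subspace A" "fv.subspace B" "A \<subseteq> V" "B \<subseteq> V"
  shows "f ` fv.span (A \<union> B) = fv.span (f ` A \<union> f ` B)"
proof -
  have "f (a + b) = f a + f b" if "a \<in> A" "b \<in> B" for a b
    using assms that linear_map_on_add by blast
  then have "f ` {a + b | a b. a \<in> A \<and> b \<in> B} = {a + b | a b. a \<in> f ` A \<and> b \<in> f ` B}"
    by (fastforce simp: image_iff)
  then show ?thesis
    using assms subspace_image[OF assms(1)] by (simp add: subspace_span_Un)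
qed

section \<open>Cyclic subspaces\<close>

lemma subspaces_trans: "V \<in> subspaces W \<Longrightarrow> W \<subseteq> E \<Longrightarrow> V \<in> subspaces E"
  by (auto simp: subspaces_def)

text \<open>Equivalently, every proper subspace of \<open>X\<close> has strictly smaller nullity \<open>dim - \<rho>\<close>.\<close>
definition cyclic :: "((nat \<Rightarrow> 'f::field) set \<Rightarrow> nat) \<Rightarrow> (nat \<Rightarrow> 'f) set \<Rightarrow> bool" where
  "cyclic \<rho> X \<longleftrightarrow> fv.subspace X \<and> (\<forall>Y x. is_hyperplane Y X x \<longrightarrow> \<rho> Y = \<rho> X)"

lemma cyclicD: "cyclic \<rho> X \<Longrightarrow> is_hyperplane Y X x \<Longrightarrow> \<rho> Y = \<rho> X"
  by (auto simp: cyclic_def)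

lemma qmatroidI:
  fixes E :: "(nat \<Rightarrow> 'f::{field,finite}) set"
  assumes "fv.subspace E" "finite E"
    and "\<And>V. V \<in> subspaces E \<Longrightarrow> \<rho> V \<le> fv.dim V"
    and "\<And>V W. V \<in> subspaces E \<Longrightarrow> W \<in> subspaces E \<Longrightarrow> V \<subseteq> W \<Longrightarrow> \<rho> V \<le> \<rho> W"
    and "\<And>V W. V \<in> subspaces E \<Longrightarrow> W \<in> subspaces E \<Longrightarrow>
        \<rho> (fv.span (V \<union> W)) + \<rho> (V \<inter> W) \<le> \<rho> V + \<rho> W"
  shows "qmatroid (E, \<rho>)"
proof -
  have "fv.span E = E" using assms(1) by (simp add: fv.span_eq_iff)
  then have "\<exists>B. finite B \<and> fv.span B = E" using assms(2) by blast
  then show ?thesis using assms unfolding qmatroid_def by simp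
qed

section \<open>Rank inequalities and the existence of cyclic subspaces\<close>

locale q_matroid =
  fixes E :: "(nat \<Rightarrow> 'f::{field,finite}) set" and \<rho> :: "(nat \<Rightarrow> 'f) set \<Rightarrow> nat"
  assumes qmatroid: "qmatroid (E, \<rho>)"
begin

lemma subspace_ground: "fv.subspace E"
  using qmatroid by (auto simp: qmatroid_def)

lemma finite_ground: "finite E"
  using qmatroid finite_span by (auto simp: qmatroid_def)

lemma ground_mem: "E \<in> subspaces E"
  by (simp add: subspaces_def subspace_ground)

lemma zero_mem: "{0} \<in> subspaces E"
  using subspace_ground fv.subspace_0 by (auto simp: subspaces_def)

lemma rank_le_dim: "V \<in> subspaces E \<Longrightarrow> \<rho> V \<le> fv.dim V"
  and rank_mono: "V \<in> subspaces E \<Longrightarrow> W \<in> subspaces E \<Longrightarrow> V \<subseteq> W \<Longrightarrow> \<rho> V \<le> \<rho> W"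
  and rank_submodular: "V \<in> subspaces E \<Longrightarrow> W \<in> subspaces E \<Longrightarrow>
        \<rho> (fv.span (V \<union> W)) + \<rho> (V \<inter> W) \<le> \<rho> V + \<rho> W"
  using qmatroid by (auto simp: qmatroid_def)

lemma subspacesD: "V \<in> subspaces E \<Longrightarrow> fv.subspace V" "V \<in> subspaces E \<Longrightarrow> V \<subseteq> E"
    "V \<in> subspaces E \<Longrightarrow> finite V"
  using finite_ground finite_subset by (auto simp: subspaces_def)

lemma span_Un_mem: "V \<in> subspaces E \<Longrightarrow> W \<in> subspaces E \<Longrightarrow> fv.span (V \<union> W) \<in> subspaces E"
  using fv.span_minimal[OF _ subspace_ground, of "V \<union> W"] by (auto simp: subspaces_def)

lemma Int_mem: "V \<in> subspaces E \<Longrightarrow> W \<in> subspaces E \<Longrightarrow> V \<inter> W \<in> subspaces E"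
  by (auto simp: subspaces_def fv.subspace_inter)

lemma image_mem:
  "linear_map_on V f \<Longrightarrow> V \<in> subspaces E \<Longrightarrow> f ` V \<subseteq> E \<Longrightarrow> f ` V \<in> subspaces E"
  using subspace_image[of V f V] by (auto simp: subspaces_def)

lemma rank_zero: "\<rho> {0} = 0"
proof -
  have "fv.dim {0 :: nat \<Rightarrow> 'f} = 0"
    by (rule fv.dim_unique[of "{}"]) (auto simp: fv.independent_empty)
  then show ?thesis using rank_le_dim[OF zero_mem] by simp
qed

lemma rank_subadditive:
  assumes "V \<in> subspaces E" "A \<in> subspaces E" "B \<in> subspaces E"
    and "\<And>x. x \<in> V \<Longrightarrow> \<exists>a\<in>A. \<exists>b\<in>B. x = a + b"
  shows "\<rho> V \<le> \<rho> A + \<rho> B"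
proof -
  have "V \<subseteq> fv.span (A \<union> B)"
    using assms subspacesD by (simp add: subspace_span_Un subset_iff) blast
  then have "\<rho> V \<le> \<rho> (fv.span (A \<union> B))" using assms span_Un_mem rank_mono by blast
  then show ?thesis using rank_submodular[of A B] assms by linarith
qed

text \<open>The image under a sum of maps lies in the sum of the images, where submodularity makes
  the rank subadditive.\<close>

lemma rank_image_sum_le:
  assumes V: "V \<in> subspaces E" and "finite I"
    and "\<And>i. i \<in> I \<Longrightarrow> linear_map_on V (f i)" "\<And>i. i \<in> I \<Longrightarrow> f i ` V \<subseteq> E"
  shows "\<rho> ((\<lambda>x. \<Sum>i\<in>I. f i x) ` V) \<le> (\<Sum>i\<in>I. \<rho> (f i ` V))"
  using assms(2-)
proof (induction I rule: finite_induct)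
  case empty
  have "(\<lambda>x. \<Sum>i\<in>{}. f i x) ` V = {0}" using V fv.subspace_0 by (auto simp: subspaces_def)
  then show ?case by (simp add: rank_zero)
next
  case (insert a I)
  let ?g = "\<lambda>x. \<Sum>i\<in>I. f i x" and ?h = "\<lambda>x. \<Sum>i\<in>insert a I. f i x"
  have lin: "linear_map_on V ?g" "linear_map_on V ?h"
    using insert by (intro linear_map_on_sum; simp)+
  have gE: "?g ` V \<subseteq> E" and hE: "?h ` V \<subseteq> E"
    using insert by (auto intro!: fv.subspace_sum[OF subspace_ground] fv.subspace_add[OF subspace_ground])
  have "\<rho> (?h ` V) \<le> \<rho> (f a ` V) + \<rho> (?g ` V)"
  proof (rule rank_subadditive)
    fix x assume "x \<in> ?h ` V"
    then obtain v where v: "v \<in> V" "x = ?h v" by blast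
    then have "x = f a v + ?g v" using insert by simp
    then show "\<exists>u\<in>f a ` V. \<exists>b\<in>?g ` V. x = u + b" using v by blast
  qed (use insert lin gE hE V in \<open>auto intro!: image_mem\<close>)
  then show ?case using insert by auto
qed

text \<open>Extending a basis of \<open>V\<close> to one of \<open>W\<close> adds a space
  \<open>U\<close> of dimension \<open>dim W - dim V\<close>, and submodularity gives
  \<open>\<rho> W \<le> \<rho> V + \<rho> U \<le> \<rho> V + dim U\<close>. The inequality says that
  \<open>dim - \<rho>\<close> is monotone, written without subtraction.\<close>

lemma nullity_mono:
  assumes "V \<in> subspaces E" "W \<in> subspaces E" "V \<subseteq> W"
  shows "\<rho> W + fv.dim V \<le> \<rho> V + fv.dim W"
proof -
  obtain S where S: "S \<subseteq> V" "fv.independent S" "V \<subseteq> fv.span S" "card S = fv.dim V"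
    using fv.basis_exists by blast
  obtain B where B: "S \<subseteq> B" "B \<subseteq> W" "fv.independent B" "W \<subseteq> fv.span B"
    using fv.maximal_independent_subset_extend[of S W] S assms by blast
  have fin: "finite B" using B assms subspacesD finite_subset by meson
  have spS: "fv.span S = V" and spB: "fv.span B = W"
    using S B assms subspacesD by (simp_all add: fv.span_minimal subset_antisym)
  let ?U = "fv.span (B - S)"
  have "?U \<subseteq> W" using fv.span_mono[of "B - S" B] spB by auto
  then have U: "?U \<in> subspaces E" using assms by (auto simp: subspaces_def)
  have "fv.span (V \<union> ?U) = W"
  proof
    show "fv.span (V \<union> ?U) \<subseteq> W"
      using \<open>?U \<subseteq> W\<close> assms subspacesD by (intro fv.span_minimal) auto
    have "B \<subseteq> V \<union> ?U" using S spS fv.span_superset[of "B - S"] by blast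
    then show "W \<subseteq> fv.span (V \<union> ?U)" using spB fv.span_mono by metis
  qed
  then have "\<rho> W \<le> \<rho> V + \<rho> ?U" using rank_submodular[OF assms(1) U] by simp
  moreover have "\<rho> ?U \<le> card (B - S)"
    using rank_le_dim[OF U] fv.dim_span_eq_card_independent[OF fv.independent_mono[OF B(3)], of "B - S"]
    by auto
  moreover have "fv.dim W = card B"
    using fv.dim_span_eq_card_independent[OF B(3)] spB by simp
  moreover have "card (B - S) + card S = card B"
    using B fin by (metis card_Diff_subset card_mono finite_subset le_add_diff_inverse2)
  ultimately show ?thesis using S by simp
qed

text \<open>A smallest subspace of the same nullity as \<open>V\<close> is cyclic: passing to a
  proper hyperplane lowers the rank by 0 or 1, and a drop by 1 would leave the nullity unchanged,
  against minimality.\<close>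

lemma exists_cyclic:
  assumes V: "V \<in> subspaces E"
  obtains X where "X \<in> subspaces V" "cyclic \<rho> X" "\<rho> X + fv.dim V = \<rho> V + fv.dim X"
proof -
  define P where "P X \<longleftrightarrow> X \<in> subspaces V \<and> \<rho> X + fv.dim V = \<rho> V + fv.dim X" for X
  have "P V" using V by (auto simp: P_def subspaces_def)
  then obtain X where X: "P X" "\<And>Y. P Y \<Longrightarrow> card X \<le> card Y"
    using arg_min_nat_lemma[of P V card] by metis
  have XE: "X \<in> subspaces E" and XV: "X \<in> subspaces V" using X V by (auto simp: P_def subspaces_def)
  have "\<rho> Y = \<rho> X" if Y: "is_hyperplane Y X x" for Y x
  \<comment> \<open>If the representative lies in \<open>Y\<close>, the hyperplane is all of
    \<open>X\<close>.\<close>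
  proof (cases "x \<in> Y")
    case True
    have "X \<subseteq> Y"
    proof
      fix z assume "z \<in> X"
      then obtain c where "z - fscale c x \<in> Y" using Y by (auto simp: is_hyperplane_def)
      moreover have "fscale c x \<in> Y" using True Y by (auto simp: is_hyperplane_def fv.subspace_scale)
      ultimately have "z - fscale c x + fscale c x \<in> Y"
        using Y fv.subspace_add by (metis is_hyperplane_def)
      then show "z \<in> Y" by simp
    qed
    then show ?thesis using Y by (auto simp: is_hyperplane_def)
  next
    case False
    have YX: "Y \<subset> X" and YV: "Y \<in> subspaces V" and YE: "Y \<in> subspaces E"
      using Y False XE XV by (auto simp: is_hyperplane_def subspaces_def)
    then have "card Y < card X" using XE subspacesD psubset_card_mono by blast
    then have "\<not> P Y" using X(2) by fastforce
    then have "\<rho> Y + fv.dim V \<noteq> \<rho> V + fv.dim Y" using YV by (simp add: P_def)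
    moreover have "fv.dim X = Suc (fv.dim Y)" using dim_hyperplane Y False XE subspacesD by blast
    moreover have "\<rho> Y \<le> \<rho> X" using rank_mono YX YE XE by blast
    moreover have "\<rho> X + fv.dim Y \<le> \<rho> Y + fv.dim X" using nullity_mono YX YE XE by blast
    ultimately show ?thesis using X(1) by (auto simp: P_def)
  qed
  then have "cyclic \<rho> X" using XE by (auto simp: cyclic_def subspaces_def)
  then show ?thesis using that X by (auto simp: P_def)
qed

text \<open>A proper subspace lies in a proper hyperplane \<open>Y\<close> of \<open>X\<close>.
  Nullity is monotone up to \<open>Y\<close>, and from \<open>Y\<close> to \<open>X\<close> it grows
  by one because the rank stays the same. This strictness later forces the minimum in
  \<open>ds_rank\<close> to be attained only at \<open>X\<close> itself.\<close>

lemma cyclic_nullity_less: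
  assumes X: "X \<in> subspaces E" "cyclic \<rho> X" and X': "X' \<in> subspaces X" "X' \<noteq> X"
  shows "\<rho> X + fv.dim X' < \<rho> X' + fv.dim X"
proof -
  \<comment> \<open>A largest proper subspace containing \<open>X'\<close> is a hyperplane, since
    adjoining any further vector already gives all of \<open>X\<close>.\<close>
  define P where "P Y \<longleftrightarrow> Y \<in> subspaces X \<and> X' \<subseteq> Y \<and> Y \<noteq> X" for Y
  have fX: "finite X" using X subspacesD by blast
  have "P X'" using X' by (auto simp: P_def)
  moreover have "\<forall>Y. P Y \<longrightarrow> card Y < card X"
    using fX by (auto simp: P_def subspaces_def intro!: psubset_card_mono)
  ultimately obtain Y where Y: "P Y" "\<And>Z. P Z \<Longrightarrow> card Z \<le> card Y"
    using Lattices_Big.ex_has_greatest_nat[of P X' card "card X"] by metis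
  then obtain x where x: "x \<in> X" "x \<notin> Y" by (auto simp: P_def subspaces_def)
  have sY: "fv.subspace Y" using Y by (auto simp: P_def subspaces_def)
  let ?Z = "fv.span (insert x Y)"
  have ZX: "?Z \<subseteq> X" using x Y X by (intro fv.span_minimal) (auto simp: P_def subspaces_def)
  have "Y \<subset> ?Z" using x fv.span_superset[of "insert x Y"] by blast
  then have "card Y < card ?Z" using fX ZX finite_subset psubset_card_mono by metis
  then have "\<not> P ?Z" using Y(2) by fastforce
  then have "?Z = X" using ZX Y \<open>Y \<subset> ?Z\<close> by (auto simp: P_def subspaces_def)
  moreover have "fv.span Y = Y" using sY by (simp add: fv.span_eq_iff)
  ultimately have hyp: "is_hyperplane Y X x" using is_hyperplane_span_insert[of Y x] by metis
  have "\<rho> Y = \<rho> X" using cyclicD X hyp by blast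
  moreover have "fv.dim X = Suc (fv.dim Y)" using dim_hyperplane hyp x X subspacesD by blast
  moreover have "\<rho> Y + fv.dim X' \<le> \<rho> X' + fv.dim Y"
    using Y X X' by (intro nullity_mono) (auto simp: P_def subspaces_def)
  ultimately show ?thesis by linarith
qed

text \<open>A hyperplane \<open>Y\<close> of \<open>g k X\<close> pulls back to a hyperplane
  \<open>X'\<close> of \<open>X\<close>, which has full rank. Recombining the images of
  \<open>X'\<close> gives \<open>\<rho> X \<le> \<rho> Y\<close> plus the ranks of the other
  components \<open>g i X\<close>; subtracting these with the help of the hypothesis on the rank sum
  leaves \<open>\<rho> (g k X) \<le> \<rho> Y\<close>.\<close>

lemma cyclic_image:
  assumes X: "X \<in> subspaces E" "cyclic \<rho> X" and I: "finite I" "k \<in> I"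
    and lin: "\<And>i. i \<in> I \<Longrightarrow> linear_map_on X (g i)" and gE: "\<And>i. i \<in> I \<Longrightarrow> g i ` X \<subseteq> E"
    and sum: "\<And>x. x \<in> X \<Longrightarrow> (\<Sum>i\<in>I. g i x) = x"
    and rank: "(\<Sum>i\<in>I. \<rho> (g i ` X)) \<le> \<rho> X"
  shows "cyclic \<rho> (g k ` X)"
proof -
  have sX: "fv.subspace X" using X by (simp add: subspaces_def)
  have gX: "g i ` X \<in> subspaces E" if "i \<in> I" for i using image_mem[OF lin X(1) gE] that by simp
  have "\<rho> Y = \<rho> (g k ` X)" if Y: "is_hyperplane Y (g k ` X) y" for Y y
  proof -
    obtain x0 where x0: "x0 \<in> X" "y = g k x0" using Y by (auto simp: is_hyperplane_def)
    have YE: "Y \<in> subspaces E" and Ysub: "Y \<subseteq> g k ` X"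
      using Y gE[OF I(2)] by (auto simp: is_hyperplane_def subspaces_def)
    define X' where "X' = {x \<in> X. g k x \<in> Y}"
    have sX': "fv.subspace X'"
      unfolding X'_def using subspace_preimage lin I sX YE by (auto simp: subspaces_def)
    then have X'E: "X' \<in> subspaces E" "X' \<subseteq> X" using X by (auto simp: X'_def subspaces_def)
    have "\<exists>c. z - fscale c x0 \<in> X'" if z: "z \<in> X" for z
    proof -
      obtain c where "g k z - fscale c (g k x0) \<in> Y"
        using Y z x0 by (auto simp: is_hyperplane_def)
      then have "g k (z - fscale c x0) \<in> Y"
        using linear_map_on_diff[OF lin[OF I(2)] sX z, of "fscale c x0"]
          linear_map_on_scale[OF lin[OF I(2)] x0(1)] x0 sX by (simp add: fv.subspace_scale)
      then show ?thesis using z x0 sX by (auto simp: X'_def intro!: fv.subspace_diff fv.subspace_scale)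
    qed
    then have "is_hyperplane X' X x0" using x0 sX' X'E by (simp add: is_hyperplane_def)
    then have "\<rho> X = \<rho> X'" using cyclicD X by metis
    also have "\<dots> = \<rho> ((\<lambda>x. \<Sum>i\<in>I. g i x) ` X')"
      using image_cong[of X' X' "\<lambda>x. \<Sum>i\<in>I. g i x" "\<lambda>x. x"] sum X'E
      by (simp add: subset_iff)
    also have "\<dots> \<le> (\<Sum>i\<in>I. \<rho> (g i ` X'))"
      using X'E I lin gE linear_map_on_subset by (intro rank_image_sum_le) blast+
    also have "\<dots> = \<rho> (g k ` X') + (\<Sum>i\<in>I - {k}. \<rho> (g i ` X'))"
      using I by (simp add: sum.remove)
    also have "\<dots> \<le> \<rho> Y + (\<Sum>i\<in>I - {k}. \<rho> (g i ` X))"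
    proof (intro add_mono sum_mono rank_mono)
      have *: "g i ` X' \<in> subspaces E" if "i \<in> I" for i
        using that X'E lin gE linear_map_on_subset by (intro image_mem) (blast)+
      show "g k ` X' \<in> subspaces E" using * I by blast
      show "g i ` X' \<in> subspaces E" "g i ` X \<in> subspaces E" if "i \<in> I - {k}" for i
        using * gX that by blast+
    qed (use YE X'E in \<open>auto simp: X'_def\<close>)
    finally have "\<rho> X \<le> \<rho> Y + (\<Sum>i\<in>I - {k}. \<rho> (g i ` X))" .
    moreover have "(\<Sum>i\<in>I. \<rho> (g i ` X)) = \<rho> (g k ` X) + (\<Sum>i\<in>I - {k}. \<rho> (g i ` X))"
      using I by (simp add: sum.remove)
    ultimately have "\<rho> (g k ` X) \<le> \<rho> Y" using rank by linarith
    then show ?thesis using rank_mono[OF YE gX[OF I(2)] Ysub] by simp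
  qed
  then show ?thesis using gX[OF I(2)] by (auto simp: cyclic_def subspaces_def)
qed

lemma q_matroid_restrict: "E' \<in> subspaces E \<Longrightarrow> q_matroid E' \<rho>"
  using finite_ground rank_le_dim rank_mono rank_submodular
  by (intro q_matroid.intro qmatroidI) (auto simp: subspaces_def intro: finite_subset)

end

section \<open>Equivalences and direct sums\<close>

definition qm_iso :: "((nat \<Rightarrow> 'f::field) \<Rightarrow> (nat \<Rightarrow> 'f)) \<Rightarrow> 'f qm \<Rightarrow> 'f qm \<Rightarrow> bool" where
  "qm_iso \<alpha> M N \<longleftrightarrow> bij_betw \<alpha> (fst M) (fst N) \<and> linear_map_on (fst M) \<alpha> \<and>
     (\<forall>V\<in>subspaces (fst M). snd N (\<alpha> ` V) = snd M V)"

lemma qm_equiv_iff_iso: "qm_equiv M N \<longleftrightarrow> (\<exists>\<alpha>. qm_iso \<alpha> M N)"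
  by (auto simp: qm_equiv_def qm_iso_def linear_map_on_def split: prod.splits)

lemma qm_equiv_refl: "qm_equiv M M"
  unfolding qm_equiv_iff_iso qm_iso_def by (rule exI[of _ "\<lambda>x. x"]) (auto simp: linear_map_on_id bij_betw_def)

lemma qm_iso_comp:
  assumes "qm_iso \<alpha> L M" "qm_iso \<beta> M N"
  shows "qm_iso (\<lambda>x. \<beta> (\<alpha> x)) L N"
proof -
  have "\<alpha> ` V \<in> subspaces (fst M)" if "V \<in> subspaces (fst L)" for V
    using that assms subspace_image[of "fst L" \<alpha> V] by (auto simp: qm_iso_def subspaces_def bij_betw_def)
  then show ?thesis
    using assms bij_betw_trans[of \<alpha> "fst L" "fst M" \<beta> "fst N"]
      linear_map_on_comp[of "fst L" \<alpha> "fst M" \<beta>]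
    by (auto simp: qm_iso_def comp_def bij_betw_def simp flip: image_image[of \<beta> \<alpha>])
qed

lemma qm_equiv_trans: "qm_equiv L M \<Longrightarrow> qm_equiv M N \<Longrightarrow> qm_equiv L N"
  using qm_iso_comp unfolding qm_equiv_iff_iso by blast

lemma linear_map_on_inv_into:
  assumes "bij_betw f V W" "linear_map_on V f" "fv.subspace V"
  shows "linear_map_on W (inv_into V f)"
proof -
  let ?g = "inv_into V f"
  have g: "?g y \<in> V" "f (?g y) = y" if "y \<in> W" for y
    using assms(1) that by (auto simp: bij_betw_def inv_into_into f_inv_into_f)
  have gf: "?g (f x) = x" if "x \<in> V" for x
    using assms(1) that by (auto simp: bij_betw_def)
  show ?thesis unfolding linear_map_on_def
  proof (intro conjI ballI allI)
    fix x y assume "x \<in> W" "y \<in> W"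
    then have "f (?g x + ?g y) = x + y" using g assms by (simp add: linear_map_on_add)
    moreover have "?g x + ?g y \<in> V" using g assms \<open>x \<in> W\<close> \<open>y \<in> W\<close> by (simp add: fv.subspace_add)
    ultimately show "?g (x + y) = ?g x + ?g y" using gf by metis
  next
    fix c x assume "x \<in> W"
    then have "f (fscale c (?g x)) = fscale c x" using g assms by (simp add: linear_map_on_scale)
    moreover have "fscale c (?g x) \<in> V" using g assms \<open>x \<in> W\<close> by (simp add: fv.subspace_scale)
    ultimately show "?g (fscale c x) = fscale c (?g x)" using gf by metis
  qed
qed

lemma qm_equiv_sym:
  assumes "qm_equiv M N" "fv.subspace (fst M)"
  shows "qm_equiv N M"
proof -
  obtain \<alpha> where \<alpha>: "qm_iso \<alpha> M N" using assms by (auto simp: qm_equiv_iff_iso)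
  let ?g = "inv_into (fst M) \<alpha>"
  have bij: "bij_betw \<alpha> (fst M) (fst N)" and lin: "linear_map_on (fst M) \<alpha>"
    using \<alpha> by (auto simp: qm_iso_def)
  have lg: "linear_map_on (fst N) ?g" using linear_map_on_inv_into bij lin assms(2) by blast
  have "snd M (?g ` V) = snd N V" if V: "V \<in> subspaces (fst N)" for V
  proof -
    have gV: "\<alpha> ` ?g ` V = V"
      using V bij by (intro image_inv_into_cancel) (auto simp: subspaces_def bij_betw_def)
    have "?g ` V \<in> subspaces (fst M)"
      using V lg subspace_image[of "fst N" ?g V] bij_betw_inv_into[OF bij]
      by (auto simp: subspaces_def bij_betw_def)
    then show ?thesis using \<alpha> gV by (metis qm_iso_def)
  qed
  then have "qm_iso ?g N M" using lg bij_betw_inv_into[OF bij] by (simp add: qm_iso_def)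
  then show ?thesis by (auto simp: qm_equiv_iff_iso)
qed

section \<open>The rank function of a direct sum\<close>

lemma subspaces_image:
  assumes "linear_map_on V f" "fv.subspace V" "inj_on f V"
  shows "subspaces (f ` V) = (\<lambda>X. f ` X) ` subspaces V"
proof
  show "(\<lambda>X. f ` X) ` subspaces V \<subseteq> subspaces (f ` V)"
    using assms subspace_image[of V f] by (auto simp: subspaces_def)
  show "subspaces (f ` V) \<subseteq> (\<lambda>X. f ` X) ` subspaces V"
  proof
    fix Y assume Y: "Y \<in> subspaces (f ` V)"
    have "{x \<in> V. f x \<in> Y} \<in> subspaces V"
      using Y assms subspace_preimage by (auto simp: subspaces_def)
    moreover have "Y = f ` {x \<in> V. f x \<in> Y}" using Y by (auto simp: subspaces_def)
    ultimately show "Y \<in> (\<lambda>X. f ` X) ` subspaces V" by blast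
  qed
qed

lemma ds_rank_image:
  fixes V :: "(nat \<Rightarrow> 'f::{field,finite}) set"
  assumes "linear_map_on V \<alpha>" "fv.subspace V" "finite V" "inj_on \<alpha> V"
  shows "ds_rank p1 p2 \<rho>1 \<rho>2 (\<alpha> ` V) = ds_rank (\<lambda>x. p1 (\<alpha> x)) (\<lambda>x. p2 (\<alpha> x)) \<rho>1 \<rho>2 V"
proof -
  have "fv.dim (\<alpha> ` X) = fv.dim X" if "X \<in> subspaces V" for X
    using that assms by (intro dim_image_inj)
      (auto simp: subspaces_def intro: linear_map_on_subset finite_subset inj_on_subset)
  moreover have "V \<in> subspaces V" using assms by (simp add: subspaces_def)
  ultimately have "fv.dim (\<alpha> ` V) = fv.dim V"
    and "(\<lambda>X. int (\<rho>1 (p1 ` X)) + int (\<rho>2 (p2 ` X)) - int (fv.dim X)) ` (\<lambda>X. \<alpha> ` X) ` subspaces V =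
      (\<lambda>X. int (\<rho>1 ((\<lambda>x. p1 (\<alpha> x)) ` X)) + int (\<rho>2 ((\<lambda>x. p2 (\<alpha> x)) ` X)) - int (fv.dim X)) ` subspaces V"
    unfolding image_image[of _ "\<lambda>X. \<alpha> ` X"] by (auto simp: image_image intro!: image_cong)
  then show ?thesis
    unfolding ds_rank_def Setcompr_eq_image subspaces_image[OF assms(1,2,4)] by (simp only:)
qed

lemma ds_rank_cong:
  assumes "\<And>x. x \<in> V \<Longrightarrow> f x = f' x" "\<And>x. x \<in> V \<Longrightarrow> g x = g' x"
    "\<And>X. X \<in> subspaces V \<Longrightarrow> \<rho>1 (f ` X) = \<rho>1' (f ` X)"
    "\<And>X. X \<in> subspaces V \<Longrightarrow> \<rho>2 (g ` X) = \<rho>2' (g ` X)"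
  shows "ds_rank f g \<rho>1 \<rho>2 V = ds_rank f' g' \<rho>1' \<rho>2' V"
proof -
  have "f ` X = f' ` X \<and> g ` X = g' ` X" if "X \<in> subspaces V" for X
    using that assms by (intro conjI image_cong) (auto simp: subspaces_def)
  then show ?thesis unfolding ds_rank_def Setcompr_eq_image using assms(3,4)
    by (simp cong: image_cong)
qed

context
  fixes V :: "(nat \<Rightarrow> 'f::{field,finite}) set"
  assumes V: "fv.subspace V" "finite V"
begin

lemma ds_rank_set_finite: "finite {int (\<rho>1 (f ` X)) + int (\<rho>2 (g ` X)) - int (fv.dim X) | X. X \<in> subspaces V}"
proof -
  have "subspaces V \<subseteq> Pow V" by (auto simp: subspaces_def)
  then have "finite (subspaces V)" using V finite_subset by blast
  then show ?thesis by (simp add: Setcompr_eq_image)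
qed

lemma ds_rank_attained:
  obtains X where "X \<in> subspaces V"
    "ds_rank f g \<rho>1 \<rho>2 V + fv.dim X = \<rho>1 (f ` X) + \<rho>2 (g ` X) + fv.dim V"
proof -
  let ?S = "{int (\<rho>1 (f ` X)) + int (\<rho>2 (g ` X)) - int (fv.dim X) | X. X \<in> subspaces V}"
  have "?S \<noteq> {}" using V by (auto simp: subspaces_def)
  then have "Min ?S \<in> ?S" using ds_rank_set_finite by (rule Min_in[rotated])
  then obtain X where X: "X \<in> subspaces V"
    "Min ?S = int (\<rho>1 (f ` X)) + int (\<rho>2 (g ` X)) - int (fv.dim X)" by blast
  \<comment> \<open>With this bound the integer under \<open>nat\<close> in \<open>ds_rank\<close>
    is nonnegative, so the conversion truncates nothing.\<close>
  moreover have "fv.dim X \<le> fv.dim V" using X V by (intro dim_subset) (auto simp: subspaces_def)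
  ultimately show ?thesis using that[of X] by (simp add: ds_rank_def)
qed

lemma ds_rank_le:
  assumes "X \<in> subspaces V"
  shows "ds_rank f g \<rho>1 \<rho>2 V + fv.dim X \<le> \<rho>1 (f ` X) + \<rho>2 (g ` X) + fv.dim V"
proof -
  let ?S = "{int (\<rho>1 (f ` X)) + int (\<rho>2 (g ` X)) - int (fv.dim X) | X. X \<in> subspaces V}"
  have "Min ?S \<le> int (\<rho>1 (f ` X)) + int (\<rho>2 (g ` X)) - int (fv.dim X)"
    using assms by (intro Min_le ds_rank_set_finite) auto
  moreover have "fv.dim X \<le> fv.dim V" using assms V by (intro dim_subset) (auto simp: subspaces_def)
  ultimately show ?thesis by (simp add: ds_rank_def)
qed

lemma ds_rank_eqI:
  assumes "\<And>X. X \<in> subspaces V \<Longrightarrow> r + fv.dim X \<le> \<rho>1 (f ` X) + \<rho>2 (g ` X) + fv.dim V"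
    and "X0 \<in> subspaces V" "r + fv.dim X0 = \<rho>1 (f ` X0) + \<rho>2 (g ` X0) + fv.dim V"
  shows "ds_rank f g \<rho>1 \<rho>2 V = r"
proof -
  obtain X where "X \<in> subspaces V"
    "ds_rank f g \<rho>1 \<rho>2 V + fv.dim X = \<rho>1 (f ` X) + \<rho>2 (g ` X) + fv.dim V"
    using ds_rank_attained .
  then show ?thesis
    using assms(1)[of X] ds_rank_le[OF assms(2), of f g \<rho>1 \<rho>2] assms(3) by linarith
qed

end

text \<open>Each inequality comes from a suitable competitor in the minimum: the zero space for the
  dimension bound; for monotonicity, a minimiser \<open>X\<close> of \<open>W\<close> cut down to
  \<open>X \<inter> V\<close>; for submodularity, the sum and the intersection of minimisers of
  \<open>V\<close> and \<open>W\<close>. The modular law for dimensions balances the remaining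
  terms.\<close>

lemma qmatroid_ds_rank:
  fixes E :: "(nat \<Rightarrow> 'f::{field,finite}) set"
  assumes E: "fv.subspace E" "finite E" and lin: "linear_map_on E f" "linear_map_on E g"
    and im: "f ` E \<subseteq> E1" "g ` E \<subseteq> E2" and qm: "qmatroid (E1, \<rho>1)" "qmatroid (E2, \<rho>2)"
  shows "qmatroid (E, ds_rank f g \<rho>1 \<rho>2)"
proof (rule qmatroidI)
  interpret A: q_matroid E1 \<rho>1 using qm by unfold_locales
  interpret B: q_matroid E2 \<rho>2 using qm by unfold_locales
  let ?r = "ds_rank f g \<rho>1 \<rho>2"
  have sub: "fv.subspace V" "finite V" if "V \<in> subspaces E" for V
    using that E finite_subset by (auto simp: subspaces_def)
  have fV: "f ` V \<in> subspaces E1" if "V \<in> subspaces E" for V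
    using that im(1) subspace_image[OF lin(1)] by (auto simp: subspaces_def)
  have gV: "g ` V \<in> subspaces E2" if "V \<in> subspaces E" for V
    using that im(2) subspace_image[OF lin(2)] by (auto simp: subspaces_def)
  show "?r V \<le> fv.dim V" if V: "V \<in> subspaces E" for V
  proof -
    have 0: "{0} \<in> subspaces V" using sub[OF V] fv.subspace_0 by (auto simp: subspaces_def)
    have "f ` {0} = {0}" "g ` {0} = {0}" using lin E linear_map_on_0 by auto
    then show ?thesis using ds_rank_le[OF sub[OF V] 0, of f g \<rho>1 \<rho>2] A.rank_zero B.rank_zero by simp
  qed
  show "?r V \<le> ?r W" if V: "V \<in> subspaces E" and W: "W \<in> subspaces E" and VW: "V \<subseteq> W" for V W
  proof -
    obtain X where X: "X \<in> subspaces W" "?r W + fv.dim X = \<rho>1 (f ` X) + \<rho>2 (g ` X) + fv.dim W"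
      using ds_rank_attained[OF sub[OF W]] .
    have XE: "X \<in> subspaces E" using X W by (auto simp: subspaces_def)
    have XV: "X \<inter> V \<in> subspaces V" "X \<inter> V \<in> subspaces E"
      using XE V by (auto simp: subspaces_def fv.subspace_inter)
    have "?r V + fv.dim (X \<inter> V) \<le> \<rho>1 (f ` (X \<inter> V)) + \<rho>2 (g ` (X \<inter> V)) + fv.dim V"
      using ds_rank_le[OF sub[OF V] XV(1)] .
    moreover have "\<rho>1 (f ` (X \<inter> V)) \<le> \<rho>1 (f ` X)" using fV XV XE by (intro A.rank_mono) auto
    moreover have "\<rho>2 (g ` (X \<inter> V)) \<le> \<rho>2 (g ` X)" using gV XV XE by (intro B.rank_mono) auto
    moreover have "fv.dim (fv.span (X \<union> V)) + fv.dim (X \<inter> V) = fv.dim X + fv.dim V"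
      using dim_modular sub[OF XE] sub[OF V] by blast
    moreover have "fv.dim (fv.span (X \<union> V)) \<le> fv.dim W"
      using X VW sub[OF W] by (intro dim_subset fv.span_minimal) (auto simp: subspaces_def)
    ultimately show ?thesis using X(2) by linarith
  qed
  show "?r (fv.span (V \<union> W)) + ?r (V \<inter> W) \<le> ?r V + ?r W"
    if V: "V \<in> subspaces E" and W: "W \<in> subspaces E" for V W
  proof -
    let ?S = "fv.span (V \<union> W)" and ?I = "V \<inter> W"
    have S: "?S \<in> subspaces E"
      using V W fv.span_minimal[of "V \<union> W", OF _ E(1)] by (auto simp: subspaces_def)
    have I: "?I \<in> subspaces E" using V W by (auto simp: subspaces_def fv.subspace_inter)
    obtain X where X: "X \<in> subspaces V" "?r V + fv.dim X = \<rho>1 (f ` X) + \<rho>2 (g ` X) + fv.dim V"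
      using ds_rank_attained[OF sub[OF V]] .
    obtain Y where Y: "Y \<in> subspaces W" "?r W + fv.dim Y = \<rho>1 (f ` Y) + \<rho>2 (g ` Y) + fv.dim W"
      using ds_rank_attained[OF sub[OF W]] .
    have XE: "X \<in> subspaces E" and YE: "Y \<in> subspaces E" using X Y V W by (auto simp: subspaces_def)
    let ?XY = "fv.span (X \<union> Y)"
    have XYS: "?XY \<in> subspaces ?S"
      using X Y fv.span_mono[of "X \<union> Y" "V \<union> W"] by (auto simp: subspaces_def)
    have XYI: "X \<inter> Y \<in> subspaces ?I" using X Y by (auto simp: subspaces_def fv.subspace_inter)
    have XYE: "X \<inter> Y \<in> subspaces E" using XYI I by (auto simp: subspaces_def)
    have "?r ?S + fv.dim ?XY \<le> \<rho>1 (f ` ?XY) + \<rho>2 (g ` ?XY) + fv.dim ?S"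
      using ds_rank_le[OF sub[OF S] XYS] .
    moreover have "?r ?I + fv.dim (X \<inter> Y) \<le> \<rho>1 (f ` (X \<inter> Y)) + \<rho>2 (g ` (X \<inter> Y)) + fv.dim ?I"
      using ds_rank_le[OF sub[OF I] XYI] .
    \<comment> \<open>A linear map preserves sums, but the image of an intersection may be smaller
      than the intersection of the images; monotonicity covers the difference.\<close>
    moreover have "\<rho>1 (f ` ?XY) + \<rho>1 (f ` (X \<inter> Y)) \<le> \<rho>1 (f ` X) + \<rho>1 (f ` Y)"
    proof -
      have "f ` ?XY = fv.span (f ` X \<union> f ` Y)"
        using XE YE by (intro image_span_Un[OF lin(1)]) (auto simp: subspaces_def)
      moreover have "\<rho>1 (f ` (X \<inter> Y)) \<le> \<rho>1 (f ` X \<inter> f ` Y)"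
        using fV XYE XE YE A.Int_mem by (intro A.rank_mono) auto
      ultimately show ?thesis using A.rank_submodular[OF fV[OF XE] fV[OF YE]] by simp
    qed
    moreover have "\<rho>2 (g ` ?XY) + \<rho>2 (g ` (X \<inter> Y)) \<le> \<rho>2 (g ` X) + \<rho>2 (g ` Y)"
    proof -
      have "g ` ?XY = fv.span (g ` X \<union> g ` Y)"
        using XE YE by (intro image_span_Un[OF lin(2)]) (auto simp: subspaces_def)
      moreover have "\<rho>2 (g ` (X \<inter> Y)) \<le> \<rho>2 (g ` X \<inter> g ` Y)"
        using gV XYE XE YE B.Int_mem by (intro B.rank_mono) auto
      ultimately show ?thesis using B.rank_submodular[OF gV[OF XE] gV[OF YE]] by simp
    qed
    moreover have "fv.dim ?XY + fv.dim (X \<inter> Y) = fv.dim X + fv.dim Y"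
      using dim_modular sub[OF XE] sub[OF YE] by blast
    moreover have "fv.dim ?S + fv.dim ?I = fv.dim V + fv.dim W"
      using dim_modular sub[OF V] sub[OF W] by blast
    ultimately show ?thesis using X(2) Y(2) by linarith
  qed
qed (use E in auto)

text \<open>A direct sum with arbitrary coordinate maps \<open>f\<close> and \<open>g\<close> in
  place of fixed projections. The external sum and the internal one with \<open>iproj\<close> both
  have this form, so the same results serve \<open>dsum\<close> and
  \<open>reducible\<close>.\<close>

definition splits_as ::
  "(nat \<Rightarrow> 'f::field) set \<Rightarrow> ((nat \<Rightarrow> 'f) set \<Rightarrow> nat) \<Rightarrow> ((nat \<Rightarrow> 'f) \<Rightarrow> (nat \<Rightarrow> 'f)) \<Rightarrow>
   ((nat \<Rightarrow> 'f) \<Rightarrow> (nat \<Rightarrow> 'f)) \<Rightarrow> 'f qm \<Rightarrow> 'f qm \<Rightarrow> bool" where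
  "splits_as E \<rho> f g A B \<longleftrightarrow> linear_map_on E f \<and> linear_map_on E g \<and>
     bij_betw (\<lambda>x. (f x, g x)) E (fst A \<times> fst B) \<and>
     (\<forall>V\<in>subspaces E. \<rho> V = ds_rank f g (snd A) (snd B) V)"

section \<open>Interleaved coordinates and the external direct sum\<close>

lemma evp_interleave [simp]: "evp (interleave u v) = u"
  and odp_interleave [simp]: "odp (interleave u v) = v"
  by (auto simp: evp_def odp_def interleave_def)

lemma interleave_evp_odp: "interleave (evp w) (odp w) = w"
  by (auto simp: evp_def odp_def interleave_def fun_eq_iff)

lemma linear_map_on_evp: "linear_map_on V evp" and linear_map_on_odp: "linear_map_on V odp"
  by (auto simp: linear_map_on_def evp_def odp_def fscale_def fun_eq_iff plus_fun_apply)

lemma interleave_add: "interleave (u + u') (v + v') = interleave u v + interleave u' v'"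
  and interleave_scale: "interleave (fscale c u) (fscale c v) = fscale c (interleave u v)"
  by (auto simp: interleave_def fscale_def fun_eq_iff plus_fun_apply)

lemma fst_dsum: "fst (dsum A B) = (\<lambda>(u, v). interleave u v) ` (fst A \<times> fst B)"
  and snd_dsum: "snd (dsum A B) = ds_rank evp odp (snd A) (snd B)"
  by (auto simp: dsum_def split: prod.splits)

text \<open>Composing an equivalence with the even and odd coordinate projections yields
  \<open>f\<close> and \<open>g\<close>; interleaving \<open>f\<close> and \<open>g\<close> recovers
  the equivalence.\<close>

lemma qm_equiv_dsum_iff_splits:
  fixes E :: "(nat \<Rightarrow> 'f::{field,finite}) set"
  assumes E: "fv.subspace E" "finite E"
  shows "qm_equiv (E, \<rho>) (dsum A B) \<longleftrightarrow> (\<exists>f g. splits_as E \<rho> f g A B)"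
proof
  assume "qm_equiv (E, \<rho>) (dsum A B)"
  then obtain \<alpha> where \<alpha>: "qm_iso \<alpha> (E, \<rho>) (dsum A B)" by (auto simp: qm_equiv_iff_iso)
  have lin: "linear_map_on E \<alpha>" and bij: "bij_betw \<alpha> E (fst (dsum A B))"
    and rk: "\<And>V. V \<in> subspaces E \<Longrightarrow> ds_rank evp odp (snd A) (snd B) (\<alpha> ` V) = \<rho> V"
    using \<alpha> by (auto simp: qm_iso_def snd_dsum)
  let ?f = "\<lambda>x. evp (\<alpha> x)" and ?g = "\<lambda>x. odp (\<alpha> x)"
  have "bij_betw (\<lambda>w. (evp w, odp w)) (fst (dsum A B)) (fst A \<times> fst B)"
    by (rule bij_betw_byWitness[where f' = "\<lambda>(u, v). interleave u v"])
      (auto simp: fst_dsum interleave_evp_odp)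
  from bij_betw_trans[OF bij this]
  have "bij_betw (\<lambda>x. (?f x, ?g x)) E (fst A \<times> fst B)" by (simp add: comp_def)
  moreover have "linear_map_on E ?f" "linear_map_on E ?g"
    using linear_map_on_comp[OF lin subset_refl] linear_map_on_evp linear_map_on_odp by blast+
  moreover have "\<rho> V = ds_rank ?f ?g (snd A) (snd B) V" if V: "V \<in> subspaces E" for V
  proof -
    have "linear_map_on V \<alpha>" "fv.subspace V" "finite V" "inj_on \<alpha> V"
      using V lin E bij by (auto simp: subspaces_def bij_betw_def
          intro: linear_map_on_subset finite_subset inj_on_subset)
    then show ?thesis using rk[OF V] ds_rank_image by metis
  qed
  ultimately have "splits_as E \<rho> ?f ?g A B" by (simp add: splits_as_def)
  then show "\<exists>f g. splits_as E \<rho> f g A B" by blast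
next
  assume "\<exists>f g. splits_as E \<rho> f g A B"
  then obtain f g where s: "splits_as E \<rho> f g A B" by blast
  let ?\<alpha> = "\<lambda>x. interleave (f x) (g x)"
  have "bij_betw (\<lambda>(u, v). interleave u v) (fst A \<times> fst B) (fst (dsum A B))"
    by (rule bij_betw_byWitness[where f' = "\<lambda>w. (evp w, odp w)"])
      (auto simp: fst_dsum interleave_evp_odp)
  moreover have "bij_betw (\<lambda>x. (f x, g x)) E (fst A \<times> fst B)" using s by (simp add: splits_as_def)
  ultimately have bij: "bij_betw ?\<alpha> E (fst (dsum A B))"
    using bij_betw_trans by (fastforce simp: comp_def)
  have lin: "linear_map_on E ?\<alpha>"
    using s by (auto simp: splits_as_def linear_map_on_def interleave_add interleave_scale)
  have "snd (dsum A B) (?\<alpha> ` V) = \<rho> V" if V: "V \<in> subspaces E" for V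
  proof -
    have "linear_map_on V ?\<alpha>" "fv.subspace V" "finite V" "inj_on ?\<alpha> V"
      using V lin E bij by (auto simp: subspaces_def bij_betw_def
          intro: linear_map_on_subset finite_subset inj_on_subset)
    from ds_rank_image[OF this, of evp odp] show ?thesis
      using s V by (simp add: snd_dsum splits_as_def)
  qed
  then have "qm_iso ?\<alpha> (E, \<rho>) (dsum A B)" using bij lin by (simp add: qm_iso_def)
  then show "qm_equiv (E, \<rho>) (dsum A B)" by (auto simp: qm_equiv_iff_iso)
qed

lemma qmatroid_dsum:
  fixes A B :: "'f::{field,finite} qm"
  assumes "qmatroid A" "qmatroid B"
  shows "qmatroid (dsum A B)"
proof -
  obtain E1 \<rho>1 E2 \<rho>2 where AB: "A = (E1, \<rho>1)" "B = (E2, \<rho>2)" by (metis surj_pair)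
  interpret A: q_matroid E1 \<rho>1 using assms AB by unfold_locales simp
  interpret B: q_matroid E2 \<rho>2 using assms AB by unfold_locales simp
  let ?E = "(\<lambda>(u, v). interleave u v) ` (E1 \<times> E2)"
  have "fv.subspace ?E"
  proof (rule fv.subspaceI)
    have "0 = interleave (0 :: nat \<Rightarrow> 'f) 0"
      by (auto simp: interleave_def fun_eq_iff zero_fun_apply)
    then show "0 \<in> ?E" using A.subspace_ground B.subspace_ground fv.subspace_0
      by (metis (no_types, lifting) SigmaI case_prod_conv image_eqI)
  next
    fix x y assume "x \<in> ?E" "y \<in> ?E"
    then obtain u v u' v' where "x = interleave u v" "y = interleave u' v'"
      "u \<in> E1" "v \<in> E2" "u' \<in> E1" "v' \<in> E2" by auto
    then have "x + y = (\<lambda>(u, v). interleave u v) (u + u', v + v')" "(u + u', v + v') \<in> E1 \<times> E2"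
      using A.subspace_ground B.subspace_ground by (auto simp: interleave_add fv.subspace_add)
    then show "x + y \<in> ?E" by blast
  next
    fix c x assume "x \<in> ?E"
    then obtain u v where "x = interleave u v" "u \<in> E1" "v \<in> E2" by auto
    then have "fscale c x = (\<lambda>(u, v). interleave u v) (fscale c u, fscale c v)"
      "(fscale c u, fscale c v) \<in> E1 \<times> E2"
      using A.subspace_ground B.subspace_ground by (auto simp: interleave_scale fv.subspace_scale)
    then show "fscale c x \<in> ?E" by blast
  qed
  moreover have "finite ?E" using A.finite_ground B.finite_ground by simp
  ultimately have "qmatroid (?E, ds_rank evp odp \<rho>1 \<rho>2)"
    using assms AB linear_map_on_evp linear_map_on_odp
    by (intro qmatroid_ds_rank[where ?E1.0 = E1 and ?E2.0 = E2]) auto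
  then show ?thesis using fst_dsum[of A B] snd_dsum[of A B] AB by (metis fst_conv snd_conv prod.collapse)
qed

lemma qmatroid_dsum_list:
  fixes Ms :: "'f::{field,finite} qm list"
  assumes "Ms \<noteq> []" "\<forall>N\<in>set Ms. qmatroid N"
  shows "qmatroid (dsum_list Ms)"
  using assms by (induction Ms rule: dsum_list.induct) (auto intro: qmatroid_dsum)

section \<open>Admissible idempotents\<close>

text \<open>A direct sum decomposition of a q-matroid amounts to an idempotent \<open>e\<close> for which the rank of
  every cyclic space \<open>X\<close> is the sum of the ranks of \<open>e X\<close> and \<open>(1 - e) X\<close>; all other ranks are then
  forced, since every space contains a cyclic space of the same nullity.\<close>
definition admissible ::
  "(nat \<Rightarrow> 'f::field) set \<Rightarrow> ((nat \<Rightarrow> 'f) set \<Rightarrow> nat) \<Rightarrow> ((nat \<Rightarrow> 'f) \<Rightarrow> (nat \<Rightarrow> 'f)) \<Rightarrow> bool" where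
  "admissible E \<rho> e \<longleftrightarrow> linear_map_on E e \<and> e ` E \<subseteq> E \<and> (\<forall>x\<in>E. e (e x) = e x) \<and>
     (\<forall>X\<in>subspaces E. cyclic \<rho> X \<longrightarrow> \<rho> X = \<rho> (e ` X) + \<rho> ((\<lambda>x. x - e x) ` X))"

lemma splits_as_commute: "splits_as E \<rho> f g A B \<Longrightarrow> splits_as E \<rho> g f B A"
proof -
  assume s: "splits_as E \<rho> f g A B"
  have "bij_betw prod.swap (fst A \<times> fst B) (fst B \<times> fst A)"
    by (rule bij_betw_byWitness[where f' = prod.swap]) auto
  then have "bij_betw (\<lambda>x. (g x, f x)) E (fst B \<times> fst A)"
    using s bij_betw_trans[of "\<lambda>x. (f x, g x)" E "fst A \<times> fst B" prod.swap]
    by (simp add: splits_as_def comp_def)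
  moreover have "ds_rank g f (snd B) (snd A) = ds_rank f g (snd A) (snd B)"
    by (simp add: ds_rank_def fun_eq_iff add.commute)
  ultimately show ?thesis using s by (simp add: splits_as_def)
qed

context q_matroid
begin

text \<open>Where \<open>g\<close> vanishes, the quantity to be minimised is
  \<open>\<rho> (f X) - dim X\<close> with the rank of \<open>A\<close>. As \<open>f\<close> is
  injective there, this is minus the nullity of \<open>f X\<close>, hence smallest at
  \<open>X = V\<close>.\<close>

lemma splits_as_rank:
  assumes s: "splits_as E \<rho> f g A B" and qm: "qmatroid A" "qmatroid B"
    and V: "V \<in> subspaces E" and g0: "\<And>x. x \<in> V \<Longrightarrow> g x = 0"
  shows "\<rho> V = snd A (f ` V)"
proof -
  interpret A: q_matroid "fst A" "snd A" using qm by unfold_locales simp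
  interpret B: q_matroid "fst B" "snd B" using qm by unfold_locales simp
  note sV = subspacesD[OF V]
  have linf: "linear_map_on V f"
    using s sV linear_map_on_subset by (auto simp: splits_as_def)
  have "inj_on (\<lambda>x. (f x, g x)) E" using s by (auto simp: splits_as_def bij_betw_def)
  then have inj: "inj_on f V"
    using g0 sV by (intro inj_onI) (auto dest!: inj_onD)
  have g0': "g ` X = {0}" if "X \<in> subspaces V" for X
    using that g0 fv.subspace_0 by (force simp: subspaces_def)
  have dim: "fv.dim (f ` X) = fv.dim X" if "X \<in> subspaces V" for X
    using that sV inj linf by (intro dim_image_inj)
      (auto simp: subspaces_def intro: linear_map_on_subset finite_subset inj_on_subset)
  have fE: "f x \<in> fst A" if "x \<in> E" for x using s that by (force simp: splits_as_def bij_betw_def)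
  have fX: "f ` X \<in> subspaces (fst A)" if "X \<in> subspaces V" for X
    using that sV fE subspace_image[OF linf, of X] by (auto simp: subspaces_def)
  have r: "\<rho> V = ds_rank f g (snd A) (snd B) V" using s V by (simp add: splits_as_def)
  have VV: "V \<in> subspaces V" using sV by (simp add: subspaces_def)
  obtain X where X: "X \<in> subspaces V" "\<rho> V + fv.dim X = snd A (f ` X) + snd B (g ` X) + fv.dim V"
    using ds_rank_attained[OF sV(1,3), of f g "snd A" "snd B"] r by metis
  have "snd A (f ` V) + fv.dim (f ` X) \<le> snd A (f ` X) + fv.dim (f ` V)"
    using X VV fX by (intro A.nullity_mono) (auto simp: subspaces_def)
  then have "snd A (f ` V) \<le> \<rho> V" using X dim[OF VV] dim[OF X(1)] by linarith
  moreover have "\<rho> V \<le> snd A (f ` V)"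
    using ds_rank_le[OF sV(1,3) VV, of f g "snd A" "snd B"] r g0'[OF VV] B.rank_zero by simp
  ultimately show ?thesis by simp
qed

text \<open>If a minimiser \<open>Y\<close> were a proper subspace, strict growth of nullity would
  give \<open>\<rho> X + dim Y < \<rho> Y + dim X\<close>, while \<open>\<rho> Y\<close> is at most
  the sum of the ranks of its two images. That contradicts the choice of \<open>Y\<close>, so the
  minimum is attained at \<open>X\<close>.\<close>

lemma splits_as_rank_cyclic:
  assumes s: "splits_as E \<rho> f g A B" and X: "X \<in> subspaces E" "cyclic \<rho> X"
  shows "\<rho> X = snd A (f ` X) + snd B (g ` X)"
proof -
  have r: "\<rho> V = ds_rank f g (snd A) (snd B) V" if "V \<in> subspaces E" for V
    using s that by (simp add: splits_as_def)
  note sX = subspacesD[OF X(1)]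
  obtain Y where Y: "Y \<in> subspaces X" "\<rho> X + fv.dim Y = snd A (f ` Y) + snd B (g ` Y) + fv.dim X"
    using ds_rank_attained[OF sX(1,3), of f g "snd A" "snd B"] r[OF X(1)] by metis
  have YE: "Y \<in> subspaces E" using Y X by (auto simp: subspaces_def)
  note sY = subspacesD[OF YE]
  have "Y \<in> subspaces Y" using sY by (simp add: subspaces_def)
  then have "\<rho> Y + fv.dim Y \<le> snd A (f ` Y) + snd B (g ` Y) + fv.dim Y"
    using ds_rank_le[OF sY(1,3)] r[OF YE] by metis
  then have "Y = X" using cyclic_nullity_less[OF X Y(1)] Y(2) by linarith
  then show ?thesis using Y(2) by simp
qed

lemma splits_as_imp_admissible:
  assumes s: "splits_as E \<rho> f g A B" and qm: "qmatroid A" "qmatroid B"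
  obtains e where "admissible E \<rho> e" "qm_iso f (e ` E, \<rho>) A" "qm_iso g ((\<lambda>x. x - e x) ` E, \<rho>) B"
proof -
  interpret A: q_matroid "fst A" "snd A" using qm by unfold_locales simp
  interpret B: q_matroid "fst B" "snd B" using qm by unfold_locales simp
  have lin: "linear_map_on E f" "linear_map_on E g" and bij: "bij_betw (\<lambda>x. (f x, g x)) E (fst A \<times> fst B)"
    using s by (auto simp: splits_as_def)
  have inj: "x = y" if "x \<in> E" "y \<in> E" "f x = f y" "g x = g y" for x y
    using that bij by (auto simp: bij_betw_def dest: inj_onD)
  have surj: "\<exists>x\<in>E. f x = a \<and> g x = b" if "a \<in> fst A" "b \<in> fst B" for a b
  proof -
    have "(a, b) \<in> (\<lambda>x. (f x, g x)) ` E" using bij that by (simp add: bij_betw_def)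
    then show ?thesis by auto
  qed
  have fE: "f x \<in> fst A" and gE: "g x \<in> fst B" if "x \<in> E" for x
    using bij that by (force simp: bij_betw_def)+
  have A0: "0 \<in> fst A" and B0: "0 \<in> fst B"
    using A.subspace_ground B.subspace_ground fv.subspace_0 by auto
  \<comment> \<open>\<open>e\<close> projects to the first summand and includes it back into
    \<open>E\<close>. It is determined by its two coordinates, so its linearity and idempotence are
    checked coordinatewise.\<close>
  have "\<forall>x\<in>E. \<exists>y. y \<in> E \<and> f y = f x \<and> g y = 0" using surj fE B0 by blast
  then obtain e where e: "\<And>x. x \<in> E \<Longrightarrow> e x \<in> E \<and> f (e x) = f x \<and> g (e x) = 0" by metis
  have lin_e: "linear_map_on E e" unfolding linear_map_on_def
  proof (intro conjI ballI allI)
    fix x y assume "x \<in> E" "y \<in> E"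
    then show "e (x + y) = e x + e y"
      using e[of x] e[of y] e[of "x + y"] subspace_ground
        linear_map_on_add[OF lin(1), of x y] linear_map_on_add[OF lin(2), of x y]
        linear_map_on_add[OF lin(1), of "e x" "e y"] linear_map_on_add[OF lin(2), of "e x" "e y"]
      by - (rule inj, simp_all add: fv.subspace_add)
  next
    fix c x assume "x \<in> E"
    then show "e (fscale c x) = fscale c (e x)"
      using e[of x] e[of "fscale c x"] subspace_ground
        linear_map_on_scale[OF lin(1), of x] linear_map_on_scale[OF lin(1), of "e x"]
        linear_map_on_scale[OF lin(2), of "e x"]
      by - (rule inj, simp_all add: fv.subspace_scale)
  qed
  have e': "x - e x \<in> E \<and> f (x - e x) = 0 \<and> g (x - e x) = g x" if "x \<in> E" for x
    using e[OF that] that subspace_ground lin by (simp add: linear_map_on_diff fv.subspace_diff)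
  have lin_e': "linear_map_on E (\<lambda>x. x - e x)"
    using linear_map_on_minus linear_map_on_id lin_e by blast
  have rank_e: "\<rho> V = snd A (f ` V)" if "V \<in> subspaces (e ` E)" for V
    using that e by (intro splits_as_rank[OF s qm]) (auto simp: subspaces_def)
  have rank_e': "\<rho> V = snd B (g ` V)" if "V \<in> subspaces ((\<lambda>x. x - e x) ` E)" for V
    using that e' by (intro splits_as_rank[OF splits_as_commute[OF s] qm(2,1)]) (auto simp: subspaces_def)
  have "admissible E \<rho> e"
    unfolding admissible_def
  proof (intro conjI ballI impI)
    show "e ` E \<subseteq> E" using e by blast
    show "e (e x) = e x" if "x \<in> E" for x
      using e[OF that] e[of "e x"] by - (rule inj, simp_all)
  next
    fix X assume X: "X \<in> subspaces E" "cyclic \<rho> X"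
    have XE: "X \<subseteq> E" and sX: "fv.subspace X" using X by (auto simp: subspaces_def)
    have "e ` X \<in> subspaces (e ` E)" "(\<lambda>x. x - e x) ` X \<in> subspaces ((\<lambda>x. x - e x) ` E)"
      using subspace_image[OF lin_e sX XE] subspace_image[OF lin_e' sX XE] XE
      by (auto simp: subspaces_def)
    then have "\<rho> (e ` X) = snd A (f ` e ` X)"
      and "\<rho> ((\<lambda>x. x - e x) ` X) = snd B (g ` (\<lambda>x. x - e x) ` X)"
      using rank_e rank_e' by blast+
    moreover have "f ` e ` X = f ` X" unfolding image_image using e XE by (intro image_cong) auto
    moreover have "g ` (\<lambda>x. x - e x) ` X = g ` X"
      unfolding image_image using e' XE by (intro image_cong) auto
    ultimately show "\<rho> X = \<rho> (e ` X) + \<rho> ((\<lambda>x. x - e x) ` X)"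
      using splits_as_rank_cyclic[OF s X] by simp
  qed (use lin_e in auto)
  moreover have "qm_iso f (e ` E, \<rho>) A"
  proof -
    have "inj_on f (e ` E)" using e inj by (auto intro!: inj_onI)
    moreover have "f ` e ` E = fst A"
    proof
      show "fst A \<subseteq> f ` e ` E" using surj[OF _ B0] e by (metis image_eqI subsetI)
    qed (simp add: image_subset_iff e fE)
    moreover have "linear_map_on (e ` E) f"
      using linear_map_on_subset[OF lin(1)] e by (simp add: image_subset_iff)
    ultimately show ?thesis using rank_e by (auto simp: qm_iso_def bij_betw_def)
  qed
  moreover have "qm_iso g ((\<lambda>x. x - e x) ` E, \<rho>) B"
  proof -
    have "inj_on g ((\<lambda>x. x - e x) ` E)"
    proof (rule inj_onI)
      fix a b assume "a \<in> (\<lambda>x. x - e x) ` E" "b \<in> (\<lambda>x. x - e x) ` E" and g: "g a = g b"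
      then obtain x y where xy: "x \<in> E" "a = x - e x" "y \<in> E" "b = y - e y" by blast
      then show "a = b" using e'[OF xy(1)] e'[OF xy(3)] g inj[of a b] by simp
    qed
    moreover have "g ` (\<lambda>x. x - e x) ` E = fst B"
    proof
      show "fst B \<subseteq> g ` (\<lambda>x. x - e x) ` E"
      proof
        fix b assume "b \<in> fst B"
        then obtain x where x: "x \<in> E" "g x = b" using surj[OF A0] by blast
        then have "b = g (x - e x)" using e' by simp
        then show "b \<in> g ` (\<lambda>x. x - e x) ` E" using x by blast
      qed
    qed (simp add: image_subset_iff e' gE)
    moreover have "linear_map_on ((\<lambda>x. x - e x) ` E) g"
      using linear_map_on_subset[OF lin(2)] e' by (simp add: image_subset_iff)
    ultimately show ?thesis using rank_e' by (auto simp: qm_iso_def bij_betw_def)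
  qed
  ultimately show ?thesis using that by blast
qed

lemma admissibleD:
  assumes "admissible E \<rho> e"
  shows "linear_map_on E e" "\<And>x. x \<in> E \<Longrightarrow> e x \<in> E" "\<And>x. x \<in> E \<Longrightarrow> e (e x) = e x"
    "\<And>X. X \<in> subspaces E \<Longrightarrow> cyclic \<rho> X \<Longrightarrow> \<rho> X = \<rho> (e ` X) + \<rho> ((\<lambda>x. x - e x) ` X)"
    "linear_map_on E (\<lambda>x. x - e x)" "\<And>x. x \<in> E \<Longrightarrow> x - e x \<in> E" "\<And>x. x \<in> E \<Longrightarrow> e (x - e x) = 0"
    "e ` E \<in> subspaces E" "(\<lambda>x. x - e x) ` E \<in> subspaces E"
proof -
  show lin: "linear_map_on E e" using assms by (simp add: admissible_def)
  show e: "e x \<in> E" and ee: "e (e x) = e x" if "x \<in> E" for x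
    using assms that by (auto simp: admissible_def)
  show lin': "linear_map_on E (\<lambda>x. x - e x)"
    using linear_map_on_minus linear_map_on_id lin by blast
  show e': "x - e x \<in> E" if "x \<in> E" for x using that e subspace_ground fv.subspace_diff by blast
  show "e (x - e x) = 0" if "x \<in> E" for x
    using linear_map_on_diff[OF lin subspace_ground that e[OF that]] ee[OF that] by simp
  show "e ` E \<in> subspaces E" using image_mem[OF lin ground_mem] e by blast
  show "(\<lambda>x. x - e x) ` E \<in> subspaces E" using image_mem[OF lin' ground_mem] e' by blast
  show "\<rho> X = \<rho> (e ` X) + \<rho> ((\<lambda>x. x - e x) ` X)" if "X \<in> subspaces E" "cyclic \<rho> X" for X
    using assms that by (auto simp: admissible_def)
qed

lemma rank_le_idempotent_split:
  assumes "V \<in> subspaces E" "linear_map_on E e" "\<And>x. x \<in> E \<Longrightarrow> e x \<in> E"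
  shows "\<rho> V \<le> \<rho> (e ` V) + \<rho> ((\<lambda>x. x - e x) ` V)"
proof (rule rank_subadditive)
  have VE: "V \<subseteq> E" using assms by (simp add: subspaces_def)
  then have "linear_map_on V e" using assms linear_map_on_subset by blast
  moreover from this have "linear_map_on V (\<lambda>x. x - e x)"
    by (rule linear_map_on_minus[OF linear_map_on_id])
  ultimately show "e ` V \<in> subspaces E" "(\<lambda>x. x - e x) ` V \<in> subspaces E"
    using assms VE subspace_ground by (auto intro!: image_mem fv.subspace_diff)
  fix x assume "x \<in> V"
  then show "\<exists>a\<in>e ` V. \<exists>b\<in>(\<lambda>x. x - e x) ` V. x = a + b"
    by (intro bexI[of _ "e x"] bexI[of _ "x - e x"]) auto
qed (use assms in auto)

lemma admissibleI:
  assumes "linear_map_on E e" "\<And>x. x \<in> E \<Longrightarrow> e x \<in> E" "\<And>x. x \<in> E \<Longrightarrow> e (e x) = e x"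
    "\<And>X. X \<in> subspaces E \<Longrightarrow> cyclic \<rho> X \<Longrightarrow> \<rho> (e ` X) + \<rho> ((\<lambda>x. x - e x) ` X) \<le> \<rho> X"
  shows "admissible E \<rho> e"
proof -
  have "\<rho> X = \<rho> (e ` X) + \<rho> ((\<lambda>x. x - e x) ` X)" if "X \<in> subspaces E" "cyclic \<rho> X" for X
    using assms(4)[OF that] rank_le_idempotent_split[OF that(1) assms(1,2)] by simp
  then show ?thesis unfolding admissible_def using assms(1-3) by (simp add: image_subset_iff)
qed

text \<open>Every \<open>Y\<close> below \<open>V\<close> gives at least \<open>\<rho> V\<close> in
  the minimum, by monotone nullity and subadditivity over \<open>e\<close> and \<open>1 - e\<close>.
  A cyclic subspace of the same nullity as \<open>V\<close> attains this bound, because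
  admissibility is additive on it.\<close>

lemma admissible_imp_splits_as:
  assumes a: "admissible E \<rho> e"
    and \<alpha>: "qm_iso \<alpha> (e ` E, \<rho>) A" and \<beta>: "qm_iso \<beta> ((\<lambda>x. x - e x) ` E, \<rho>) B"
  shows "splits_as E \<rho> (\<lambda>x. \<alpha> (e x)) (\<lambda>x. \<beta> (x - e x)) A B"
proof -
  note e = admissibleD[OF a]
  have bij\<alpha>: "bij_betw \<alpha> (e ` E) (fst A)" and lin\<alpha>: "linear_map_on (e ` E) \<alpha>"
    and rk\<alpha>: "\<And>V. V \<in> subspaces (e ` E) \<Longrightarrow> snd A (\<alpha> ` V) = \<rho> V"
    using \<alpha> by (auto simp: qm_iso_def)
  have bij\<beta>: "bij_betw \<beta> ((\<lambda>x. x - e x) ` E) (fst B)" and lin\<beta>: "linear_map_on ((\<lambda>x. x - e x) ` E) \<beta>"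
    and rk\<beta>: "\<And>V. V \<in> subspaces ((\<lambda>x. x - e x) ` E) \<Longrightarrow> snd B (\<beta> ` V) = \<rho> V"
    using \<beta> by (auto simp: qm_iso_def)
  let ?f = "\<lambda>x. \<alpha> (e x)" and ?g = "\<lambda>x. \<beta> (x - e x)"
  have lin: "linear_map_on E ?f" "linear_map_on E ?g"
    using linear_map_on_comp[OF e(1) subset_refl lin\<alpha>] linear_map_on_comp[OF e(5) subset_refl lin\<beta>] .
  have "bij_betw (\<lambda>x. (?f x, ?g x)) E (fst A \<times> fst B)"
    unfolding bij_betw_def
  proof
    show "inj_on (\<lambda>x. (?f x, ?g x)) E"
    proof (rule inj_onI)
      fix x y assume xy: "x \<in> E" "y \<in> E" "(?f x, ?g x) = (?f y, ?g y)"
      then have "e x = e y" using bij\<alpha> by (auto simp: bij_betw_def dest: inj_onD)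
      moreover have "x - e x = y - e y" using bij\<beta> xy
        by - (rule inj_onD[of \<beta> "(\<lambda>x. x - e x) ` E"], auto simp: bij_betw_def)
      ultimately show "x = y" by simp
    qed
    show "(\<lambda>x. (?f x, ?g x)) ` E = fst A \<times> fst B"
    proof
      show "(\<lambda>x. (?f x, ?g x)) ` E \<subseteq> fst A \<times> fst B" using bij\<alpha> bij\<beta> by (auto simp: bij_betw_def)
      show "fst A \<times> fst B \<subseteq> (\<lambda>x. (?f x, ?g x)) ` E"
      proof clarify
        fix a b assume "a \<in> fst A" "b \<in> fst B"
        then obtain x y where x: "x \<in> E" "a = \<alpha> (e x)" and y: "y \<in> E" "b = \<beta> (y - e y)"
          using bij\<alpha> bij\<beta> unfolding bij_betw_def by (metis (no_types, lifting) imageE)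
        \<comment> \<open>\<open>?z\<close> combines both preimages: \<open>e\<close> returns only
          the part from \<open>x\<close>, and \<open>1 - e\<close> only the part from
          \<open>y\<close>.\<close>
        let ?z = "e x + (y - e y)"
        have z: "?z \<in> E" using x y e subspace_ground by (simp add: fv.subspace_add)
        have "e ?z = e x"
          using linear_map_on_add[OF e(1), of "e x" "y - e y"] x y e by simp
        then have "(a, b) = (?f ?z, ?g ?z)" using x y by simp
        then show "(a, b) \<in> (\<lambda>x. (?f x, ?g x)) ` E" using z by blast
      qed
    qed
  qed
  moreover have "\<rho> V = ds_rank ?f ?g (snd A) (snd B) V" if V: "V \<in> subspaces E" for V
  proof -
    note sV = subspacesD[OF V]
    have rk: "snd A (?f ` X) = \<rho> (e ` X)" "snd B (?g ` X) = \<rho> ((\<lambda>x. x - e x) ` X)"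
      if X: "X \<in> subspaces V" for X
    proof -
      have XE: "fv.subspace X" "X \<subseteq> E" using X sV by (auto simp: subspaces_def)
      then have "e ` X \<in> subspaces (e ` E)" "(\<lambda>x. x - e x) ` X \<in> subspaces ((\<lambda>x. x - e x) ` E)"
        using subspace_image[OF e(1) XE] subspace_image[OF e(5) XE] by (auto simp: subspaces_def)
      then show "snd A (?f ` X) = \<rho> (e ` X)" "snd B (?g ` X) = \<rho> ((\<lambda>x. x - e x) ` X)"
        using rk\<alpha> rk\<beta> by (metis (no_types, lifting) image_cong image_image)+
    qed
    obtain X where X: "X \<in> subspaces V" "cyclic \<rho> X" "\<rho> X + fv.dim V = \<rho> V + fv.dim X"
      using exists_cyclic[OF V] .
    have "ds_rank ?f ?g (snd A) (snd B) V = \<rho> V"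
    proof (rule ds_rank_eqI[OF sV(1,3) _ X(1)])
      show "\<rho> V + fv.dim X = snd A (?f ` X) + snd B (?g ` X) + fv.dim V"
        using rk[OF X(1)] e(4)[OF subspaces_trans[OF X(1) sV(2)] X(2)] X(3) by simp
      fix Y assume Y: "Y \<in> subspaces V"
      then have YE: "Y \<in> subspaces E" "Y \<subseteq> V" using sV by (auto simp: subspaces_def)
      show "\<rho> V + fv.dim Y \<le> snd A (?f ` Y) + snd B (?g ` Y) + fv.dim V"
        using rk[OF Y] rank_le_idempotent_split[OF YE(1) e(1,2)] nullity_mono[OF YE(1) V YE(2)] by simp
    qed
    then show ?thesis by simp
  qed
  ultimately show ?thesis using lin by (simp add: splits_as_def)
qed

end

section \<open>Reducibility in terms of idempotents\<close>

lemma iproj_eq: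
  assumes "fv.subspace A" "fv.subspace B" "A \<inter> B = {0}" "u \<in> A" "w - u \<in> B"
  shows "iproj A B w = u"
  unfolding iproj_def
proof (rule the_equality)
  fix u' assume u': "u' \<in> A \<and> w - u' \<in> B"
  have "u' - u = (w - u) - (w - u')" by simp
  then have "u' - u \<in> A \<inter> B" using u' assms fv.subspace_diff by (metis IntI)
  then show "u' = u" using assms by simp
qed (use assms in simp)

lemma (in q_matroid) reducible_imp_splits_as:
  assumes "reducible (E, \<rho>)"
  obtains f g A B where "qmatroid A" "qmatroid B" "fst A \<noteq> {0}" "fst B \<noteq> {0}" "splits_as E \<rho> f g A B"
proof -
  obtain E1 \<rho>1 E2 \<rho>2 where qm: "qmatroid (E1, \<rho>1)" "qmatroid (E2, \<rho>2)"
    and nz: "E1 \<noteq> {0}" "E2 \<noteq> {0}" and "E1 \<subseteq> E" "E2 \<subseteq> E"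
    and int: "E1 \<inter> E2 = {0}" and span: "fv.span (E1 \<union> E2) = E"
    and rk: "\<And>V. V \<in> subspaces E \<Longrightarrow> \<rho> V = ds_rank (iproj E1 E2) (iproj E2 E1) \<rho>1 \<rho>2 V"
    using assms unfolding reducible_def prod.case by metis
  interpret A: q_matroid E1 \<rho>1 using qm by unfold_locales
  interpret B: q_matroid E2 \<rho>2 using qm by unfold_locales
  note sub = A.subspace_ground B.subspace_ground
  have E: "E = {u + v | u v. u \<in> E1 \<and> v \<in> E2}" using span subspace_span_Un[OF sub] by simp
  let ?p = "iproj E1 E2" and ?q = "iproj E2 E1"
  have p: "?p (u + v) = u" and q: "?q (u + v) = v" if "u \<in> E1" "v \<in> E2" for u v
    using iproj_eq[OF sub int, of u "u + v"] iproj_eq[OF sub(2,1), of v "u + v"] int that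
    by (simp_all add: Int_commute)
  have "bij_betw (\<lambda>x. (?p x, ?q x)) E (E1 \<times> E2)"
    by (rule bij_betw_byWitness[where f' = "\<lambda>(u, v). u + v"]) (auto simp: E p q)
  moreover have "linear_map_on E ?p \<and> linear_map_on E ?q"
  proof -
    have "?p (x + y) = ?p x + ?p y \<and> ?q (x + y) = ?q x + ?q y" if xy: "x \<in> E" "y \<in> E" for x y
    proof -
      obtain u v u' v' where *: "x = u + v" "y = u' + v'" "u \<in> E1" "v \<in> E2" "u' \<in> E1" "v' \<in> E2"
        using xy by (auto simp: E)
      then have "x + y = (u + u') + (v + v')" by (simp add: algebra_simps)
      then show ?thesis using * p q sub fv.subspace_add by metis
    qed
    moreover have "?p (fscale c x) = fscale c (?p x) \<and> ?q (fscale c x) = fscale c (?q x)"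
      if x: "x \<in> E" for c x
    proof -
      obtain u v where *: "x = u + v" "u \<in> E1" "v \<in> E2" using x by (auto simp: E)
      then have "fscale c x = fscale c u + fscale c v" by (simp add: fv.scale_right_distrib)
      then show ?thesis using * p q sub fv.subspace_scale by metis
    qed
    ultimately show ?thesis by (simp add: linear_map_on_def)
  qed
  ultimately have "splits_as E \<rho> ?p ?q (E1, \<rho>1) (E2, \<rho>2)" using rk by (simp add: splits_as_def)
  then show ?thesis using that[of "(E1, \<rho>1)" "(E2, \<rho>2)"] qm nz by simp
qed

lemma (in q_matroid) admissible_imp_reducible:
  assumes a: "admissible E \<rho> e" and nz: "\<exists>x\<in>E. e x \<noteq> 0" "\<exists>x\<in>E. e x \<noteq> x"
  shows "reducible (E, \<rho>)"
proof -
  note e = admissibleD[OF a]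
  let ?A = "e ` E" and ?B = "(\<lambda>x. x - e x) ` E"
  have sub: "fv.subspace ?A" "fv.subspace ?B" using e(8,9) by (auto simp: subspaces_def)
  have int: "?A \<inter> ?B = {0}"
  proof
    show "?A \<inter> ?B \<subseteq> {0}"
    proof clarify
      fix x y assume "x \<in> E" "y \<in> E" "e x = y - e y"
      then show "e x = 0" using e(3)[of x] e(7)[of y] by simp
    qed
    show "{0} \<subseteq> ?A \<inter> ?B" using sub fv.subspace_0 by blast
  qed
  have span: "fv.span (?A \<union> ?B) = E"
  proof
    show "fv.span (?A \<union> ?B) \<subseteq> E" using e(2,6) subspace_ground by (intro fv.span_minimal) auto
    show "E \<subseteq> fv.span (?A \<union> ?B)"
    proof
      fix x assume "x \<in> E"
      then have "x = e x + (x - e x)" "e x \<in> ?A" "x - e x \<in> ?B" by auto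
      then show "x \<in> fv.span (?A \<union> ?B)" unfolding subspace_span_Un[OF sub] by blast
    qed
  qed
  have "qm_iso (\<lambda>x. x) (?A, \<rho>) (?A, \<rho>)" "qm_iso (\<lambda>x. x) (?B, \<rho>) (?B, \<rho>)"
    by (auto simp: qm_iso_def linear_map_on_id bij_betw_def)
  from admissible_imp_splits_as[OF a this]
  have rk: "\<rho> V = ds_rank e (\<lambda>x. x - e x) \<rho> \<rho> V" if "V \<in> subspaces E" for V
    using that by (simp add: splits_as_def)
  have "iproj ?A ?B x = e x" "iproj ?B ?A x = x - e x" if "x \<in> E" for x
    using that sub int by (auto intro!: iproj_eq)
  then have rank: "\<rho> V = ds_rank (iproj ?A ?B) (iproj ?B ?A) \<rho> \<rho> V" if "V \<in> subspaces E" for V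
    unfolding rk[OF that] using that by (intro ds_rank_cong) (auto simp: subspaces_def)
  have qm: "qmatroid (?A, \<rho>)" "qmatroid (?B, \<rho>)"
    using q_matroid_restrict e(8,9) q_matroid.qmatroid by blast+
  have nzA: "?A \<noteq> {0}" using nz by auto
  have nzB: "?B \<noteq> {0}"
    using nz(2) by (metis (no_types, lifting) eq_iff_diff_eq_0 image_eqI singletonD)
  have subE: "?A \<subseteq> E" "?B \<subseteq> E" using e(8,9) by (simp_all add: subspaces_def)
  show ?thesis unfolding reducible_def prod.case
    by (rule exI[of _ ?A], rule exI[of _ \<rho>], rule exI[of _ ?B], rule exI[of _ \<rho>], intro conjI ballI)
      (fact qm nzA nzB subE int span rank)+
qed

lemma (in q_matroid) irreducible_admissible:
  assumes "irreducible_qm (E, \<rho>)" "admissible E \<rho> e"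
  shows "(\<forall>x\<in>E. e x = 0) \<or> (\<forall>x\<in>E. e x = x)"
  using assms(1) admissible_imp_reducible[OF assms(2)] unfolding irreducible_qm_def by blast

lemma (in q_matroid) splits_as_imp_nontrivial_admissible:
  assumes s: "splits_as E \<rho> f g A B"
    and AB: "qmatroid A" "qmatroid B" "fst A \<noteq> {0}" "fst B \<noteq> {0}"
  obtains e where "admissible E \<rho> e" "\<exists>x\<in>E. e x \<noteq> 0" "\<exists>x\<in>E. e x \<noteq> x"
proof -
  obtain e where e: "admissible E \<rho> e" "qm_iso f (e ` E, \<rho>) A" "qm_iso g ((\<lambda>x. x - e x) ` E, \<rho>) B"
    using splits_as_imp_admissible[OF s AB(1,2)] .
  note eD = admissibleD[OF e(1)]
  have 0: "\<alpha> 0 = 0" if "qm_iso \<alpha> (V, \<rho>) N" "V \<in> subspaces E" for \<alpha> V N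
    using that linear_map_on_0[of V \<alpha>] by (simp add: qm_iso_def subspaces_def)
  have ne: "E \<noteq> {}" using ground_mem fv.subspace_0 by (auto simp: subspaces_def)
  have "\<exists>x\<in>E. e x \<noteq> 0"
  proof (rule ccontr)
    assume "\<not> ?thesis"
    then have "e ` E = {0}" using ne by auto
    then have "fst A = {0}" using e(2) 0[OF e(2) eD(8)] by (auto simp: qm_iso_def bij_betw_def)
    then show False using AB by simp
  qed
  moreover have "\<exists>x\<in>E. e x \<noteq> x"
  proof (rule ccontr)
    assume "\<not> ?thesis"
    then have "(\<lambda>x. x - e x) ` E = {0}" using ne by auto
    then have "fst B = {0}" using e(3) 0[OF e(3) eD(9)] by (auto simp: qm_iso_def bij_betw_def)
    then show False using AB by simp
  qed
  ultimately show ?thesis using that e(1) by blast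
qed

lemma (in q_matroid) not_irreducible_admissible:
  assumes "\<not> irreducible_qm (E, \<rho>)"
  obtains e where "admissible E \<rho> e" "\<exists>x\<in>E. e x \<noteq> 0" "\<exists>x\<in>E. e x \<noteq> x"
proof -
  have red: "reducible (E, \<rho>)" using assms qmatroid by (simp add: irreducible_qm_def)
  obtain f g A B where AB: "qmatroid A" "qmatroid B" "fst A \<noteq> {0}" "fst B \<noteq> {0}"
    and s: "splits_as E \<rho> f g A B" using reducible_imp_splits_as[OF red] .
  show ?thesis using splits_as_imp_nontrivial_admissible[OF s AB] that .
qed

lemma (in q_matroid) admissible_cyclic_image:
  assumes a: "admissible E \<rho> e" and X: "X \<in> subspaces E" "cyclic \<rho> X"
  shows "cyclic \<rho> (e ` X)" "cyclic \<rho> ((\<lambda>x. x - e x) ` X)"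
proof -
  note e = admissibleD[OF a]
  \<comment> \<open>The two complementary idempotents are indexed by the booleans, so that one
    application of \<open>cyclic_image\<close> treats both.\<close>
  let ?g = "\<lambda>b. if b then e else (\<lambda>x. x - e x)"
  have XE: "X \<subseteq> E" using X by (simp add: subspaces_def)
  have "cyclic \<rho> (?g k ` X)" for k
  proof (rule cyclic_image[OF X, of UNIV])
    show "linear_map_on X (?g i)" for i
      using linear_map_on_subset[OF e(1) XE] linear_map_on_subset[OF e(5) XE] by simp
    show "?g i ` X \<subseteq> E" for i using e(2,6) XE by auto
    show "(\<Sum>i\<in>UNIV. \<rho> (?g i ` X)) \<le> \<rho> X" using e(4)[OF X] by (simp add: UNIV_bool)
  qed (auto simp: UNIV_bool)
  from this[of True] this[of False] show "cyclic \<rho> (e ` X)" "cyclic \<rho> ((\<lambda>x. x - e x) ` X)" by simp_all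
qed

text \<open>As \<open>e X\<close> is again cyclic, \<open>a\<close> splits its rank as well. Writing
  \<open>1 - a e\<close> as \<open>(e - a e) + (1 - e)\<close> and using subadditivity merges the
  last two of the three resulting ranks.\<close>

lemma (in q_matroid) admissible_comp:
  assumes e: "admissible E \<rho> e" and a: "admissible (e ` E) \<rho> a"
  shows "admissible E \<rho> (\<lambda>x. a (e x))"
proof -
  note eD = admissibleD[OF e]
  interpret R: q_matroid "e ` E" \<rho> using q_matroid_restrict[OF eD(8)] .
  note aD = R.admissibleD[OF a]
  have ea: "e y = y" if "y \<in> e ` E" for y using that eD(3) by auto
  have sub: "e ` E \<subseteq> E" using eD(2) by blast
  show ?thesis
  proof (rule admissibleI)
    show lin: "linear_map_on E (\<lambda>x. a (e x))" using linear_map_on_comp[OF eD(1) subset_refl aD(1)] .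
    show mem: "a (e x) \<in> E" if "x \<in> E" for x using aD(2)[of "e x"] that sub by blast
    show "a (e (a (e x))) = a (e x)" if "x \<in> E" for x
      using that ea[OF aD(2)[of "e x"]] aD(3)[of "e x"] by simp
    fix X assume X: "X \<in> subspaces E" "cyclic \<rho> X"
    then have XE: "X \<subseteq> E" and sX: "fv.subspace X" by (simp_all add: subspaces_def)
    have eX: "e ` X \<in> subspaces (e ` E)"
      using subspace_image[OF eD(1) sX XE] XE by (auto simp: subspaces_def)
    have "\<rho> (e ` X) = \<rho> (a ` e ` X) + \<rho> ((\<lambda>y. y - a y) ` e ` X)"
      using aD(4)[OF eX admissible_cyclic_image(1)[OF e X]] .
    moreover have "\<rho> X = \<rho> (e ` X) + \<rho> ((\<lambda>x. x - e x) ` X)" using eD(4)[OF X] .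
    moreover have "\<rho> ((\<lambda>x. x - a (e x)) ` X) \<le> \<rho> ((\<lambda>y. y - a y) ` e ` X) + \<rho> ((\<lambda>x. x - e x) ` X)"
    proof (rule rank_subadditive)
      have "(\<lambda>y. y - a y) ` e ` X \<in> subspaces (e ` E)"
      proof (rule R.image_mem)
        have "e ` X \<subseteq> e ` E" using XE by blast
        then show "linear_map_on (e ` X) (\<lambda>y. y - a y)" "(\<lambda>y. y - a y) ` e ` X \<subseteq> e ` E"
          using linear_map_on_subset[OF aD(5)] aD(6) by blast+
      qed (rule eX)
      then show "(\<lambda>y. y - a y) ` e ` X \<in> subspaces E" using sub by (rule subspaces_trans)
      show "(\<lambda>x. x - e x) ` X \<in> subspaces E"
        using X eD(6) XE linear_map_on_subset[OF eD(5) XE] by (intro image_mem) auto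
      have "linear_map_on X (\<lambda>x. x - a (e x))"
        using linear_map_on_minus[OF linear_map_on_id linear_map_on_subset[OF lin XE]] .
      then show "(\<lambda>x. x - a (e x)) ` X \<in> subspaces E"
        using X mem XE subspace_ground by (intro image_mem) (auto intro!: fv.subspace_diff)
      fix z assume "z \<in> (\<lambda>x. x - a (e x)) ` X"
      then obtain x where x: "x \<in> X" "z = x - a (e x)" by blast
      then have "z = (e x - a (e x)) + (x - e x)" by simp
      then show "\<exists>u\<in>(\<lambda>y. y - a y) ` e ` X. \<exists>v\<in>(\<lambda>x. x - e x) ` X. z = u + v" using x by blast
    qed
    ultimately show "\<rho> ((\<lambda>x. a (e x)) ` X) + \<rho> ((\<lambda>x. x - a (e x)) ` X) \<le> \<rho> X"
      by (simp add: image_image)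
  qed
qed

section \<open>Existence of a decomposition into irreducibles\<close>

lemma dsum_list_Cons: "Ms \<noteq> [] \<Longrightarrow> dsum_list (N # Ms) = dsum N (dsum_list Ms)"
  by (cases Ms) auto

text \<open>A nonzero admissible idempotent with smallest image has an irreducible image: a
  nontrivial idempotent on that image could be composed with it to give a smaller one.\<close>

lemma (in q_matroid) exists_irreducible_admissible:
  assumes "\<not> irreducible_qm (E, \<rho>)"
  obtains e where "admissible E \<rho> e" "irreducible_qm (e ` E, \<rho>)" "\<exists>x\<in>E. e x \<noteq> 0"
proof -
  define P where "P e \<longleftrightarrow> admissible E \<rho> e \<and> (\<exists>x\<in>E. e x \<noteq> 0)" for e
  obtain e0 where "P e0" using not_irreducible_admissible[OF assms] unfolding P_def by metis
  then obtain e where e: "P e" "\<And>e'. P e' \<Longrightarrow> card (e ` E) \<le> card (e' ` E)"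
    using arg_min_nat_lemma[of P e0 "\<lambda>e. card (e ` E)"] by metis
  have adm: "admissible E \<rho> e" and nz: "\<exists>x\<in>E. e x \<noteq> 0" using e by (simp_all add: P_def)
  note eD = admissibleD[OF adm]
  interpret R: q_matroid "e ` E" \<rho> using q_matroid_restrict[OF eD(8)] .
  have "irreducible_qm (e ` E, \<rho>)"
  proof (rule ccontr)
    assume "\<not> ?thesis"
    then obtain a where a: "admissible (e ` E) \<rho> a" "\<exists>y\<in>e ` E. a y \<noteq> 0" "\<exists>y\<in>e ` E. a y \<noteq> y"
      using R.not_irreducible_admissible by blast
    have "P (\<lambda>x. a (e x))" using admissible_comp[OF adm a(1)] a(2) by (auto simp: P_def)
    then have "card (e ` E) \<le> card (a ` e ` E)" using e(2) by (simp add: image_image)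
    moreover have "a ` e ` E \<subseteq> e ` E" using R.admissibleD(2)[OF a(1)] by blast
    \<comment> \<open>An idempotent that is onto is the identity, which the choice of
      \<open>a\<close> excludes.\<close>
    ultimately have "a ` e ` E = e ` E" using R.finite_ground by (simp add: card_seteq)
    then have "a y = y" if "y \<in> e ` E" for y
      using that R.admissibleD(3)[OF a(1)] by (metis imageE)
    then show False using a(3) by blast
  qed
  then show ?thesis using that adm nz by blast
qed

text \<open>One irreducible summand is split off at a time. Its complement is strictly smaller,
  because \<open>e\<close> vanishes there but not on all of \<open>E\<close>.\<close>

lemma exists_irreducible_decomposition:
  fixes E :: "(nat \<Rightarrow> 'f::{field,finite}) set"
  assumes "qmatroid (E, \<rho>)"
  shows "\<exists>Ms. Ms \<noteq> [] \<and> (\<forall>N\<in>set Ms. irreducible_qm N) \<and> qm_equiv (E, \<rho>) (dsum_list Ms)"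
  using assms
proof (induction "card E" arbitrary: E rule: less_induct)
  case less
  interpret q_matroid E \<rho> using less by unfold_locales
  show ?case
  proof (cases "irreducible_qm (E, \<rho>)")
    case True
    then show ?thesis by (intro exI[of _ "[(E, \<rho>)]"]) (simp add: qm_equiv_refl)
  next
    case False
    obtain e where e: "admissible E \<rho> e" "irreducible_qm (e ` E, \<rho>)" "\<exists>x\<in>E. e x \<noteq> 0"
      using exists_irreducible_admissible[OF False] .
    note eD = admissibleD[OF e(1)]
    let ?E = "(\<lambda>x. x - e x) ` E"
    have "?E \<subseteq> E" using eD(6) by blast
    moreover have "?E \<noteq> E"
    proof
      assume "?E = E"
      then have "e x = 0" if "x \<in> E" for x using that eD(7) by (metis (no_types, lifting) imageE)
      then show False using e(3) by blast
    qed
    ultimately have "card ?E < card E" using finite_ground by (simp add: psubset_card_mono psubset_eq)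
    moreover have "qmatroid (?E, \<rho>)" using q_matroid_restrict[OF eD(9)] q_matroid.qmatroid by blast
    ultimately obtain Ms where Ms: "Ms \<noteq> []" "\<forall>N\<in>set Ms. irreducible_qm N"
      "qm_equiv (?E, \<rho>) (dsum_list Ms)" using less.hyps by blast
    obtain \<alpha> \<beta> where "qm_iso \<alpha> (e ` E, \<rho>) (e ` E, \<rho>)" "qm_iso \<beta> (?E, \<rho>) (dsum_list Ms)"
      using Ms(3) qm_equiv_refl[of "(e ` E, \<rho>)"] unfolding qm_equiv_iff_iso by blast
    from admissible_imp_splits_as[OF e(1) this]
    have "qm_equiv (E, \<rho>) (dsum (e ` E, \<rho>) (dsum_list Ms))"
      using qm_equiv_dsum_iff_splits[OF subspace_ground finite_ground] by blast
    then show ?thesis using Ms e(2)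
      by (intro exI[of _ "(e ` E, \<rho>) # Ms"]) (simp add: dsum_list_Cons)
  qed
qed

section \<open>Decompositions into several summands\<close>

text \<open>A complete system of orthogonal idempotents. Components may be zero and need not be
  irreducible, so that the compression of a decomposition to a single summand is again of this
  kind.\<close>

definition decomposition ::
  "(nat \<Rightarrow> 'f::field) set \<Rightarrow> ((nat \<Rightarrow> 'f) set \<Rightarrow> nat) \<Rightarrow> nat \<Rightarrow>
   (nat \<Rightarrow> (nat \<Rightarrow> 'f) \<Rightarrow> (nat \<Rightarrow> 'f)) \<Rightarrow> bool" where
  "decomposition E \<rho> n p \<longleftrightarrow> (\<forall>i<n. linear_map_on E (p i) \<and> (\<forall>x\<in>E. p i x \<in> E)) \<and>
     (\<forall>i<n. \<forall>j<n. \<forall>x\<in>E. p i (p j x) = (if i = j then p i x else 0)) \<and>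
     (\<forall>x\<in>E. (\<Sum>i<n. p i x) = x) \<and>
     (\<forall>X\<in>subspaces E. cyclic \<rho> X \<longrightarrow> \<rho> X = (\<Sum>i<n. \<rho> (p i ` X)))"

lemma decompositionD:
  assumes "decomposition E \<rho> n p"
  shows "i < n \<Longrightarrow> linear_map_on E (p i)" "i < n \<Longrightarrow> x \<in> E \<Longrightarrow> p i x \<in> E"
    "i < n \<Longrightarrow> j < n \<Longrightarrow> x \<in> E \<Longrightarrow> p i (p j x) = (if i = j then p i x else 0)"
    "x \<in> E \<Longrightarrow> (\<Sum>i<n. p i x) = x"
    "X \<in> subspaces E \<Longrightarrow> cyclic \<rho> X \<Longrightarrow> \<rho> X = (\<Sum>i<n. \<rho> (p i ` X))"
  using assms by (simp_all add: decomposition_def)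

text \<open>The rank identity on the complement applies because \<open>1 - e\<close> maps cyclic
  spaces to cyclic spaces.\<close>

lemma (in q_matroid) decomposition_Cons:
  assumes e: "admissible E \<rho> e" and p: "decomposition ((\<lambda>x. x - e x) ` E) \<rho> n p"
  shows "decomposition E \<rho> (Suc n) (\<lambda>i. case i of 0 \<Rightarrow> e | Suc j \<Rightarrow> (\<lambda>x. p j (x - e x)))"
    (is "decomposition E \<rho> _ ?p")
proof -
  note eD = admissibleD[OF e]
  let ?E = "(\<lambda>x. x - e x) ` E"
  have EE: "?E \<subseteq> E" using eD(6) by blast
  have e0: "e y = 0" if "y \<in> ?E" for y using that eD(7) by auto
  note lin = decompositionD(1)[OF p] and mem = decompositionD(2)[OF p]
    and orth = decompositionD(3)[OF p] and sum = decompositionD(4)[OF p]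
    and rank = decompositionD(5)[OF p]
  have p0: "p j 0 = 0" if "j < n" for j
    using linear_map_on_0[OF lin[OF that]] eD(9) by (simp add: subspaces_def)
  have x': "x - e x \<in> ?E" if "x \<in> E" for x using that by blast
  show ?thesis unfolding decomposition_def
  proof (intro conjI allI impI ballI)
    fix i assume i: "i < Suc n"
    show "linear_map_on E (?p i)"
    proof (cases i)
      case (Suc j)
      then show ?thesis using linear_map_on_comp[OF eD(5) subset_refl lin[of j]] i by simp
    qed (use eD(1) in simp)
    show "?p i x \<in> E" if "x \<in> E" for x
    proof (cases i)
      case (Suc j)
      then have "p j (x - e x) \<in> ?E" using i mem[of j "x - e x"] x'[OF that] by simp
      then show ?thesis using EE Suc by auto
    qed (use eD(2)[OF that] in simp)
    show "?p i (?p k x) = (if i = k then ?p i x else 0)" if k: "k < Suc n" and x: "x \<in> E" for k x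
    proof (cases i)
      case 0
      show ?thesis
      proof (cases k)
        case (Suc j)
        then show ?thesis using 0 e0[OF mem[OF _ x'[OF x]], of j] k by simp
      qed (use 0 eD(3)[OF x] in simp)
    next
      case (Suc j)
      show ?thesis
      proof (cases k)
        case 0
        then show ?thesis using Suc eD(3)[OF x] p0[of j] i by simp
      next
        case (Suc l)
        have "l < n" "j < n" using Suc \<open>i = Suc j\<close> i k by simp_all
        then have "p j (p l (x - e x)) = (if j = l then p j (x - e x) else 0)"
          and "e (p l (x - e x)) = 0"
          using orth[OF _ _ x'[OF x]] e0[OF mem[OF _ x'[OF x]]] by blast+
        then show ?thesis using Suc \<open>i = Suc j\<close> by simp
      qed
    qed
  next
    fix x assume x: "x \<in> E"
    show "(\<Sum>i<Suc n. ?p i x) = x"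
      unfolding sum.lessThan_Suc_shift using sum[OF x'[OF x]] by simp
  next
    fix X assume X: "X \<in> subspaces E" "cyclic \<rho> X"
    then have XE: "X \<subseteq> E" and sX: "fv.subspace X" by (simp_all add: subspaces_def)
    have "(\<lambda>x. x - e x) ` X \<in> subspaces ?E"
      using subspace_image[OF eD(5) sX XE] XE by (auto simp: subspaces_def)
    from rank[OF this admissible_cyclic_image(2)[OF e X]]
    show "\<rho> X = (\<Sum>i<Suc n. \<rho> (?p i ` X))"
      unfolding sum.lessThan_Suc_shift using eD(4)[OF X] by (simp add: image_image)
  qed
qed

lemma dsum_list_decomposition:
  fixes E :: "(nat \<Rightarrow> 'f::{field,finite}) set"
  assumes "Ms \<noteq> []" "\<forall>N\<in>set Ms. qmatroid N" "qmatroid (E, \<rho>)" "qm_equiv (E, \<rho>) (dsum_list Ms)"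
  shows "\<exists>p. decomposition E \<rho> (length Ms) p \<and> (\<forall>i<length Ms. qm_equiv (p i ` E, \<rho>) (Ms ! i))"
  using assms
proof (induction Ms arbitrary: E rule: list_nonempty_induct)
  case (single N)
  have "decomposition E \<rho> 1 (\<lambda>_ x. x)"
    by (simp add: decomposition_def linear_map_on_id)
  then show ?case using single by (intro exI[of _ "\<lambda>_ x. x"]) simp
next
  case (cons N Ms)
  interpret q_matroid E \<rho> using cons by unfold_locales
  have qm: "qmatroid N" "qmatroid (dsum_list Ms)" using cons by (auto intro: qmatroid_dsum_list)
  have "qm_equiv (E, \<rho>) (dsum N (dsum_list Ms))" using cons by (simp add: dsum_list_Cons)
  then obtain f g where s: "splits_as E \<rho> f g N (dsum_list Ms)"
    using qm_equiv_dsum_iff_splits[OF subspace_ground finite_ground] by blast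
  obtain e where e: "admissible E \<rho> e" "qm_iso f (e ` E, \<rho>) N"
    "qm_iso g ((\<lambda>x. x - e x) ` E, \<rho>) (dsum_list Ms)"
    using splits_as_imp_admissible[OF s qm] .
  let ?E = "(\<lambda>x. x - e x) ` E"
  have "qmatroid (?E, \<rho>)"
    using q_matroid_restrict[OF admissibleD(9)[OF e(1)]] q_matroid.qmatroid by blast
  moreover have "qm_equiv (?E, \<rho>) (dsum_list Ms)" using e(3) qm_equiv_iff_iso by blast
  ultimately obtain p where p: "decomposition ?E \<rho> (length Ms) p"
    "\<forall>i<length Ms. qm_equiv (p i ` ?E, \<rho>) (Ms ! i)" using cons.IH[of ?E] cons.prems(1)
    by (metis list.set_intros(2))
  let ?p = "\<lambda>i. case i of 0 \<Rightarrow> e | Suc j \<Rightarrow> (\<lambda>x. p j (x - e x))"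
  have "qm_equiv (?p i ` E, \<rho>) ((N # Ms) ! i)" if "i < length (N # Ms)" for i
  proof (cases i)
    case 0
    then show ?thesis using e(2) qm_equiv_iff_iso by fastforce
  next
    case (Suc j)
    then show ?thesis using p(2) that by (simp add: image_image)
  qed
  then show ?case using decomposition_Cons[OF e(1) p(1)] by (intro exI[of _ ?p]) simp
qed

section \<open>Loops, and the irreducible q-matroids of dimension one\<close>

text \<open>A largest subspace \<open>H\<close> avoiding \<open>x\<close> works: adjoining any
  \<open>z\<close> outside \<open>H\<close> captures \<open>x\<close>, so \<open>x\<close> is
  congruent to a nonzero multiple of \<open>z\<close> modulo \<open>H\<close>, and this relation can
  be solved for \<open>z\<close>.\<close>

lemma exists_complementary_hyperplane:
  assumes "fv.subspace E" "finite E" "x \<in> E" "x \<noteq> 0"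
  obtains H where "is_hyperplane H E x" "x \<notin> H"
proof -
  define P where "P H \<longleftrightarrow> H \<in> subspaces E \<and> x \<notin> H" for H
  have "P {0}" using assms fv.subspace_0[OF assms(1)] by (simp add: P_def subspaces_def)
  moreover have "\<forall>H. P H \<longrightarrow> card H < card E"
    using assms by (auto simp: P_def subspaces_def intro!: psubset_card_mono)
  ultimately obtain H where H: "P H" "\<And>Z. P Z \<Longrightarrow> card Z \<le> card H"
    using Lattices_Big.ex_has_greatest_nat[of P "{0}" card "card E"] by metis
  have sH: "fv.subspace H" "H \<subseteq> E" "x \<notin> H" using H by (auto simp: P_def subspaces_def)
  have spH: "fv.span H = H" using sH(1) by (rule fv.span_eq_iff[THEN iffD2])
  have "\<exists>c. z - fscale c x \<in> H" if z: "z \<in> E" for z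
  proof (cases "z \<in> H")
    case True
    then show ?thesis by (intro exI[of _ 0]) simp
  next
    case False
    let ?Z = "fv.span (insert z H)"
    have "H \<subset> ?Z" using False fv.span_superset[of "insert z H"] by blast
    moreover have ZE: "?Z \<subseteq> E" using z sH assms by (intro fv.span_minimal) auto
    ultimately have "card H < card ?Z" using assms(2) finite_subset psubset_card_mono by metis
    then have "\<not> P ?Z" using H(2)[of ?Z] by linarith
    then have "x \<in> ?Z" using ZE by (simp add: P_def subspaces_def)
    then obtain k where k: "x - fscale k z \<in> H" using spH by (auto simp: fv.span_insert)
    then have "k \<noteq> 0" using sH by auto
    have "fscale (- inverse k) (x - fscale k z) \<in> H" using k sH fv.subspace_scale by blast
    moreover have "fscale (- inverse k) (x - fscale k z) = z - fscale (inverse k) x"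
      using \<open>k \<noteq> 0\<close> by (simp add: fv.scale_right_diff_distrib)
    ultimately show ?thesis by metis
  qed
  then have "is_hyperplane H E x" using sH assms by (simp add: is_hyperplane_def)
  then show ?thesis using that sH by blast
qed

text \<open>The coefficient \<open>c z\<close> with \<open>z - c z * x\<close> in \<open>H\<close>
  is unique because \<open>x\<close> is outside \<open>H\<close>. Uniqueness makes \<open>c\<close>
  a linear functional with value 1 at \<open>x\<close> and 0 on \<open>H\<close>.\<close>

lemma hyperplane_projection:
  assumes E: "fv.subspace E" and H: "is_hyperplane H E x" and x: "x \<notin> H"
  obtains e where "linear_map_on E e" "\<And>z. z \<in> E \<Longrightarrow> z - e z \<in> H" "\<And>z. z \<in> E \<Longrightarrow> e z \<in> fv.span {x}"
    "e x = x" "\<And>z. z \<in> H \<Longrightarrow> e z = 0" "\<And>z. z \<in> E \<Longrightarrow> e (e z) = e z"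
proof -
  have sH: "fv.subspace H" and HE: "H \<subseteq> E" and xE: "x \<in> E" using H by (auto simp: is_hyperplane_def)
  have "\<forall>z\<in>E. \<exists>c. z - fscale c x \<in> H" using H by (simp add: is_hyperplane_def)
  then obtain c where c: "\<And>z. z \<in> E \<Longrightarrow> z - fscale (c z) x \<in> H" by metis
  have uniq: "c z = d" if "z \<in> E" "z - fscale d x \<in> H" for z d
  proof (rule ccontr)
    assume ne: "c z \<noteq> d"
    have "(z - fscale d x) - (z - fscale (c z) x) \<in> H" using c that sH fv.subspace_diff by blast
    then have "fscale (c z - d) x \<in> H" by (simp add: fv.scale_left_diff_distrib)
    then have "fscale (inverse (c z - d)) (fscale (c z - d) x) \<in> H" using sH fv.subspace_scale by blast
    then have "x \<in> H" using ne unfolding fv.scale_scale by simp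
    then show False using x by simp
  qed
  let ?e = "\<lambda>z. fscale (c z) x"
  have "linear_map_on E ?e" unfolding linear_map_on_def
  proof (intro conjI ballI allI)
    fix u v assume uv: "u \<in> E" "v \<in> E"
    have "(u - ?e u) + (v - ?e v) \<in> H" using c uv sH fv.subspace_add by blast
    moreover have "(u - ?e u) + (v - ?e v) = (u + v) - fscale (c u + c v) x"
      by (simp add: fv.scale_left_distrib)
    ultimately have "c (u + v) = c u + c v" using uv E by (intro uniq) (auto intro: fv.subspace_add)
    then show "?e (u + v) = ?e u + ?e v" by (simp add: fv.scale_left_distrib)
  next
    fix d u assume u: "u \<in> E"
    have "fscale d (u - ?e u) \<in> H" using c u sH fv.subspace_scale by blast
    moreover have "fscale d (u - ?e u) = fscale d u - fscale (d * c u) x"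
      by (simp add: fv.scale_right_diff_distrib)
    ultimately have "c (fscale d u) = d * c u" using u E by (intro uniq) (auto intro: fv.subspace_scale)
    then show "?e (fscale d u) = fscale d (?e u)" by simp
  qed
  moreover have "?e z \<in> fv.span {x}" for z by (intro fv.span_scale fv.span_base) simp
  moreover have "?e x = x" using uniq[OF xE, of 1] fv.subspace_0[OF sH] by simp
  moreover have "?e z = 0" if "z \<in> H" for z using uniq[of z 0] that HE by auto
  moreover have "?e (?e z) = ?e z" if "z \<in> E" for z
  proof -
    have "?e z \<in> E" using xE E fv.subspace_scale by blast
    then show ?thesis using uniq[of "?e z" "c z"] fv.subspace_0[OF sH] by simp
  qed
  ultimately show ?thesis using c by (intro that) blast+
qed

context q_matroid
begin

definition loops :: "(nat \<Rightarrow> 'f) set" where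
  "loops = {x \<in> E. \<rho> (fv.span {x}) = 0}"

lemma span_singleton_mem: "x \<in> E \<Longrightarrow> fv.span {x} \<in> subspaces E"
  using subspace_ground by (simp add: subspaces_def fv.span_minimal)

lemma loopsI: "x \<in> V \<Longrightarrow> V \<in> subspaces E \<Longrightarrow> \<rho> V = 0 \<Longrightarrow> x \<in> loops"
proof -
  assume *: "x \<in> V" "V \<in> subspaces E" "\<rho> V = 0"
  then have "x \<in> E" "fv.span {x} \<subseteq> V"
    using fv.span_minimal[of "{x}" V] by (auto simp: subspaces_def)
  then show "x \<in> loops"
    using rank_mono[OF span_singleton_mem *(2)] *(3) by (simp add: loops_def)
qed

text \<open>Closure under addition is submodularity: two lines of rank zero span a space of rank
  zero, and subspaces of that space have rank zero too.\<close>

lemma subspace_loops: "fv.subspace loops"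
proof (rule fv.subspaceI)
  show "0 \<in> loops" using loopsI[OF _ zero_mem] rank_zero by simp
next
  fix x y assume x: "x \<in> loops" and y: "y \<in> loops"
  let ?V = "fv.span (fv.span {x} \<union> fv.span {y})"
  have mem: "fv.span {x} \<in> subspaces E" "fv.span {y} \<in> subspaces E"
    using x y span_singleton_mem by (simp_all add: loops_def)
  have "\<rho> ?V = 0" using rank_submodular[OF mem] x y by (simp add: loops_def)
  moreover have "x + y \<in> ?V" by (intro fv.span_add) (auto intro!: fv.span_base)
  ultimately show "x + y \<in> loops" using loopsI span_Un_mem[OF mem] by blast
next
  fix c x assume x: "x \<in> loops"
  then have "x \<in> E" "\<rho> (fv.span {x}) = 0" by (simp_all add: loops_def)
  moreover have "fscale c x \<in> fv.span {x}" by (intro fv.span_scale fv.span_base) simp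
  ultimately show "fscale c x \<in> loops" using loopsI span_singleton_mem by blast
qed

lemma loops_mem: "loops \<in> subspaces E"
  using subspace_loops by (auto simp: subspaces_def loops_def)

lemma rank_zero_cyclic:
  assumes "X \<in> subspaces E" "\<rho> X = 0"
  shows "cyclic \<rho> X"
proof -
  have "\<rho> Y = \<rho> X" if Y: "is_hyperplane Y X x" for Y x
  proof -
    have "Y \<in> subspaces E" "Y \<subseteq> X" using Y assms by (auto simp: is_hyperplane_def subspaces_def)
    then show ?thesis using rank_mono[of Y X] assms by simp
  qed
  then show ?thesis using assms by (simp add: cyclic_def subspaces_def)
qed

text \<open>Any projection onto the line of a loop is admissible: its image has rank zero, and the
  complementary image of \<open>X\<close> lies in \<open>X\<close> plus that line, so it has rank at
  most \<open>\<rho> X\<close>. By irreducibility this projection is the identity.\<close>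

lemma irreducible_loop:
  assumes irr: "irreducible_qm (E, \<rho>)" and l: "l \<in> loops" "l \<noteq> 0"
  shows "E = fv.span {l}"
proof -
  have lE: "l \<in> E" and rl: "\<rho> (fv.span {l}) = 0" using l by (simp_all add: loops_def)
  have spE: "fv.span {l} \<subseteq> E" using span_singleton_mem[OF lE] by (simp add: subspaces_def)
  obtain H where H: "is_hyperplane H E l" "l \<notin> H"
    using exists_complementary_hyperplane[OF subspace_ground finite_ground lE l(2)] .
  obtain e where e: "linear_map_on E e" "\<And>z. z \<in> E \<Longrightarrow> e z \<in> fv.span {l}" "e l = l"
    "\<And>z. z \<in> E \<Longrightarrow> e (e z) = e z"
    using hyperplane_projection[OF subspace_ground H] by metis
  have eE: "e z \<in> E" if "z \<in> E" for z using e(2)[OF that] spE by blast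
  have "admissible E \<rho> e"
  proof (rule admissibleI)
    fix X assume X: "X \<in> subspaces E" "cyclic \<rho> X"
    have XE: "X \<subseteq> E" using X by (simp add: subspaces_def)
    have linX: "linear_map_on X e" using linear_map_on_subset[OF e(1) XE] .
    have eX: "e ` X \<in> subspaces E" using eE XE by (intro image_mem[OF linX X(1)]) blast
    have "e ` X \<subseteq> fv.span {l}" using e(2) XE by blast
    then have "\<rho> (e ` X) = 0" using rank_mono[OF eX span_singleton_mem[OF lE]] rl by simp
    moreover have "\<rho> ((\<lambda>x. x - e x) ` X) \<le> \<rho> X + \<rho> (fv.span {l})"
    proof (rule rank_subadditive[OF _ X(1) span_singleton_mem[OF lE]])
      show "(\<lambda>x. x - e x) ` X \<in> subspaces E"
        using linear_map_on_minus[OF linear_map_on_id linX] X eE XE subspace_ground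
        by (intro image_mem) (auto intro!: fv.subspace_diff)
      fix z assume "z \<in> (\<lambda>x. x - e x) ` X"
      then obtain x where x: "x \<in> X" "z = x - e x" by blast
      have "- e x \<in> fv.span {l}" using e(2) x XE fv.span_neg by blast
      moreover have "z = x + (- e x)" using x by simp
      ultimately show "\<exists>a\<in>X. \<exists>b\<in>fv.span {l}. z = a + b" using x by blast
    qed
    ultimately show "\<rho> (e ` X) + \<rho> ((\<lambda>x. x - e x) ` X) \<le> \<rho> X" using rl by simp
  qed (use e eE in blast)+
  then have "\<forall>z\<in>E. e z = z" using irreducible_admissible[OF irr] e(3) l(2) lE by metis
  then have "E \<subseteq> fv.span {l}" using e(2) by (metis subsetI)
  then show ?thesis using spE by blast
qed

text \<open>If \<open>X\<close> were not inside \<open>Y\<close>, then \<open>X \<inter> Y\<close>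
  would be a hyperplane of \<open>X\<close> with the same rank, and submodularity applied to
  \<open>X\<close> and \<open>Y\<close>, which together span \<open>E\<close>, would give
  \<open>\<rho> E \<le> \<rho> Y\<close>.\<close>

lemma cyclic_subset_hyperplane:
  assumes Y: "is_hyperplane Y E x" "\<rho> Y \<noteq> \<rho> E" and X: "X \<in> subspaces E" "cyclic \<rho> X"
  shows "X \<subseteq> Y"
proof (rule ccontr)
  assume "\<not> X \<subseteq> Y"
  then obtain u where u: "u \<in> X" "u \<notin> Y" by blast
  have sX: "fv.subspace X" "X \<subseteq> E" using X by (simp_all add: subspaces_def)
  have sY: "fv.subspace Y" "Y \<subseteq> E" and cov: "\<And>z. z \<in> E \<Longrightarrow> \<exists>c. z - fscale c x \<in> Y"
    using Y by (auto simp: is_hyperplane_def)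
  \<comment> \<open>Any vector outside \<open>Y\<close> can replace \<open>x\<close> as
    representative, as its \<open>x\<close>-coefficient \<open>a\<close> is invertible.\<close>
  have cov_u: "\<exists>c. z - fscale c u \<in> Y" if z: "z \<in> E" for z
  proof -
    obtain a b where a: "u - fscale a x \<in> Y" and b: "z - fscale b x \<in> Y"
      using cov z u sX by blast
    have a0: "a \<noteq> 0" using a u by auto
    have "(z - fscale b x) - fscale (b * inverse a) (u - fscale a x) \<in> Y"
      using fv.subspace_diff[OF sY(1) b fv.subspace_scale[OF sY(1) a]] .
    moreover have "(z - fscale b x) - fscale (b * inverse a) (u - fscale a x) = z - fscale (b * inverse a) u"
      using a0 by (simp add: fv.scale_right_diff_distrib)
    ultimately show ?thesis by metis
  qed
  have "is_hyperplane (X \<inter> Y) X u"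
    unfolding is_hyperplane_def
  proof (intro conjI ballI)
    fix z assume z: "z \<in> X"
    then obtain c where "z - fscale c u \<in> Y" using cov_u sX by blast
    moreover have "z - fscale c u \<in> X" using z u sX by (intro fv.subspace_diff fv.subspace_scale)
    ultimately show "\<exists>c. z - fscale c u \<in> X \<inter> Y" by blast
  qed (use sX sY u fv.subspace_inter in auto)
  then have "\<rho> (X \<inter> Y) = \<rho> X" using cyclicD[OF X(2)] by blast
  have "E \<subseteq> fv.span (X \<union> Y)"
  proof
    fix z assume "z \<in> E"
    then obtain c where c: "z - fscale c u \<in> Y" using cov_u by blast
    have "fscale c u \<in> X" using u sX fv.subspace_scale by blast
    moreover have "z = fscale c u + (z - fscale c u)" by simp
    ultimately show "z \<in> fv.span (X \<union> Y)" using c unfolding subspace_span_Un[OF sX(1) sY(1)] by blast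
  qed
  moreover have YE: "Y \<in> subspaces E" using sY by (simp add: subspaces_def)
  ultimately have "fv.span (X \<union> Y) = E" using span_Un_mem[OF X(1) YE] by (auto simp: subspaces_def)
  then have "\<rho> E \<le> \<rho> Y" using rank_submodular[OF X(1) YE] \<open>\<rho> (X \<inter> Y) = \<rho> X\<close> by simp
  then show False using rank_mono[OF YE ground_mem sY(2)] Y(2) by simp
qed

text \<open>The coloop counterpart of \<open>irreducible_loop\<close>. A hyperplane \<open>Y\<close>
  of smaller rank contains every cyclic space, so the projection onto \<open>x\<close> along
  \<open>Y\<close> kills them all and is trivially admissible. By irreducibility it is the identity,
  so \<open>Y\<close> is zero and \<open>E\<close> is a line.\<close>

lemma irreducible_not_cyclic:
  assumes irr: "irreducible_qm (E, \<rho>)" and nc: "\<not> cyclic \<rho> E"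
  obtains x where "E = fv.span {x}" "x \<noteq> 0" "\<rho> E = 1"
proof -
  obtain Y x where Y: "is_hyperplane Y E x" "\<rho> Y \<noteq> \<rho> E"
    using nc subspace_ground by (auto simp: cyclic_def)
  have sY: "fv.subspace Y" "Y \<subseteq> E" and xE: "x \<in> E" using Y by (auto simp: is_hyperplane_def)
  have YE: "Y \<in> subspaces E" using sY by (simp add: subspaces_def)
  have x: "x \<notin> Y"
  proof
    assume xY: "x \<in> Y"
    have "E \<subseteq> Y"
    proof
      fix z assume "z \<in> E"
      then obtain c where "z - fscale c x \<in> Y" using Y by (auto simp: is_hyperplane_def)
      then have "(z - fscale c x) + fscale c x \<in> Y"
        using xY sY by (intro fv.subspace_add fv.subspace_scale)
      then show "z \<in> Y" by simp
    qed
    then show False using sY(2) Y(2) by simp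
  qed
  then have x0: "x \<noteq> 0" using fv.subspace_0[OF sY(1)] by metis
  have spE: "fv.span {x} \<subseteq> E" using span_singleton_mem[OF xE] by (simp add: subspaces_def)
  obtain e where e: "linear_map_on E e" "\<And>z. z \<in> E \<Longrightarrow> e z \<in> fv.span {x}" "e x = x"
    "\<And>z. z \<in> Y \<Longrightarrow> e z = 0" "\<And>z. z \<in> E \<Longrightarrow> e (e z) = e z"
    using hyperplane_projection[OF subspace_ground Y(1) x] by metis
  have eE: "e z \<in> E" if "z \<in> E" for z using e(2)[OF that] spE by blast
  have "admissible E \<rho> e"
  proof (rule admissibleI)
    fix X assume X: "X \<in> subspaces E" "cyclic \<rho> X"
    have XY: "X \<subseteq> Y" using cyclic_subset_hyperplane[OF Y X] .
    have "0 \<in> X" using X fv.subspace_0 by (auto simp: subspaces_def)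
    have e0: "e x = 0" if "x \<in> X" for x using that XY e(4) by blast
    have "e ` X = {0}" using e0 \<open>0 \<in> X\<close> by force
    moreover have "(\<lambda>x. x - e x) ` X = X" using e0 by force
    ultimately show "\<rho> (e ` X) + \<rho> ((\<lambda>x. x - e x) ` X) \<le> \<rho> X" using rank_zero by simp
  qed (use e eE in blast)+
  then have id: "\<forall>z\<in>E. e z = z" using irreducible_admissible[OF irr] e(3) x0 xE by metis
  then have E: "E = fv.span {x}" using e(2) spE by (metis subsetI subset_antisym)
  have "Y \<subseteq> {0}" using id e(4) sY(2) by (metis singletonI subset_iff)
  then have "Y = {0}" using fv.subspace_0[OF sY(1)] by blast
  then have "\<rho> E \<noteq> 0" using Y(2) rank_zero by simp
  moreover have "fv.dim E \<le> 1" using fv.dim_le_card[of E "{x}"] E by simp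
  ultimately have "\<rho> E = 1" using rank_le_dim[OF ground_mem] by linarith
  then show ?thesis using that E x0 by blast
qed

end

text \<open>A line has no subspaces besides zero and itself, so its rank determines it up to
  equivalence.\<close>

lemma qm_equiv_span_singleton:
  fixes x y :: "nat \<Rightarrow> 'f::{field,finite}"
  assumes "qmatroid (fv.span {x}, \<rho>)" "qmatroid (fv.span {y}, \<tau>)" "x \<noteq> 0" "y \<noteq> 0"
    and r: "\<rho> (fv.span {x}) = \<tau> (fv.span {y})"
  shows "qm_equiv (fv.span {x}, \<rho>) (fv.span {y}, \<tau>)"
proof -
  interpret A: q_matroid "fv.span {x}" \<rho> using assms by unfold_locales
  interpret B: q_matroid "fv.span {y}" \<tau> using assms by unfold_locales
  have sp: "fv.span {z} = range (\<lambda>c. fscale c z)" for z :: "nat \<Rightarrow> 'f" by (rule fv.span_singleton)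
  define k where "k u = (THE c. u = fscale c x)" for u
  have k: "k (fscale c x) = c" for c unfolding k_def using assms(3) by (intro the_equality) auto
  let ?\<alpha> = "\<lambda>u. fscale (k u) y"
  have "bij_betw ?\<alpha> (fv.span {x}) (fv.span {y})"
    unfolding bij_betw_def
  proof
    show "inj_on ?\<alpha> (fv.span {x})" using assms(4) by (auto intro!: inj_onI simp: sp k)
    show "?\<alpha> ` fv.span {x} = fv.span {y}" by (simp add: sp image_image k)
  qed
  moreover have "linear_map_on (fv.span {x}) ?\<alpha>"
    by (auto simp: linear_map_on_def sp k simp flip: fv.scale_left_distrib)
  moreover have "\<tau> (?\<alpha> ` V) = \<rho> V" if V: "V \<in> subspaces (fv.span {x})" for V
  proof (cases "V = {0}")
    case True
    have "?\<alpha> 0 = 0" using k[of 0] by simp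
    then have "?\<alpha> ` V = {0}" unfolding True by (simp only: image_insert image_empty)
    then show ?thesis using True A.rank_zero B.rank_zero by (simp only:)
  next
    case False
    have sV: "fv.subspace V" "V \<subseteq> fv.span {x}" using V by (simp_all add: subspaces_def)
    then obtain v where v: "v \<in> V" "v \<noteq> 0" using False fv.subspace_0[OF sV(1)] by blast
    then obtain c where c: "v = fscale c x" using sV sp by blast
    then have "c \<noteq> 0" using v by auto
    have "fscale (inverse c) v \<in> V" using v sV fv.subspace_scale by blast
    then have "x \<in> V" using c \<open>c \<noteq> 0\<close> by simp
    then have "V = fv.span {x}" using sV fv.span_minimal[of "{x}" V] by blast
    then show ?thesis using r \<open>bij_betw _ _ _\<close> by (simp add: bij_betw_def)
  qed
  ultimately have "qm_iso ?\<alpha> (fv.span {x}, \<rho>) (fv.span {y}, \<tau>)" by (simp add: qm_iso_def)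
  then show ?thesis using qm_equiv_iff_iso by blast
qed

section \<open>Comparing two decompositions\<close>

context q_matroid
begin

lemma decomposition_image_mem:
  assumes "decomposition E \<rho> n p" "i < n" "V \<in> subspaces E"
  shows "p i ` V \<in> subspaces E"
proof -
  have VE: "V \<subseteq> E" using assms by (simp add: subspaces_def)
  show ?thesis
    using image_mem[OF linear_map_on_subset[OF decompositionD(1)[OF assms(1,2)] VE] assms(3)]
      decompositionD(2)[OF assms(1,2)] VE by blast
qed

lemma decomposition_cyclic_image:
  assumes p: "decomposition E \<rho> n p" and i: "i < n" and X: "X \<in> subspaces E" "cyclic \<rho> X"
  shows "cyclic \<rho> (p i ` X)"
proof (rule cyclic_image[OF X, of "{..<n}"])
  have XE: "X \<subseteq> E" using X by (simp add: subspaces_def)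
  show "linear_map_on X (p j)" "p j ` X \<subseteq> E" if "j \<in> {..<n}" for j
    using linear_map_on_subset[OF decompositionD(1)[OF p] XE] decompositionD(2)[OF p] that XE by auto
  show "(\<Sum>i<n. p i x) = x" if "x \<in> X" for x using decompositionD(4)[OF p] that XE by blast
  show "(\<Sum>i<n. \<rho> (p i ` X)) \<le> \<rho> X" using decompositionD(5)[OF p X] by simp
qed (use i in auto)

lemma decomposition_rank_image_le_cyclic:
  assumes p: "decomposition E \<rho> n p" and i: "i < n" and X: "X \<in> subspaces E" "cyclic \<rho> X"
  shows "\<rho> (p i ` X) \<le> \<rho> X"
  unfolding decompositionD(5)[OF p X] using i by (intro member_le_sum) auto

text \<open>For a cyclic space the rank of the image is one term of the rank sum. A general
  \<open>V\<close> is replaced by a cyclic \<open>X\<close> of equal nullity; \<open>p i\<close>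
  preserves the dimensions of both, and monotone nullity on the images carries the bound from
  \<open>X\<close> to \<open>V\<close>.\<close>

lemma decomposition_rank_image_le:
  assumes p: "decomposition E \<rho> n p" and i: "i < n" and V: "V \<in> subspaces E" and inj: "inj_on (p i) V"
  shows "\<rho> (p i ` V) \<le> \<rho> V"
proof -
  obtain X where X: "X \<in> subspaces V" "cyclic \<rho> X" "\<rho> X + fv.dim V = \<rho> V + fv.dim X"
    using exists_cyclic[OF V] .
  have XE: "X \<in> subspaces E" "X \<subseteq> V" using X V by (auto simp: subspaces_def)
  have dim: "fv.dim (p i ` W) = fv.dim W" if "W \<in> subspaces E" "W \<subseteq> V" for W
  proof (rule dim_image_inj)
    show "linear_map_on W (p i)"
      using linear_map_on_subset[OF decompositionD(1)[OF p i]] that by (simp add: subspaces_def)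
  qed (use that subspacesD inj inj_on_subset in blast)+
  have "\<rho> (p i ` V) + fv.dim (p i ` X) \<le> \<rho> (p i ` X) + fv.dim (p i ` V)"
    using XE decomposition_image_mem[OF p i] V by (intro nullity_mono) auto
  then show ?thesis
    using decomposition_rank_image_le_cyclic[OF p i XE(1) X(2)] X(3) dim[OF XE] dim[OF V] by simp
qed

text \<open>A line of rank zero is cyclic, so its image has rank at most zero.\<close>

lemma decomposition_loops:
  assumes p: "decomposition E \<rho> n p" and i: "i < n" and x: "x \<in> loops"
  shows "p i x \<in> loops"
proof (rule loopsI)
  have xE: "x \<in> E" "\<rho> (fv.span {x}) = 0" using x by (simp_all add: loops_def)
  note mem = span_singleton_mem[OF xE(1)]
  show "p i ` fv.span {x} \<in> subspaces E" using decomposition_image_mem[OF p i mem] .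
  show "\<rho> (p i ` fv.span {x}) = 0"
    using decomposition_rank_image_le_cyclic[OF p i mem rank_zero_cyclic[OF mem xE(2)]] xE(2) by simp
  show "p i x \<in> p i ` fv.span {x}" by (intro imageI fv.span_base) simp
qed

text \<open>Each \<open>p j\<close> is admissible, since \<open>1 - p j\<close> is the sum of the
  other projections, and is therefore zero or the identity. They sum to the identity on a nonzero
  space, so not all can vanish.\<close>

lemma decomposition_irreducible:
  assumes irr: "irreducible_qm (E, \<rho>)" and nz: "E \<noteq> {0}" and p: "decomposition E \<rho> n p"
  obtains j where "j < n" "\<And>x. x \<in> E \<Longrightarrow> p j x = x"
proof -
  have "(\<forall>x\<in>E. p j x = 0) \<or> (\<forall>x\<in>E. p j x = x)" if j: "j < n" for j
  proof (rule irreducible_admissible[OF irr], rule admissibleI)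
    show "p j (p j x) = p j x" if "x \<in> E" for x using decompositionD(3)[OF p j j that] by simp
    fix X assume X: "X \<in> subspaces E" "cyclic \<rho> X"
    have XE: "X \<subseteq> E" using X by (simp add: subspaces_def)
    have "x - p j x = (\<Sum>k\<in>{..<n} - {j}. p k x)" if "x \<in> X" for x
    proof -
      have "x = (\<Sum>k<n. p k x)" using decompositionD(4)[OF p, of x] that XE by auto
      also have "\<dots> = p j x + (\<Sum>k\<in>{..<n} - {j}. p k x)" using j by (simp add: sum.remove)
      finally show ?thesis by (simp add: algebra_simps)
    qed
    then have "(\<lambda>x. x - p j x) ` X = (\<lambda>x. \<Sum>k\<in>{..<n} - {j}. p k x) ` X" by (rule image_cong[OF refl])
    moreover have "\<rho> ((\<lambda>x. \<Sum>k\<in>{..<n} - {j}. p k x) ` X) \<le> (\<Sum>k\<in>{..<n} - {j}. \<rho> (p k ` X))"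
    proof (rule rank_image_sum_le[OF X(1)])
      show "linear_map_on X (p k)" "p k ` X \<subseteq> E" if "k \<in> {..<n} - {j}" for k
        using linear_map_on_subset[OF decompositionD(1)[OF p] XE] decompositionD(2)[OF p] that XE by auto
    qed simp
    moreover have "\<rho> X = \<rho> (p j ` X) + (\<Sum>k\<in>{..<n} - {j}. \<rho> (p k ` X))"
      using decompositionD(5)[OF p X] j by (simp add: sum.remove)
    ultimately show "\<rho> (p j ` X) + \<rho> ((\<lambda>x. x - p j x) ` X) \<le> \<rho> X" by simp
  qed (use decompositionD(1,2)[OF p j] in blast)+
  moreover have "\<exists>j<n. \<not> (\<forall>x\<in>E. p j x = 0)"
  proof (rule ccontr)
    assume "\<not> ?thesis"
    then have "(\<Sum>j<n. p j x) = 0" if "x \<in> E" for x using that by simp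
    then have "E \<subseteq> {0}" using decompositionD(4)[OF p] by force
    then show False using nz fv.subspace_0[OF subspace_ground] by blast
  qed
  ultimately show ?thesis using that by blast
qed

text \<open>Loops are the only obstruction to the projections \<open>r j\<close>, compressed to a summand, being
  orthogonal idempotents; on a loop-free summand they therefore decompose it.\<close>
lemma decomposition_compress:
  assumes p: "decomposition E \<rho> n p" and r: "decomposition E \<rho> m r" and i: "i < n"
    and cyc: "cyclic \<rho> (p i ` E)" and loopfree: "\<And>x. x \<in> p i ` E \<Longrightarrow> x \<in> loops \<Longrightarrow> x = 0"
  shows "decomposition (p i ` E) \<rho> m (\<lambda>j x. p i (r j x))"
    and "\<And>j k x. j < m \<Longrightarrow> k < n \<Longrightarrow> k \<noteq> i \<Longrightarrow> x \<in> p i ` E \<Longrightarrow> p k (r j x) \<in> loops"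
proof -
  let ?E = "p i ` E"
  note pD = decompositionD[OF p] and rD = decompositionD[OF r]
  have EE: "?E \<in> subspaces E" using decomposition_image_mem[OF p i ground_mem] .
  then have sE: "fv.subspace ?E" "?E \<subseteq> E" by (simp_all add: subspaces_def)
  have fix_p: "p i x = x" if "x \<in> ?E" for x using that pD(3)[OF i i] by auto
  have sum_id: "(\<Sum>j<m. p i (r j x)) = x" if x: "x \<in> ?E" for x
  proof -
    have xE: "x \<in> E" using x sE by blast
    have "(\<Sum>j<m. p i (r j x)) = p i (\<Sum>j<m. r j x)"
      using linear_map_on_apply_sum[OF pD(1)[OF i] subspace_ground, of "{..<m}" "\<lambda>j. r j x"] rD(2) xE
      by simp
    then show ?thesis using rD(4)[OF xE] fix_p[OF x] by simp
  qed
  have lin: "linear_map_on E (\<lambda>x. p k (r j x))" if "k < n" "j < m" for k j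
    using linear_map_on_comp[OF rD(1)[OF that(2)] _ pD(1)[OF that(1)]] rD(2)[OF that(2)] by blast
  \<comment> \<open>Splitting \<open>X\<close> by all \<open>r j\<close> and then by all
    \<open>p k\<close> gives a double sum equal to \<open>\<rho> X\<close>. The terms with
    \<open>k = i\<close> alone already reach \<open>\<rho> X\<close> by subadditivity, since the
    maps \<open>p i r j\<close> sum to the identity on \<open>X\<close>; hence all other terms are
    zero.\<close>
  have rank: "\<rho> X = (\<Sum>j<m. \<rho> (p i ` r j ` X)) \<and>
      (\<forall>j<m. \<forall>k<n. k \<noteq> i \<longrightarrow> \<rho> (p k ` r j ` X) = 0)"
    if X: "X \<in> subspaces ?E" "cyclic \<rho> X" for X
  proof -
    have XE: "X \<in> subspaces E" "X \<subseteq> ?E" "X \<subseteq> E" using X sE by (auto simp: subspaces_def)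
    have "\<rho> X = (\<Sum>j<m. \<rho> (r j ` X))" using rD(5)[OF XE(1) X(2)] .
    also have "\<dots> = (\<Sum>j<m. \<Sum>k<n. \<rho> (p k ` r j ` X))"
      using decomposition_image_mem[OF r _ XE(1)] decomposition_cyclic_image[OF r _ XE(1) X(2)]
      by (intro sum.cong refl pD(5)) auto
    also have "\<dots> = (\<Sum>j<m. \<rho> (p i ` r j ` X)) + (\<Sum>j<m. \<Sum>k\<in>{..<n} - {i}. \<rho> (p k ` r j ` X))"
      using i by (simp add: sum.remove[of "{..<n}" i] sum.distrib)
    finally have 1: "\<rho> X = (\<Sum>j<m. \<rho> (p i ` r j ` X)) + (\<Sum>j<m. \<Sum>k\<in>{..<n} - {i}. \<rho> (p k ` r j ` X))" .
    have "(\<lambda>x. \<Sum>j<m. p i (r j x)) ` X = (\<lambda>x. x) ` X"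
      using sum_id XE(2) by (intro image_cong) auto
    moreover have "\<rho> ((\<lambda>x. \<Sum>j<m. p i (r j x)) ` X) \<le> (\<Sum>j<m. \<rho> ((\<lambda>x. p i (r j x)) ` X))"
    proof (rule rank_image_sum_le[OF XE(1)])
      fix j assume "j \<in> {..<m}"
      then have j: "j < m" by simp
      show "linear_map_on X (\<lambda>x. p i (r j x))" using linear_map_on_subset[OF lin[OF i j] XE(3)] .
      show "(\<lambda>x. p i (r j x)) ` X \<subseteq> E" using pD(2)[OF i] rD(2)[OF j] XE(3) by blast
    qed simp
    ultimately have 2: "\<rho> X \<le> (\<Sum>j<m. \<rho> (p i ` r j ` X))" by (simp add: image_image)
    then have 3: "(\<Sum>j<m. \<Sum>k\<in>{..<n} - {i}. \<rho> (p k ` r j ` X)) = 0" using 1 by simp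
    have "\<rho> (p k ` r j ` X) = 0" if "j < m" "k < n" "k \<noteq> i" for j k
    proof -
      have "(\<Sum>k\<in>{..<n} - {i}. \<rho> (p k ` r j ` X)) = 0" using 3 that by simp
      then show ?thesis using that by simp
    qed
    then show ?thesis using 1 3 by simp
  qed
  have EsubE: "?E \<in> subspaces ?E" using sE by (simp add: subspaces_def)
  show loop: "p k (r j x) \<in> loops" if "j < m" "k < n" "k \<noteq> i" "x \<in> ?E" for j k x
  proof (rule loopsI)
    show "p k ` r j ` ?E \<in> subspaces E"
      using decomposition_image_mem[OF p that(2) decomposition_image_mem[OF r that(1) EE]] .
    show "\<rho> (p k ` r j ` ?E) = 0" using rank[OF EsubE cyc] that by blast
    show "p k (r j x) \<in> p k ` r j ` ?E" using that(4) by blast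
  qed
  \<comment> \<open>Insert the identity \<open>\<Sum>k. p k\<close> between \<open>r j\<close> and
    \<open>r l\<close>. The terms with \<open>k \<noteq> i\<close> are loops, and
    \<open>p i r j\<close> sends them to loops of a loop-free summand, that is, to zero.\<close>
  have orth: "p i (r j (p i (r l x))) = (if j = l then p i (r j x) else 0)"
    if j: "j < m" and l: "l < m" and x: "x \<in> ?E" for j l x
  proof -
    have xE: "x \<in> E" using x sE by blast
    let ?y = "r l x"
    have yE: "?y \<in> E" using rD(2)[OF l xE] .
    have z: "p i (r j (p k ?y)) = 0" if k: "k \<in> {..<n} - {i}" for k
    proof -
      have "p k ?y \<in> loops" using loop[OF l _ _ x, of k] k by simp
      then have "p i (r j (p k ?y)) \<in> loops"
        using decomposition_loops[OF r j] decomposition_loops[OF p i] by blast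
      moreover have "p i (r j (p k ?y)) \<in> ?E" using pD(2)[of k] rD(2)[OF j] yE k by blast
      ultimately show ?thesis using loopfree by blast
    qed
    have "p i (r j ?y) = p i (r j (\<Sum>k<n. p k ?y))" using pD(4)[OF yE] by simp
    also have "\<dots> = (\<Sum>k<n. p i (r j (p k ?y)))"
      using linear_map_on_apply_sum[OF lin[OF i j] subspace_ground, of "{..<n}" "\<lambda>k. p k ?y"] pD(2) yE
      by simp
    also have "\<dots> = p i (r j (p i ?y)) + (\<Sum>k\<in>{..<n} - {i}. p i (r j (p k ?y)))"
      using i by (simp add: sum.remove)
    also have "\<dots> = p i (r j (p i ?y))" using z by simp
    finally have "p i (r j (p i ?y)) = p i (r j (r l x))" by simp
    then show ?thesis using rD(3)[OF j l xE] linear_map_on_0[OF pD(1)[OF i] subspace_ground] by simp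
  qed
  show "decomposition ?E \<rho> m (\<lambda>j x. p i (r j x))"
    unfolding decomposition_def
  proof (intro conjI allI impI ballI)
    fix j assume j: "j < m"
    show "linear_map_on ?E (\<lambda>x. p i (r j x))" using linear_map_on_subset[OF lin[OF i j] sE(2)] .
    show "p i (r j x) \<in> ?E" if "x \<in> ?E" for x using that rD(2)[OF j] sE(2) by blast
  next
    fix X assume "X \<in> subspaces ?E" "cyclic \<rho> X"
    then show "\<rho> X = (\<Sum>j<m. \<rho> ((\<lambda>x. p i (r j x)) ` X))" using rank by (simp add: image_image)
  qed (use sum_id orth in blast)+
qed

end

text \<open>A reduction refers to subspaces of one ground space, so it is carried over by way of the
  external sum: both q-matroids are equivalent to the same \<open>dsum A B\<close>, which can be
  read back as an idempotent on \<open>N\<close>.\<close>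

lemma qm_equiv_irreducible:
  fixes E :: "(nat \<Rightarrow> 'f::{field,finite}) set"
  assumes qm: "qmatroid (E, \<rho>)" and equiv: "qm_equiv (E, \<rho>) N" and irr: "irreducible_qm N"
  shows "irreducible_qm (E, \<rho>)"
proof (rule ccontr)
  assume "\<not> ?thesis"
  then have red: "reducible (E, \<rho>)" using qm by (simp add: irreducible_qm_def)
  interpret q_matroid E \<rho> using qm by unfold_locales
  interpret N: q_matroid "fst N" "snd N" using irr by unfold_locales (simp add: irreducible_qm_def)
  obtain f g A B where AB: "qmatroid A" "qmatroid B" "fst A \<noteq> {0}" "fst B \<noteq> {0}"
    and s: "splits_as E \<rho> f g A B" using reducible_imp_splits_as[OF red] .
  have "qm_equiv (E, \<rho>) (dsum A B)"
    using s qm_equiv_dsum_iff_splits[OF subspace_ground finite_ground] by blast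
  moreover have "qm_equiv N (E, \<rho>)" using qm_equiv_sym[OF equiv] subspace_ground by simp
  ultimately have "qm_equiv (fst N, snd N) (dsum A B)" using qm_equiv_trans by simp
  then obtain f' g' where "splits_as (fst N) (snd N) f' g' A B"
    using qm_equiv_dsum_iff_splits[OF N.subspace_ground N.finite_ground] by blast
  from N.splits_as_imp_nontrivial_admissible[OF this AB]
  obtain e where "admissible (fst N) (snd N) e" "\<exists>x\<in>fst N. e x \<noteq> 0" "\<exists>x\<in>fst N. e x \<noteq> x" .
  then have "reducible N" using N.admissible_imp_reducible by simp
  then show False using irr by (simp add: irreducible_qm_def)
qed

section \<open>Loop, coloop and remaining summands\<close>

context q_matroid
begin

text \<open>The zero space counts as irreducible, so nonzero summands are demanded: otherwise zero
  summands could be added and their number would not be determined.\<close>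

definition irreducible_decomposition :: "nat \<Rightarrow> (nat \<Rightarrow> (nat \<Rightarrow> 'f) \<Rightarrow> (nat \<Rightarrow> 'f)) \<Rightarrow> bool" where
  "irreducible_decomposition n p \<longleftrightarrow> decomposition E \<rho> n p \<and>
     (\<forall>i<n. irreducible_qm (p i ` E, \<rho>) \<and> p i ` E \<noteq> {0})"

text \<open>For nonzero irreducible summands these three classes are the loop lines, the coloop
  lines, and the cyclic loop-free summands to which compression applies.\<close>

definition loop_summands where "loop_summands n p = {i. i < n \<and> \<rho> (p i ` E) = 0}"
definition coloop_summands where "coloop_summands n p = {i. i < n \<and> \<not> cyclic \<rho> (p i ` E)}"
definition full_summands where
  "full_summands n p = {i. i < n \<and> cyclic \<rho> (p i ` E) \<and> \<rho> (p i ` E) \<noteq> 0}"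

context
  fixes n p assumes ip: "irreducible_decomposition n p"
begin

lemma irreducible_decompositionD: "decomposition E \<rho> n p"
  using ip by (simp add: irreducible_decomposition_def)

lemma summand_mem: "i < n \<Longrightarrow> p i ` E \<in> subspaces E"
  using decomposition_image_mem[OF irreducible_decompositionD _ ground_mem] .

lemma summand_fixed: "i < n \<Longrightarrow> x \<in> p i ` E \<Longrightarrow> p i x = x"
  using decompositionD(3)[OF irreducible_decompositionD, of i i] by auto

lemma summand_subset: "i < n \<Longrightarrow> x \<in> p i ` E \<Longrightarrow> x \<in> E"
  using summand_mem by (auto simp: subspaces_def)

lemma summand_nonzero:
  assumes "i < n" obtains x where "x \<in> p i ` E" "x \<noteq> 0"
proof -
  have "0 \<in> p i ` E" using summand_mem[OF assms] fv.subspace_0 by (auto simp: subspaces_def)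
  then show ?thesis using ip assms that unfolding irreducible_decomposition_def by blast
qed

lemma summand_loop:
  assumes i: "i < n" and x: "x \<in> p i ` E" "x \<in> loops" "x \<noteq> 0"
  shows "p i ` E = fv.span {x}"
proof -
  interpret R: q_matroid "p i ` E" \<rho> using q_matroid_restrict[OF summand_mem[OF i]] .
  have "x \<in> R.loops" using x unfolding R.loops_def loops_def by simp
  then show ?thesis using R.irreducible_loop x ip i by (simp add: irreducible_decomposition_def)
qed

lemma summand_loop_free:
  assumes "i < n" "\<rho> (p i ` E) \<noteq> 0" "x \<in> p i ` E" "x \<in> loops"
  shows "x = 0"
proof (rule ccontr)
  assume "x \<noteq> 0"
  then have "p i ` E = fv.span {x}" using summand_loop[OF assms(1,3,4)] by blast
  then show False using assms(2,4) by (simp add: loops_def)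
qed

lemma loop_summand:
  assumes "i \<in> loop_summands n p"
  obtains x where "p i ` E = fv.span {x}" "x \<noteq> 0"
proof -
  have i: "i < n" "\<rho> (p i ` E) = 0" using assms by (simp_all add: loop_summands_def)
  obtain x where x: "x \<in> p i ` E" "x \<noteq> 0" using summand_nonzero[OF i(1)] .
  have "x \<in> loops" using loopsI[OF x(1) summand_mem[OF i(1)] i(2)] .
  then show ?thesis using that summand_loop[OF i(1) x(1)] x(2) by blast
qed

lemma coloop_summand:
  assumes "i \<in> coloop_summands n p"
  obtains x where "p i ` E = fv.span {x}" "x \<noteq> 0" "\<rho> (p i ` E) = 1"
proof -
  have i: "i < n" "\<not> cyclic \<rho> (p i ` E)" using assms by (simp_all add: coloop_summands_def)
  interpret R: q_matroid "p i ` E" \<rho> using q_matroid_restrict[OF summand_mem[OF i(1)]] .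
  have "irreducible_qm (p i ` E, \<rho>)" using ip i by (simp add: irreducible_decomposition_def)
  then show ?thesis using that R.irreducible_not_cyclic[OF _ i(2)] by metis
qed

lemma summands_partition:
  "{..<n} = full_summands n p \<union> (loop_summands n p \<union> coloop_summands n p)"
  "full_summands n p \<inter> (loop_summands n p \<union> coloop_summands n p) = {}"
  "loop_summands n p \<inter> coloop_summands n p = {}"
proof -
  have "cyclic \<rho> (p i ` E)" if "i < n" "\<rho> (p i ` E) = 0" for i
    using rank_zero_cyclic[OF summand_mem] that by simp
  then show "{..<n} = full_summands n p \<union> (loop_summands n p \<union> coloop_summands n p)"
    "full_summands n p \<inter> (loop_summands n p \<union> coloop_summands n p) = {}"
    "loop_summands n p \<inter> coloop_summands n p = {}"
    unfolding full_summands_def loop_summands_def coloop_summands_def by auto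
qed

lemma finite_summands:
  "finite (full_summands n p)" "finite (loop_summands n p)" "finite (coloop_summands n p)"
  by (auto simp: full_summands_def loop_summands_def coloop_summands_def)

text \<open>Invariance makes \<open>V\<close> the direct sum of its components \<open>p i V\<close>.
  Applied to the loop space and to \<open>E\<close>, this turns sizes into numbers of
  summands.\<close>

lemma card_invariant_subspace:
  assumes V: "V \<in> subspaces E" and inv: "\<And>i x. i < n \<Longrightarrow> x \<in> V \<Longrightarrow> p i x \<in> V"
  shows "card V = (\<Prod>i<n. card (p i ` V))"
proof -
  have sV: "fv.subspace V" "V \<subseteq> E" using V by (simp_all add: subspaces_def)
  let ?h = "\<lambda>x. \<lambda>i\<in>{..<n}. p i x"
  have "bij_betw ?h V (\<Pi>\<^sub>E i\<in>{..<n}. p i ` V)"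
  proof (rule bij_betw_byWitness[where f' = "\<lambda>y. \<Sum>i<n. y i"])
    show "\<forall>x\<in>V. (\<Sum>i<n. ?h x i) = x" using decompositionD(4)[OF irreducible_decompositionD] sV by auto
    have *: "(\<Sum>i<n. y i) \<in> V \<and> ?h (\<Sum>i<n. y i) = y" if y: "y \<in> (\<Pi>\<^sub>E i\<in>{..<n}. p i ` V)" for y
    proof
      have yV: "y i \<in> V" if "i < n" for i 
      proof -
        have "y i \<in> p i ` V" using PiE_mem[OF y] that by simp
        then obtain v where "v \<in> V" "y i = p i v" by blast
        then show ?thesis using inv that by simp
      qed
      then show "(\<Sum>i<n. y i) \<in> V" by (intro fv.subspace_sum[OF sV(1)]) simp
      have "p i (\<Sum>j<n. y j) = y i" if i: "i < n" for i
      proof -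
        have "p i (\<Sum>j<n. y j) = (\<Sum>j<n. p i (y j))"
          using yV sV by (intro linear_map_on_apply_sum[OF decompositionD(1)[OF irreducible_decompositionD i] subspace_ground]) auto
        also have "\<dots> = (\<Sum>j<n. if i = j then y i else 0)"
        proof (rule sum.cong[OF refl])
          fix j assume "j \<in> {..<n}"
          then have j: "j < n" by simp
          then have "y j \<in> p j ` V" using PiE_mem[OF y] by simp
          then obtain v where v: "v \<in> E" "y j = p j v" using sV by blast
          show "p i (y j) = (if i = j then y i else 0)"
            using decompositionD(3)[OF irreducible_decompositionD i j v(1)] v(2) by auto
        qed
        also have "\<dots> = y i" using i by simp
        finally show ?thesis .
      qed
      then show "?h (\<Sum>i<n. y i) = y" using y by (intro ext) (auto simp: PiE_iff extensional_def)
    qed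
    show "\<forall>y\<in>(\<Pi>\<^sub>E i\<in>{..<n}. p i ` V). ?h (\<Sum>i<n. y i) = y" using * by blast
    show "(\<lambda>y. \<Sum>i<n. y i) ` (\<Pi>\<^sub>E i\<in>{..<n}. p i ` V) \<subseteq> V" using * by blast
  qed auto
  then have "card V = card (\<Pi>\<^sub>E i\<in>{..<n}. p i ` V)" by (rule bij_betw_same_card)
  then show ?thesis by (simp add: card_PiE)
qed

lemma prod_summands:
  "(\<Prod>i<n. f i) = (\<Prod>i\<in>full_summands n p. f i) *
    ((\<Prod>i\<in>loop_summands n p. f i) * (\<Prod>i\<in>coloop_summands n p. f i))"
  for f :: "nat \<Rightarrow> nat"
  unfolding summands_partition(1) using finite_summands summands_partition(2,3)
  by (simp add: prod.union_disjoint)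

text \<open>The loop space is invariant under the projections. Its component is the whole line in a
  loop summand and zero in every other summand, so its dimension counts the loop summands.\<close>

lemma card_loops: "card loops = CARD('f) ^ card (loop_summands n p)"
proof -
  have loop: "p i ` loops = p i ` E" if i: "i \<in> loop_summands n p" for i
  proof
    have in': "i < n" and r: "\<rho> (p i ` E) = 0" using i by (simp_all add: loop_summands_def)
    show "p i ` loops \<subseteq> p i ` E" by (auto simp: loops_def)
    show "p i ` E \<subseteq> p i ` loops"
    proof
      fix x assume x: "x \<in> p i ` E"
      then have "x \<in> loops" using loopsI summand_mem[OF in'] r by blast
      then show "x \<in> p i ` loops" using summand_fixed[OF in' x] by (metis imageI)
    qed
  qed
  have other: "card (p i ` loops) = 1" if i: "i < n" "\<rho> (p i ` E) \<noteq> 0" for i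
  proof -
    have "p i x = 0" if "x \<in> loops" for x
      using summand_loop_free[OF i] decomposition_loops[OF irreducible_decompositionD i(1) that] that by (auto simp: loops_def)
    moreover have "0 \<in> loops" using subspace_loops fv.subspace_0 by blast
    ultimately have "p i ` loops = {0}" by force
    then show ?thesis by simp
  qed
  have "card (p i ` loops) = CARD('f)" if i: "i \<in> loop_summands n p" for i
    using loop_summand[OF i] loop[OF i] card_span_singleton by metis
  moreover have "card (p i ` loops) = 1" if "i \<in> full_summands n p" for i
    using that other by (simp add: full_summands_def)
  moreover have "card (p i ` loops) = 1" if i: "i \<in> coloop_summands n p" for i
  proof -
    have "\<rho> (p i ` E) = 1" using coloop_summand[OF i] by metis
    then show ?thesis using i other by (simp add: coloop_summands_def)
  qed
  ultimately show ?thesis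
    using card_invariant_subspace[OF loops_mem decomposition_loops[OF irreducible_decompositionD]]
    by (simp add: prod_summands)
qed

lemma card_ground:
  "card E = (\<Prod>i\<in>full_summands n p. card (p i ` E)) *
    (CARD('f) ^ card (loop_summands n p) * CARD('f) ^ card (coloop_summands n p))"
proof -
  have "card (p i ` E) = CARD('f)" if i: "i \<in> loop_summands n p" for i
    using loop_summand[OF i] card_span_singleton by metis
  moreover have "card (p i ` E) = CARD('f)" if i: "i \<in> coloop_summands n p" for i
    using coloop_summand[OF i] card_span_singleton by metis
  ultimately show ?thesis
    using card_invariant_subspace[OF ground_mem decompositionD(2)[OF irreducible_decompositionD]] by (simp add: prod_summands)
qed

end

text \<open>Compressing \<open>r\<close> to \<open>p i E\<close> and using irreducibility yields one
  \<open>j\<close> for which \<open>p i r j\<close> is the identity there. It remains to exclude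
  that \<open>r j E\<close> is a loop or a coloop line.\<close>

lemma full_summand_partner:
  assumes ip: "irreducible_decomposition n p" and ir: "irreducible_decomposition m r"
    and i: "i \<in> full_summands n p"
  shows "\<exists>j\<in>full_summands m r. \<forall>x\<in>p i ` E. p i (r j x) = x"
proof -
  have i': "i < n" "cyclic \<rho> (p i ` E)" "\<rho> (p i ` E) \<noteq> 0" using i by (simp_all add: full_summands_def)
  note p = irreducible_decompositionD[OF ip] and r = irreducible_decompositionD[OF ir]
  note E' = summand_mem[OF ip i'(1)]
  interpret R: q_matroid "p i ` E" \<rho> using q_matroid_restrict[OF E'] .
  have "irreducible_qm (p i ` E, \<rho>)" "p i ` E \<noteq> {0}"
    using ip i' by (simp_all add: irreducible_decomposition_def)
  moreover have "decomposition (p i ` E) \<rho> m (\<lambda>j x. p i (r j x))"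
    using decomposition_compress(1)[OF p r i'(1,2) summand_loop_free[OF ip i'(1,3)]] .
  ultimately obtain j where j: "j < m" "\<And>x. x \<in> p i ` E \<Longrightarrow> p i (r j x) = x"
    using R.decomposition_irreducible by metis
  obtain x where x: "x \<in> p i ` E" "x \<noteq> 0" using summand_nonzero[OF ip i'(1)] .
  have xE: "x \<in> E" using summand_subset[OF ip i'(1) x(1)] .
  let ?F = "r j ` E" and ?X = "r j ` p i ` E"
  have X: "?X \<in> subspaces E" "cyclic \<rho> ?X"
    using decomposition_image_mem[OF r j(1) E'] decomposition_cyclic_image[OF r j(1) E' i'(2)] .
  have XF: "?X \<subseteq> ?F" using E' by (auto simp: subspaces_def)
  have rx: "r j x \<in> ?X" "r j x \<in> ?F" using x xE by blast+
  have rx0: "r j x \<noteq> 0"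
    using j(2)[OF x(1)] x(2) linear_map_on_0[OF decompositionD(1)[OF p i'(1)] subspace_ground] by metis
  have "\<rho> ?F \<noteq> 0"
  \<comment> \<open>If \<open>r j E\<close> had rank zero, \<open>r j x\<close> would be a loop, and
    so would \<open>x = p i (r j x)\<close>.\<close>
  proof
    assume "\<rho> ?F = 0"
    then have "r j x \<in> loops" using loopsI[OF rx(2) summand_mem[OF ir j(1)]] by simp
    then have "x \<in> loops" using decomposition_loops[OF p i'(1)] j(2)[OF x(1)] by metis
    then show False using summand_loop_free[OF ip i'(1,3) x(1)] x(2) by simp
  qed
  moreover have "cyclic \<rho> ?F"
  \<comment> \<open>A coloop line \<open>r j E\<close> would be filled by its nonzero subspace
    \<open>r j p i E\<close>, which is cyclic as the image of a cyclic space.\<close>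
  proof (rule ccontr)
    assume "\<not> ?thesis"
    then have "j \<in> coloop_summands m r" using j(1) by (simp add: coloop_summands_def)
    then obtain y where y: "?F = fv.span {y}" using coloop_summand[OF ir] by metis
    have "?F \<subseteq> fv.span {r j x}"
    proof -
      have "r j x \<in> range (\<lambda>c. fscale c y)" using rx(2) y by (simp only: fv.span_singleton)
      then obtain c where c: "r j x = fscale c y" by blast
      then have "c \<noteq> 0" using rx0 by auto
      then have "y = fscale (inverse c) (r j x)" using c by simp
      then have "y \<in> fv.span {r j x}" using fv.span_scale[OF fv.span_base[of "r j x" "{r j x}"]] by simp
      then show ?thesis unfolding y by (intro fv.span_minimal) auto
    qed
    moreover have "fv.span {r j x} \<subseteq> ?X"
      using rx(1) X(1) by (intro fv.span_minimal) (auto simp: subspaces_def)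
    ultimately have "?X = ?F" using XF by blast
    then show False using X(2) \<open>\<not> cyclic \<rho> ?F\<close> by simp
  qed
  ultimately have "j \<in> full_summands m r" using j(1) by (simp add: full_summands_def)
  then show ?thesis using j(2) by blast
qed

text \<open>For \<open>k \<noteq> i\<close> the vector \<open>p k (r j x)\<close> is a loop, but
  \<open>r j\<close> sends it back to \<open>r j x\<close>. Then \<open>x = p i (r j x)\<close>
  would be a nonzero loop in a loop-free summand.\<close>

lemma full_summand_partner_inverse:
  assumes ip: "irreducible_decomposition n p" and ir: "irreducible_decomposition m r"
    and i: "i \<in> full_summands n p" and j: "j < m" and k: "k < n"
    and ij: "\<forall>x\<in>p i ` E. p i (r j x) = x" and jk: "\<forall>y\<in>r j ` E. r j (p k y) = y"
  shows "k = i"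
proof (rule ccontr)
  assume ne: "k \<noteq> i"
  have i': "i < n" "cyclic \<rho> (p i ` E)" "\<rho> (p i ` E) \<noteq> 0" using i by (simp_all add: full_summands_def)
  note p = irreducible_decompositionD[OF ip] and r = irreducible_decompositionD[OF ir]
  obtain x where x: "x \<in> p i ` E" "x \<noteq> 0" using summand_nonzero[OF ip i'(1)] .
  have "p k (r j x) \<in> loops"
    using decomposition_compress(2)[OF p r i'(1,2) summand_loop_free[OF ip i'(1,3)] j k ne x(1)] .
  then have "r j (p k (r j x)) \<in> loops" using decomposition_loops[OF r j] by blast
  moreover have "r j (p k (r j x)) = r j x" using jk summand_subset[OF ip i'(1) x(1)] by blast
  ultimately have "p i (r j x) \<in> loops" using decomposition_loops[OF p i'(1)] by simp
  then have "x \<in> loops" using ij x(1) by simp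
  then show False using summand_loop_free[OF ip i'(1,3) x(1)] x(2) by simp
qed

text \<open>\<open>r j\<close> and \<open>p i\<close> restrict to mutually inverse maps between the
  two summands. Neither increases the rank of a subspace on which it is injective, so both preserve
  it.\<close>

lemma summands_equiv:
  assumes ip: "irreducible_decomposition n p" and ir: "irreducible_decomposition m r"
    and i: "i < n" and j: "j < m"
    and ij: "\<forall>x\<in>p i ` E. p i (r j x) = x" and ji: "\<forall>y\<in>r j ` E. r j (p i y) = y"
  shows "qm_equiv (p i ` E, \<rho>) (r j ` E, \<rho>)"
proof -
  note p = irreducible_decompositionD[OF ip] and r = irreducible_decompositionD[OF ir]
  have inj_r: "inj_on (r j) (p i ` E)" using ij by (intro inj_on_inverseI[of _ "p i"]) blast
  have inj_p: "inj_on (p i) (r j ` E)" using ji by (intro inj_on_inverseI[of _ "r j"]) blast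
  have sub: "p i ` E \<subseteq> E" "r j ` E \<subseteq> E"
    using summand_mem[OF ip i] summand_mem[OF ir j] by (simp_all add: subspaces_def)
  have "r j ` p i ` E = r j ` E"
  proof
    show "r j ` p i ` E \<subseteq> r j ` E" using sub by blast
    show "r j ` E \<subseteq> r j ` p i ` E"
    proof
      fix y assume y: "y \<in> r j ` E"
      have "y = r j (p i y)" using bspec[OF ji y] by simp
      then show "y \<in> r j ` p i ` E" using y sub by blast
    qed
  qed
  then have "bij_betw (r j) (p i ` E) (r j ` E)" using inj_r by (simp add: bij_betw_def)
  moreover have "linear_map_on (p i ` E) (r j)"
    using linear_map_on_subset[OF decompositionD(1)[OF r j] sub(1)] .
  moreover have "\<rho> (r j ` V) = \<rho> V" if V: "V \<in> subspaces (p i ` E)" for V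
  proof (rule antisym)
    have VE: "V \<in> subspaces E" using V sub(1) by (rule subspaces_trans)
    have Vp: "V \<subseteq> p i ` E" using V by (simp add: subspaces_def)
    show "\<rho> (r j ` V) \<le> \<rho> V"
      using decomposition_rank_image_le[OF r j VE inj_on_subset[OF inj_r Vp]] .
    have "r j ` V \<subseteq> r j ` E" using Vp sub by blast
    then have "\<rho> (p i ` r j ` V) \<le> \<rho> (r j ` V)"
      using decomposition_rank_image_le[OF p i decomposition_image_mem[OF r j VE]]
        inj_on_subset[OF inj_p] by blast
    moreover have "p i ` r j ` V = V"
    proof -
      have "(\<lambda>x. p i (r j x)) ` V = (\<lambda>x. x) ` V" using ij Vp by (intro image_cong) auto
      then show ?thesis by (simp add: image_image)
    qed
    ultimately show "\<rho> V \<le> \<rho> (r j ` V)" by simp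
  qed
  ultimately have "qm_iso (r j) (p i ` E, \<rho>) (r j ` E, \<rho>)" by (simp add: qm_iso_def)
  then show ?thesis using qm_equiv_iff_iso by blast
qed

text \<open>Partners are chosen in both directions independently;
  \<open>full_summand_partner_inverse\<close> shows that the two choices are inverse to each
  other.\<close>

lemma full_summands_bij:
  assumes ip: "irreducible_decomposition n p" and ir: "irreducible_decomposition m r"
  obtains \<sigma> where "bij_betw \<sigma> (full_summands n p) (full_summands m r)"
    "\<forall>i\<in>full_summands n p. qm_equiv (p i ` E, \<rho>) (r (\<sigma> i) ` E, \<rho>)"
proof -
  have lt: "i \<in> full_summands n p \<Longrightarrow> i < n" "j \<in> full_summands m r \<Longrightarrow> j < m" for i j
    by (simp_all add: full_summands_def)
  obtain \<sigma> where \<sigma>: "\<And>i. i \<in> full_summands n p \<Longrightarrow> \<sigma> i \<in> full_summands m r"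
    "\<And>i. i \<in> full_summands n p \<Longrightarrow> \<forall>x\<in>p i ` E. p i (r (\<sigma> i) x) = x"
    using full_summand_partner[OF ip ir] by metis
  obtain \<tau> where \<tau>: "\<And>j. j \<in> full_summands m r \<Longrightarrow> \<tau> j \<in> full_summands n p"
    "\<And>j. j \<in> full_summands m r \<Longrightarrow> \<forall>x\<in>r j ` E. r j (p (\<tau> j) x) = x"
    using full_summand_partner[OF ir ip] by metis
  have \<tau>\<sigma>: "\<tau> (\<sigma> i) = i" if i: "i \<in> full_summands n p" for i
    using full_summand_partner_inverse[OF ip ir i lt(2)[OF \<sigma>(1)[OF i]] lt(1)[OF \<tau>(1)[OF \<sigma>(1)[OF i]]]
        \<sigma>(2)[OF i] \<tau>(2)[OF \<sigma>(1)[OF i]]] .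
  have \<sigma>\<tau>: "\<sigma> (\<tau> j) = j" if j: "j \<in> full_summands m r" for j
    using full_summand_partner_inverse[OF ir ip j lt(1)[OF \<tau>(1)[OF j]] lt(2)[OF \<sigma>(1)[OF \<tau>(1)[OF j]]]
        \<tau>(2)[OF j] \<sigma>(2)[OF \<tau>(1)[OF j]]] .
  have "bij_betw \<sigma> (full_summands n p) (full_summands m r)"
    by (rule bij_betw_byWitness[where f' = \<tau>]) (use \<sigma>(1) \<tau>(1) \<tau>\<sigma> \<sigma>\<tau> in blast)+
  moreover have "qm_equiv (p i ` E, \<rho>) (r (\<sigma> i) ` E, \<rho>)" if i: "i \<in> full_summands n p" for i
    using summands_equiv[OF ip ir lt(1)[OF i] lt(2)[OF \<sigma>(1)[OF i]] \<sigma>(2)[OF i]]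
      \<tau>(2)[OF \<sigma>(1)[OF i]] \<tau>\<sigma>[OF i] by simp
  ultimately show ?thesis using that by blast
qed

lemma irreducible_decomposition_unique:
  assumes ip: "irreducible_decomposition n p" and ir: "irreducible_decomposition m r"
  shows "n = m \<and> (\<exists>\<sigma>. bij_betw \<sigma> {..<n} {..<m} \<and> (\<forall>i<n. qm_equiv (p i ` E, \<rho>) (r (\<sigma> i) ` E, \<rho>)))"
proof -
  obtain \<sigma> where \<sigma>: "bij_betw \<sigma> (full_summands n p) (full_summands m r)"
    "\<forall>i\<in>full_summands n p. qm_equiv (p i ` E, \<rho>) (r (\<sigma> i) ` E, \<rho>)"
    using full_summands_bij[OF ip ir] .
  have inj_pow: "a = b" if "CARD('f) ^ a = CARD('f) ^ b" for a b
    using that two_le_card_field[where 'f='f] by (metis Suc_1 Suc_le_lessD power_inject_exp)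
  have loop: "card (loop_summands n p) = card (loop_summands m r)"
    using inj_pow card_loops[OF ip] card_loops[OF ir] by simp
  have "card (p i ` E) = card (r (\<sigma> i) ` E)" if "i \<in> full_summands n p" for i
    using bspec[OF \<sigma>(2) that] bij_betw_same_card by (auto simp: qm_equiv_def)
  then have "(\<Prod>i\<in>full_summands n p. card (p i ` E)) = (\<Prod>i\<in>full_summands n p. card (r (\<sigma> i) ` E))"
    by (intro prod.cong) auto
  also have "\<dots> = (\<Prod>j\<in>full_summands m r. card (r j ` E))"
    by (rule prod.reindex_bij_betw[OF \<sigma>(1)])
  finally have eq: "(\<Prod>i\<in>full_summands n p. card (p i ` E)) = (\<Prod>j\<in>full_summands m r. card (r j ` E))" .
  have "E \<noteq> {}" using fv.subspace_0[OF subspace_ground] by blast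
  then have "(\<Prod>i\<in>full_summands n p. card (p i ` E)) \<noteq> 0"
    using finite_ground by (simp add: prod_zero_iff finite_summands(1)[OF ip])
  \<comment> \<open>Both size formulas for \<open>E\<close> share the nonzero factor from the full
    summands and the power from the loops; cancelling these leaves the coloops.\<close>
  then have "CARD('f) ^ card (coloop_summands n p) = CARD('f) ^ card (coloop_summands m r)"
    using card_ground[OF ip] card_ground[OF ir] eq loop by simp
  then have coloop: "card (coloop_summands n p) = card (coloop_summands m r)" by (rule inj_pow)
  \<comment> \<open>Arbitrary bijections suffice for loops and for coloops, as lines of equal rank
    are equivalent.\<close>
  obtain \<sigma>1 where \<sigma>1: "bij_betw \<sigma>1 (loop_summands n p) (loop_summands m r)"
    using finite_same_card_bij[OF finite_summands(2)[OF ip] finite_summands(2)[OF ir] loop] by blast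
  obtain \<sigma>2 where \<sigma>2: "bij_betw \<sigma>2 (coloop_summands n p) (coloop_summands m r)"
    using finite_same_card_bij[OF finite_summands(3)[OF ip] finite_summands(3)[OF ir] coloop] by blast
  define \<pi> where "\<pi> i = (if i \<in> full_summands n p then \<sigma> i
    else if i \<in> loop_summands n p then \<sigma>1 i else \<sigma>2 i)" for i
  have "bij_betw \<pi> {..<n} {..<m}"
    unfolding \<pi>_def summands_partition(1)[OF ip] summands_partition(1)[OF ir]
    using summands_partition(2,3)[OF ip] summands_partition(2,3)[OF ir] \<sigma>(1) \<sigma>1 \<sigma>2
    by (intro bij_betw_disjoint_Un)
  moreover have qm: "qmatroid (p i ` E, \<rho>)" if "i < n" for i
    using q_matroid_restrict[OF summand_mem[OF ip that]] q_matroid.qmatroid by blast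
  have qm': "qmatroid (r i ` E, \<rho>)" if "i < m" for i
    using q_matroid_restrict[OF summand_mem[OF ir that]] q_matroid.qmatroid by blast
  have "qm_equiv (p i ` E, \<rho>) (r (\<pi> i) ` E, \<rho>)" if i: "i < n" for i
  proof -
    have \<pi>m: "\<pi> i < m" using \<open>bij_betw \<pi> _ _\<close> i by (auto simp: bij_betw_def)
    consider "i \<in> full_summands n p" | "i \<in> loop_summands n p" | "i \<in> coloop_summands n p"
      using summands_partition(1)[OF ip] i by blast
    then show ?thesis
    proof cases
      case 1
      then show ?thesis using \<sigma>(2) by (simp add: \<pi>_def)
    next
      case 2
      then have "\<pi> i \<in> loop_summands m r"
        using summands_partition(2)[OF ip] \<sigma>1 by (auto simp: \<pi>_def bij_betw_def)
      then obtain y where y: "r (\<pi> i) ` E = fv.span {y}" "y \<noteq> 0" "\<rho> (r (\<pi> i) ` E) = 0"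
        using loop_summand[OF ir] by (metis (mono_tags, lifting) loop_summands_def mem_Collect_eq)
      obtain x where x: "p i ` E = fv.span {x}" "x \<noteq> 0" "\<rho> (p i ` E) = 0"
        using 2 loop_summand[OF ip] by (metis (mono_tags, lifting) loop_summands_def mem_Collect_eq)
      show ?thesis using qm_equiv_span_singleton[of x \<rho> y \<rho>] x y qm[OF i] qm'[OF \<pi>m] by simp
    next
      case 3
      then have "\<pi> i \<in> coloop_summands m r"
        using summands_partition(2,3)[OF ip] \<sigma>2 by (auto simp: \<pi>_def bij_betw_def)
      then obtain y where y: "r (\<pi> i) ` E = fv.span {y}" "y \<noteq> 0" "\<rho> (r (\<pi> i) ` E) = 1"
        using coloop_summand[OF ir] by metis
      obtain x where x: "p i ` E = fv.span {x}" "x \<noteq> 0" "\<rho> (p i ` E) = 1"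
        using 3 coloop_summand[OF ip] by metis
      show ?thesis using qm_equiv_span_singleton[of x \<rho> y \<rho>] x y qm[OF i] qm'[OF \<pi>m] by simp
    qed
  qed
  moreover have "n = m" using bij_betw_same_card[OF \<open>bij_betw \<pi> _ _\<close>] by simp
  ultimately show ?thesis by blast
qed

end

section \<open>Uniqueness for iterated direct sums\<close>

lemma dsum_list_irreducible_decomposition:
  fixes E :: "(nat \<Rightarrow> 'f::{field,finite}) set"
  assumes qm: "qmatroid (E, \<rho>)" and Ms: "Ms \<noteq> []" "\<forall>N\<in>set Ms. irreducible_qm N \<and> fst N \<noteq> {0}"
    and equiv: "qm_equiv (E, \<rho>) (dsum_list Ms)"
  obtains p where "q_matroid.irreducible_decomposition E \<rho> (length Ms) p"
    "\<forall>i<length Ms. qm_equiv (p i ` E, \<rho>) (Ms ! i)"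
proof -
  interpret q_matroid E \<rho> using qm by unfold_locales
  have "\<forall>N\<in>set Ms. qmatroid N" using Ms(2) by (simp add: irreducible_qm_def)
  then obtain p where p: "decomposition E \<rho> (length Ms) p"
    "\<forall>i<length Ms. qm_equiv (p i ` E, \<rho>) (Ms ! i)"
    using dsum_list_decomposition[OF Ms(1) _ qm equiv] by blast
  have "irreducible_qm (p i ` E, \<rho>) \<and> p i ` E \<noteq> {0}" if i: "i < length Ms" for i
  proof
    have N: "irreducible_qm (Ms ! i)" "fst (Ms ! i) \<noteq> {0}" using Ms(2) i by auto
    have eq: "qm_equiv (p i ` E, \<rho>) (Ms ! i)" using p(2) i by blast
    have mem: "p i ` E \<in> subspaces E" using decomposition_image_mem[OF p(1) i ground_mem] .
    then have "qmatroid (p i ` E, \<rho>)" using q_matroid_restrict q_matroid.qmatroid by blast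
    then show "irreducible_qm (p i ` E, \<rho>)" using qm_equiv_irreducible[OF _ eq N(1)] by blast
    obtain \<alpha> where \<alpha>: "qm_iso \<alpha> (p i ` E, \<rho>) (Ms ! i)" using eq qm_equiv_iff_iso by blast
    have "\<alpha> 0 = 0" using \<alpha> mem linear_map_on_0[of "p i ` E" \<alpha>] by (simp add: qm_iso_def subspaces_def)
    moreover have "\<alpha> ` p i ` E = fst (Ms ! i)" using \<alpha> by (simp add: qm_iso_def bij_betw_def)
    ultimately show "p i ` E \<noteq> {0}" using N(2) by (metis image_empty image_insert)
  qed
  then have "irreducible_decomposition (length Ms) p"
    using p(1) by (simp add: irreducible_decomposition_def)
  then show ?thesis using that p(2) by blast
qed

lemma dsum_list_unique:
  fixes E :: "(nat \<Rightarrow> 'f::{field,finite}) set"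
  assumes qm: "qmatroid (E, \<rho>)"
    and Ms: "Ms \<noteq> []" "\<forall>N\<in>set Ms. irreducible_qm N \<and> fst N \<noteq> {0}" "qm_equiv (E, \<rho>) (dsum_list Ms)"
    and Ns: "Ns \<noteq> []" "\<forall>N\<in>set Ns. irreducible_qm N \<and> fst N \<noteq> {0}" "qm_equiv (E, \<rho>) (dsum_list Ns)"
  shows "length Ns = length Ms \<and> (\<exists>\<sigma>. bij_betw \<sigma> {..<length Ms} {..<length Ms} \<and>
    (\<forall>i<length Ms. qm_equiv (Ms ! i) (Ns ! \<sigma> i)))"
proof -
  interpret q_matroid E \<rho> using qm by unfold_locales
  obtain p where p: "irreducible_decomposition (length Ms) p"
    "\<forall>i<length Ms. qm_equiv (p i ` E, \<rho>) (Ms ! i)"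
    using dsum_list_irreducible_decomposition[OF qm Ms] .
  obtain r where r: "irreducible_decomposition (length Ns) r"
    "\<forall>i<length Ns. qm_equiv (r i ` E, \<rho>) (Ns ! i)"
    using dsum_list_irreducible_decomposition[OF qm Ns] .
  obtain \<sigma> where len: "length Ms = length Ns" and \<sigma>: "bij_betw \<sigma> {..<length Ms} {..<length Ns}"
    "\<forall>i<length Ms. qm_equiv (p i ` E, \<rho>) (r (\<sigma> i) ` E, \<rho>)"
    using irreducible_decomposition_unique[OF p(1) r(1)] by blast
  have "qm_equiv (Ms ! i) (Ns ! \<sigma> i)" if i: "i < length Ms" for i
  proof -
    have "fv.subspace (p i ` E)" using summand_mem[OF p(1) i] by (simp add: subspaces_def)
    then have "qm_equiv (Ms ! i) (p i ` E, \<rho>)"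
      using qm_equiv_sym[OF p(2)[rule_format, OF i]] by simp
    moreover have "\<sigma> i < length Ns" using \<sigma>(1) i by (auto simp: bij_betw_def)
    ultimately show ?thesis
      using qm_equiv_trans[OF _ qm_equiv_trans[OF \<sigma>(2)[rule_format, OF i]]] r(2) by blast
  qed
  then show ?thesis using len \<sigma>(1) by auto
qed

theorem theorem7p15:
  fixes M :: "('f::{field,finite}) qm"
  assumes "qmatroid M"
  shows "(\<exists>Ms. Ms \<noteq> [] \<and> (\<forall>N\<in>set Ms. irreducible_qm N) \<and> qm_equiv M (dsum_list Ms))
    \<and> (\<forall>Ms Ns. Ms \<noteq> [] \<and> Ns \<noteq> [] \<and>
          (\<forall>N\<in>set Ms. irreducible_qm N \<and> fst N \<noteq> {0}) \<and>
          (\<forall>N\<in>set Ns. irreducible_qm N \<and> fst N \<noteq> {0}) \<and>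
          qm_equiv M (dsum_list Ms) \<and> qm_equiv M (dsum_list Ns)
        \<longrightarrow> length Ns = length Ms \<and>
            (\<exists>\<sigma>. bij_betw \<sigma> {..<length Ms} {..<length Ms} \<and>
                 (\<forall>i<length Ms. qm_equiv (Ms ! i) (Ns ! \<sigma> i))))"
proof -
  have "qmatroid (fst M, snd M)" using assms by simp
  note exists_irreducible_decomposition[OF this] and dsum_list_unique[OF this]
  then show ?thesis unfolding prod.collapse by (intro conjI[OF _ allI[OF allI[OF impI]]]) blast+
qed

end
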